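(* Let $a\in C(\mathbf{R})$ and suppose there are constants $a_1,a_2>0$ such that $$\frac{a_1}{1+|x|}\le a(x)\le \frac{a_2}{1+|x|},\qquad x\in\mathbf{R}.$$ Let $V\in C^1(\mathbf{R})$ be bounded with $V(x)>0$ and $xV'(x)\le 0$ for all $x\in\mathbf{R}$. Let $R>0$ and let $[u_0,u_1]\in H^1(\mathbf{R})\times L^2(\mathbf{R})$ satisfy $\operatorname{supp}u_0\cup\operatorname{supp}u_1\subset\{x:|x|\le R\}$. Then the Cauchy problem $$u_{tt}-u_{xx}+V(x)u+a(x)u_t=0\ \ \text{in }(0,\infty)\times\mathbf{R},\qquad u(0,x)=u_0(x),\ u_t(0,x)=u_1(x),$$ has a unique weak solution $u\in C([0,\infty);H^1(\mathbf{R}))\cap C^1([0,\infty);L^2(\mathbf{R}))$, this solution satisfies $u(t,x)=0$ for $|x|>R+t$, $t\ge0$, and: (1) if $0<a_1\le 2$, then for every sufficiently small $\delta>0$, $E(t)=O(t^{-a_1+\delta})$ as $t\to\infty$; (2) if $a_1>2$, then $E(t)=O(t^{-2})$ as $t\to\infty$.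
   Context: All functions are real-valued. The total energy of $u$ is $E(t)=\frac12\big(\|u_t(t,\cdot)\|^2+\|u_x(t,\cdot)\|^2+\|\sqrt{V}\,u(t,\cdot)\|^2\big)$, where $\|\cdot\|$ denotes the $L^2(\mathbf{R})$ norm. *)

theory Defs
  imports "HOL-Analysis.Analysis" "HOL-Library.Landau_Symbols"
begin

definition L2 :: "(real \<Rightarrow> real) \<Rightarrow> bool" where
  "L2 f \<longleftrightarrow> f \<in> borel_measurable lborel \<and> integrable lborel (\<lambda>x. (f x)\<^sup>2)"

definition L2norm :: "(real \<Rightarrow> real) \<Rightarrow> real" where
  "L2norm f = sqrt (\<integral>x. (f x)\<^sup>2 \<partial>lborel)"

definition smooth_fun :: "(real \<Rightarrow> real) \<Rightarrow> bool" where
  "smooth_fun \<phi> \<longleftrightarrow> (\<forall>n x. ((deriv ^^ n) \<phi>) differentiable (at x))"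

definition fsupp :: "(real \<Rightarrow> real) \<Rightarrow> real set" where
  "fsupp \<phi> = closure {x. \<phi> x \<noteq> 0}"

definition test_fun :: "(real \<Rightarrow> real) \<Rightarrow> bool" where
  "test_fun \<phi> \<longleftrightarrow> smooth_fun \<phi> \<and> compact (fsupp \<phi>)"

definition test_fun_pos :: "(real \<Rightarrow> real) \<Rightarrow> bool" where
  "test_fun_pos \<theta> \<longleftrightarrow> smooth_fun \<theta> \<and> compact (fsupp \<theta>) \<and> fsupp \<theta> \<subseteq> {0<..}"

definition weak_deriv :: "(real \<Rightarrow> real) \<Rightarrow> (real \<Rightarrow> real) \<Rightarrow> bool" where
  "weak_deriv f g \<longleftrightarrow> (\<forall>\<phi>. test_fun \<phi> \<longrightarrow>
      (\<integral>x. f x * deriv \<phi> x \<partial>lborel) = - (\<integral>x. g x * \<phi> x \<partial>lborel))"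

definition H1 :: "(real \<Rightarrow> real) \<Rightarrow> (real \<Rightarrow> real) \<Rightarrow> bool" where
  "H1 f g \<longleftrightarrow> L2 f \<and> L2 g \<and> weak_deriv f g"

definition L2_cont :: "(real \<Rightarrow> real \<Rightarrow> real) \<Rightarrow> bool" where
  "L2_cont w \<longleftrightarrow> (\<forall>t\<ge>0. L2 (w t)) \<and>
     (\<forall>t0\<ge>0. ((\<lambda>t. L2norm (\<lambda>x. w t x - w t0 x)) \<longlongrightarrow> 0) (at t0 within {0..}))"

definition weak_solution ::
  "(real \<Rightarrow> real) \<Rightarrow> (real \<Rightarrow> real) \<Rightarrow> (real \<Rightarrow> real) \<Rightarrow> (real \<Rightarrow> real) \<Rightarrow>
   (real \<Rightarrow> real \<Rightarrow> real) \<Rightarrow> (real \<Rightarrow> real \<Rightarrow> real) \<Rightarrow> (real \<Rightarrow> real \<Rightarrow> real) \<Rightarrow> bool" where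
  "weak_solution a V u0 u1 u ut ux \<longleftrightarrow>
     \<comment> \<open>u \<in> C([0,infinity);H^1)\<close>
     L2_cont u \<and> L2_cont ux \<and> (\<forall>t\<ge>0. H1 (u t) (ux t)) \<and>
     \<comment> \<open>u \<in> C^1([0,infinity);L^2) with derivative ut\<close>
     L2_cont ut \<and>
     (\<forall>t0\<ge>0. ((\<lambda>t. L2norm (\<lambda>x. (u t x - u t0 x) / (t - t0) - ut t0 x)) \<longlongrightarrow> 0)
                (at t0 within {0..})) \<and>
     \<comment> \<open>the equation, in the sense of distributions on (0,infinity) \<times> R\<close>
     (\<forall>\<phi> \<theta>. test_fun \<phi> \<longrightarrow> test_fun_pos \<theta> \<longrightarrow>
        - (\<integral>t. deriv \<theta> t * (\<integral>x. ut t x * \<phi> x \<partial>lborel) \<partial>lborel)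
        + (\<integral>t. \<theta> t * ((\<integral>x. ux t x * deriv \<phi> x \<partial>lborel)
                        + (\<integral>x. V x * u t x * \<phi> x \<partial>lborel)
                        + (\<integral>x. a x * ut t x * \<phi> x \<partial>lborel)) \<partial>lborel) = 0) \<and>
     \<comment> \<open>initial data\<close>
     (AE x in lborel. u 0 x = u0 x) \<and> (AE x in lborel. ut 0 x = u1 x)"

definition energy ::
  "(real \<Rightarrow> real) \<Rightarrow> (real \<Rightarrow> real \<Rightarrow> real) \<Rightarrow> (real \<Rightarrow> real \<Rightarrow> real) \<Rightarrow>
   (real \<Rightarrow> real \<Rightarrow> real) \<Rightarrow> real \<Rightarrow> real" where
  "energy V u ut ux t = (1/2) * ((L2norm (ut t))\<^sup>2 + (L2norm (ux t))\<^sup>2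
        + (L2norm (\<lambda>x. sqrt (V x) * u t x))\<^sup>2)"

end

theory Submission
  imports Defs
begin

text \<open>
  Everything takes place in the Hilbert space of square-integrable functions modulo null sets. A weak
  derivative is the generator of the translation group, and translations are isometries, so it is
  skew-adjoint; this replaces all integrations by parts. Existence follows from a Picard iteration for
  \<open>u\<^sub>t \<plusminus> u\<^sub>x\<close> along characteristics, which also yields finite propagation speed. Put \<open>W(t) = \<integral>\<^sub>0\<^sup>t u\<close>.
  The equation integrated in time can be tested with \<open>u\<close> and gives
  \<open>1/2 d/dt (\<parallel>u\<parallel>\<^sup>2 + \<parallel>W\<^sub>x\<parallel>\<^sup>2 + \<langle>V W, W\<rangle>) + \<langle>a u, u\<rangle> = \<langle>u\<^sub>1 + a u\<^sub>0, u\<rangle>\<close>; for zero data this is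
  uniqueness, and for compactly supported data positivity of \<open>V\<close> lets the left-hand side absorb the
  right-hand side, so that \<open>\<langle>a u, u\<rangle>\<close> is integrable in time. For \<open>k = min a\<^sub>1 2\<close> the multiplier
  \<open>s\<^sup>k u\<^sub>t + (k/2) s\<^sup>k\<^sup>-\<^sup>1 u\<close> with \<open>s\<close> equal to \<open>t\<close> plus a constant then bounds \<open>s\<^sup>k E(t)\<close>, because
  \<open>s a \<ge> k\<close> on the support of \<open>u\<close>. It is applied to time averages of the solution, which are strong
  solutions.
\<close>

subsection \<open>The Hilbert space of square-integrable functions\<close>

text \<open>Two separate effects limit the exponent \<open>k\<close>. Testing with
  \<open>s^k u_t\<close> leaves \<open>(k/2) s^(k-1)\<close> times the sum of
  \<open>|u_t|^2\<close>, \<open>|u_x|^2\<close> and \<open>V u^2\<close>, and the damping controls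
  only the first of these. Adding \<open>(k/2) s^(k-1) u\<close> exchanges the last two for a second
  \<open>(k/2) s^(k-1) |u_t|^2\<close>. The total \<open>k s^(k-1) |u_t|^2\<close> is dominated by
  \<open>s^k a |u_t|^2\<close>, since finite speed keeps the support where
  \<open>1 + |x| <= s\<close>; this requires \<open>k <= a_1\<close>. The remaining corrections are
  at most of size \<open>s^(k-2) a u^2\<close>, and the time integral of \<open>a u^2\<close>
  absorbs them as long as that weight is bounded; this requires \<open>k <= 2\<close>. The obstacle
  is regularity: \<open>u_t\<close> is merely square-integrable in space, so a weak solution cannot
  be tested with it. Integration in time moves the test down to \<open>u\<close>; averaging in time
  makes \<open>u_t\<close> weakly differentiable. Integration in time creates the source
  \<open>u_1 + a u_0\<close>. It is written as \<open>V G\<close> with \<open>G\<close> of compact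
  support, so that its time-integrated pairing with \<open>u\<close> is \<open><V G, W>\<close>,
  which \<open><V W, W>\<close> and the constant \<open><V G, G>\<close> control uniformly in
  time.\<close>

lemma L2_borel_measurable: "L2 f \<Longrightarrow> f \<in> borel_measurable borel"
  by (simp add: L2_def)

lemma L2_integrable_square: "L2 f \<Longrightarrow> integrable lborel (\<lambda>x. (f x)\<^sup>2)"
  by (simp add: L2_def)

lemma L2_integrable_mult:
  assumes "L2 f" "L2 g"
  shows "integrable lborel (\<lambda>x. f x * g x)"
proof (rule Bochner_Integration.integrable_bound)
  show "integrable lborel (\<lambda>x. (f x)\<^sup>2 + (g x)\<^sup>2)"
    using assms by (simp add: L2_def)
  show "(\<lambda>x. f x * g x) \<in> borel_measurable lborel"
    using assms by (auto simp: L2_def)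
  have "\<bar>a * b\<bar> \<le> a\<^sup>2 + b\<^sup>2" for a b :: real
  proof -
    have "0 \<le> (\<bar>a\<bar> - \<bar>b\<bar>)\<^sup>2" "0 \<le> \<bar>a\<bar> * \<bar>b\<bar>" by simp_all
    then have "2 * \<bar>a\<bar> * \<bar>b\<bar> \<le> a\<^sup>2 + b\<^sup>2" "0 \<le> \<bar>a\<bar> * \<bar>b\<bar>" by (simp_all add: power2_diff)
    then show ?thesis unfolding abs_mult by linarith
  qed
  then show "AE x in lborel. norm (f x * g x) \<le> norm ((f x)\<^sup>2 + (g x)\<^sup>2)"
    by simp
qed

lemma L2_zero: "L2 (\<lambda>x. 0)"
  by (simp add: L2_def)

lemma L2_add:
  assumes "L2 f" "L2 g"
  shows "L2 (\<lambda>x. f x + g x)"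
  using assms L2_integrable_mult[OF assms]
  by (auto simp: L2_def power2_sum mult.assoc)

lemma L2_scale: "L2 f \<Longrightarrow> L2 (\<lambda>x. c * f x)"
  by (auto simp: L2_def power_mult_distrib)

lemma L2_uminus: "L2 f \<Longrightarrow> L2 (\<lambda>x. - f x)"
  using L2_scale[of f "-1"] by simp

lemma L2_diff: "L2 f \<Longrightarrow> L2 g \<Longrightarrow> L2 (\<lambda>x. f x - g x)"
  using L2_add[OF _ L2_uminus, of f g] by simp

lemma L2_bound:
  assumes "L2 f" "g \<in> borel_measurable lborel" "\<And>x. \<bar>g x\<bar> \<le> \<bar>c * f x\<bar>"
  shows "L2 g"
  unfolding L2_def
proof
  show "integrable lborel (\<lambda>x. (g x)\<^sup>2)"
  proof (rule Bochner_Integration.integrable_bound)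
    show "integrable lborel (\<lambda>x. (c * f x)\<^sup>2)"
      using L2_scale[OF assms(1)] by (rule L2_integrable_square)
    show "AE x in lborel. norm ((g x)\<^sup>2) \<le> norm ((c * f x)\<^sup>2)"
      using assms(3) by (simp add: abs_le_square_iff)
  qed (use assms in simp)
qed fact

text \<open>Membership on both sides makes this a partial equivalence relation whose domain is
  exactly the square-integrable functions, so the quotient contains no other classes.\<close>

definition L2_eq :: "(real \<Rightarrow> real) \<Rightarrow> (real \<Rightarrow> real) \<Rightarrow> bool" where
  "L2_eq f g \<longleftrightarrow> L2 f \<and> L2 g \<and> (AE x in lborel. f x = g x)"

quotient_type lsq = "real \<Rightarrow> real" / partial: L2_eq
proof (rule part_equivpI)
  show "\<exists>x. L2_eq x x" by (rule exI[of _ "\<lambda>x. 0"]) (simp add: L2_eq_def L2_zero)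
  show "symp L2_eq" by (auto simp: symp_def L2_eq_def elim: AE_mp)
  show "transp L2_eq"
    unfolding transp_def L2_eq_def by (auto elim: AE_mp)
qed

lemma L2_eq_refl: "L2 f \<Longrightarrow> L2_eq f f"
  by (simp add: L2_eq_def)

lemma abs_lsq_eq_iff:
  assumes "L2 f" "L2 g"
  shows "abs_lsq f = abs_lsq g \<longleftrightarrow> (AE x in lborel. f x = g x)"
  using Quotient3_rel[OF Quotient3_lsq, of f g] assms by (simp add: L2_eq_def)

lemma abs_lsq_rep [simp]: "abs_lsq (rep_lsq f) = f"
  by (rule Quotient3_abs_rep[OF Quotient3_lsq])

lemma L2_rep: "L2 (rep_lsq f)"
  using Quotient3_rep_reflp[OF Quotient3_lsq, of f] by (simp add: L2_eq_def)

lemma rep_abs_lsq: "L2 f \<Longrightarrow> AE x in lborel. rep_lsq (abs_lsq f) x = f x"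
  using abs_lsq_eq_iff[OF L2_rep, of f "abs_lsq f"] by simp

instantiation lsq :: ab_group_add
begin

lift_definition zero_lsq :: lsq is "\<lambda>x. 0"
  by (simp add: L2_eq_def L2_zero)

lift_definition plus_lsq :: "lsq \<Rightarrow> lsq \<Rightarrow> lsq" is "\<lambda>f g x. f x + g x"
  by (auto simp: L2_eq_def L2_add)

lift_definition minus_lsq :: "lsq \<Rightarrow> lsq \<Rightarrow> lsq" is "\<lambda>f g x. f x - g x"
  by (auto simp: L2_eq_def L2_diff)

lift_definition uminus_lsq :: "lsq \<Rightarrow> lsq" is "\<lambda>f x. - f x"
  by (auto simp: L2_eq_def L2_uminus)

instance
  by standard (transfer; simp add: L2_eq_def L2_add L2_diff L2_uminus L2_zero algebra_simps)+

end

instantiation lsq :: real_vector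
begin

lift_definition scaleR_lsq :: "real \<Rightarrow> lsq \<Rightarrow> lsq" is "\<lambda>c f x. c * f x"
  by (auto simp: L2_eq_def L2_scale)

instance
  by standard (transfer; simp add: L2_eq_def L2_add L2_scale algebra_simps)+

end

instantiation lsq :: real_inner
begin

lift_definition inner_lsq :: "lsq \<Rightarrow> lsq \<Rightarrow> real" is "\<lambda>f g. \<integral>x. f x * g x \<partial>lborel"
  by (rule integral_cong_AE) (auto simp: L2_eq_def L2_def)

definition norm_lsq :: "lsq \<Rightarrow> real" where
  "norm_lsq f = sqrt (inner f f)"

definition dist_lsq :: "lsq \<Rightarrow> lsq \<Rightarrow> real" where
  "dist_lsq f g = norm (f - g)"

definition sgn_lsq :: "lsq \<Rightarrow> lsq" where
  "sgn_lsq f = f /\<^sub>R norm f"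

definition uniformity_lsq :: "(lsq \<times> lsq) filter" where
  "uniformity_lsq = (INF e\<in>{0<..}. principal {(x, y). dist x y < e})"

definition open_lsq :: "lsq set \<Rightarrow> bool" where
  "open_lsq U \<longleftrightarrow> (\<forall>x\<in>U. eventually (\<lambda>(x', y). x' = x \<longrightarrow> y \<in> U) uniformity)"

instance
proof
  fix a :: real and x y z :: lsq
  show "inner x y = inner y x"
    by transfer (simp add: mult.commute)
  show "inner (x + y) z = inner x z + inner y z"
    by transfer
      (simp add: L2_eq_def L2_integrable_mult distrib_right flip: Bochner_Integration.integral_add)
  show "inner (a *\<^sub>R x) y = a * inner x y"
    by transfer (simp add: mult.assoc)
  show "0 \<le> inner x x"
    by transfer simp
  show "(inner x x = 0) = (x = 0)"
  proof transfer
    fix f assume "L2_eq f f"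
    then have f: "L2 f" by (simp add: L2_eq_def)
    then show "((\<integral>x. f x * f x \<partial>lborel) = 0) = L2_eq f (\<lambda>x. 0)"
      using integral_nonneg_eq_0_iff_AE[OF L2_integrable_mult[OF f f]] by (simp add: L2_eq_def L2_zero)
  qed
qed (simp_all add: dist_lsq_def norm_lsq_def sgn_lsq_def uniformity_lsq_def open_lsq_def)

end

lemma abs_lsq_add: "L2 f \<Longrightarrow> L2 g \<Longrightarrow> abs_lsq (\<lambda>x. f x + g x) = abs_lsq f + abs_lsq g"
  by (simp add: plus_lsq.abs_eq L2_eq_refl)

lemma abs_lsq_diff: "L2 f \<Longrightarrow> L2 g \<Longrightarrow> abs_lsq (\<lambda>x. f x - g x) = abs_lsq f - abs_lsq g"
  by (simp add: minus_lsq.abs_eq L2_eq_refl)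

lemma abs_lsq_scale: "L2 f \<Longrightarrow> abs_lsq (\<lambda>x. c * f x) = c *\<^sub>R abs_lsq f"
  by (simp add: scaleR_lsq.abs_eq L2_eq_refl)

lemma inner_abs_lsq:
  "L2 f \<Longrightarrow> L2 g \<Longrightarrow> inner (abs_lsq f) (abs_lsq g) = (\<integral>x. f x * g x \<partial>lborel)"
  by (simp add: inner_lsq.abs_eq L2_eq_refl)

lemma norm_abs_lsq: "L2 f \<Longrightarrow> norm (abs_lsq f) = L2norm f"
  by (simp add: norm_eq_sqrt_inner inner_abs_lsq L2norm_def power2_eq_square)

lemma abs_lsq_cong: "L2 f \<Longrightarrow> L2 g \<Longrightarrow> AE x in lborel. f x = g x \<Longrightarrow> abs_lsq f = abs_lsq g"
  by (simp add: abs_lsq_eq_iff)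

text \<open>Riesz--Fischer. The weights \<open>2 ^ n\<close> turn the fast decay of the increments in norm into
  pointwise summability almost everywhere.\<close>

lemma rapid_Cauchy_convergent_lsq:
  fixes X :: "nat \<Rightarrow> lsq"
  assumes "\<And>n. norm (X (Suc n) - X n) \<le> (1/2)^n"
  shows "convergent X"
proof -
  define f where "f n = rep_lsq (X n)" for n
  define d where "d n = (\<lambda>x. f (Suc n) x - f n x)" for n
  have f: "L2 (f n)" and fX: "abs_lsq (f n) = X n" for n
    by (simp_all add: f_def L2_rep)
  have d: "L2 (d n)" for n unfolding d_def by (intro L2_diff f)
  have [measurable]: "f n \<in> borel_measurable borel" "d n \<in> borel_measurable borel" for n
    using f d by (simp_all add: L2_borel_measurable)
  have nd: "(\<integral>x. (d n x)\<^sup>2 \<partial>lborel) \<le> (1/4)^n" for n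
  proof -
    have "abs_lsq (d n) = X (Suc n) - X n"
      unfolding d_def using f by (simp add: abs_lsq_diff fX)
    then have "L2norm (d n) \<le> (1/2)^n"
      using norm_abs_lsq[OF d, of n] assms[of n] by simp
    then have "(L2norm (d n))\<^sup>2 \<le> ((1/2)^n)\<^sup>2"
      by (intro power_mono) (simp_all add: L2norm_def)
    then show ?thesis
      by (simp add: L2norm_def power2_eq_square flip: power_mult_distrib)
  qed
  have "AE x in lborel. summable (\<lambda>n. 2^n * (d n x)\<^sup>2)"
  proof -
    have "(\<integral>\<^sup>+x. (\<Sum>n. ennreal (2^n * (d n x)\<^sup>2)) \<partial>lborel)
        = (\<Sum>n. \<integral>\<^sup>+x. ennreal (2^n * (d n x)\<^sup>2) \<partial>lborel)"
      by (rule nn_integral_suminf) simp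
    also have "\<dots> \<le> (\<Sum>n. ennreal ((1/2)^n))"
    proof (intro suminf_le summableI)
      fix n
      have "(\<integral>\<^sup>+x. ennreal (2^n * (d n x)\<^sup>2) \<partial>lborel) = ennreal (\<integral>x. 2^n * (d n x)\<^sup>2 \<partial>lborel)"
        using L2_integrable_square[OF d] by (intro nn_integral_eq_integral) auto
      also have "\<dots> \<le> ennreal (2^n * (1/4)^n)"
        using nd[of n] by (simp add: ennreal_leI)
      also have "2^n * (1/4)^n = ((1/2)^n :: real)"
        by (simp flip: power_mult_distrib)
      finally show "(\<integral>\<^sup>+x. ennreal (2^n * (d n x)\<^sup>2) \<partial>lborel) \<le> ennreal ((1/2)^n)" .
    qed
    also have "\<dots> = ennreal (\<Sum>n. (1/2)^n)"
      by (rule suminf_ennreal2) (simp_all add: summable_geometric)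
    also have "\<dots> < \<infinity>" by simp
    finally have "AE x in lborel. (\<Sum>n. ennreal (2^n * (d n x)\<^sup>2)) \<noteq> \<infinity>"
      by (intro nn_integral_noteq_infinite) (auto simp: less_top)
    then show ?thesis
    proof eventually_elim
      case (elim x)
      show ?case by (rule summable_suminf_not_top) (use elim in simp_all)
    qed
  qed
  then have AE_conv: "AE x in lborel. convergent (\<lambda>n. f n x)"
  proof eventually_elim
    case (elim x)
    have "summable (\<lambda>n. d n x)"
    proof (rule summable_comparison_test')
      show "summable (\<lambda>n. 2^n * (d n x)\<^sup>2 + (1/2)^n)"
        by (intro summable_add elim summable_geometric) simp
      fix n :: nat assume "n \<ge> 0"
      \<comment> \<open>Arithmetic-geometric mean inequality with weight \<open>2^n\<close>: twice
        \<open>|d n x|\<close> is at most the sum of two summable terms.\<close>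
      have "0 \<le> (2^n * \<bar>d n x\<bar> - 1)\<^sup>2 / 2^n" by simp
      also have "\<dots> = 2^n * (d n x)\<^sup>2 - 2 * \<bar>d n x\<bar> + (1/2)^n"
        by (simp add: power2_eq_square field_simps)
      finally show "norm (d n x) \<le> 2^n * (d n x)\<^sup>2 + (1/2)^n" by simp
    qed
    then have "convergent (\<lambda>n. \<Sum>i<n. d i x)"
      by (simp add: summable_iff_convergent)
    moreover have "(\<Sum>i<n. d i x) = f n x - f 0 x" for n
      by (induction n) (simp_all add: d_def)
    ultimately have "convergent (\<lambda>n. f n x - f 0 x)" by simp
    from convergent_add[OF this convergent_const[of "f 0 x"]] show ?case by simp
  qed
  \<comment> \<open>Where the sequence diverges, \<open>lim\<close> is an unspecified value;
    measurability survives, and divergence is confined to a null set.\<close>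
  define g where "g x = lim (\<lambda>n. f n x)" for x
  have [measurable]: "g \<in> borel_measurable borel"
    unfolding g_def by (rule borel_measurable_lim_metric) simp
  have dist_bound: "norm (X (m + n) - X n) \<le> 2 * (1/2)^n" for m n
  proof -
    \<comment> \<open>The subtracted term shrinks in each step by exactly the size allowed for the
      next increment, which lets the induction on \<open>m\<close> close.\<close>
    have "norm (X (m + n) - X n) \<le> 2 * (1/2)^n - 2 * (1/2)^(m + n)"
    proof (induction m)
      case (Suc m)
      have "norm (X (Suc m + n) - X n) \<le> norm (X (Suc (m + n)) - X (m + n)) + norm (X (m + n) - X n)"
        using norm_triangle_ineq[of "X (Suc (m + n)) - X (m + n)" "X (m + n) - X n"] by simp
      with Suc assms[of "m + n"] show ?case by simp
    qed simp
    then show ?thesis by (rule order_trans) simp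
  qed
  \<comment> \<open>Fatou's lemma sends the first index of the Cauchy estimate to infinity. The
    bound yields both the square-integrability of \<open>g - f n\<close> and the rate of
    convergence.\<close>
  have fatou: "(\<integral>\<^sup>+x. ennreal ((g x - f n x)\<^sup>2) \<partial>lborel) \<le> ennreal (4 * (1/4)^n)" for n
  proof -
    have "(\<integral>\<^sup>+x. ennreal ((g x - f n x)\<^sup>2) \<partial>lborel)
        = (\<integral>\<^sup>+x. liminf (\<lambda>m. ennreal ((f (m + n) x - f n x)\<^sup>2)) \<partial>lborel)"
    proof (rule nn_integral_cong_AE)
      show "AE x in lborel. ennreal ((g x - f n x)\<^sup>2) = liminf (\<lambda>m. ennreal ((f (m + n) x - f n x)\<^sup>2))"
        using AE_conv
      proof eventually_elim
        case (elim x)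
        then have "(\<lambda>m. f m x) \<longlonglongrightarrow> g x"
          unfolding g_def by (simp add: convergent_LIMSEQ_iff)
        then have "(\<lambda>m. f (m + n) x) \<longlonglongrightarrow> g x" by (rule LIMSEQ_ignore_initial_segment)
        then have "(\<lambda>m. ennreal ((f (m + n) x - f n x)\<^sup>2)) \<longlonglongrightarrow> ennreal ((g x - f n x)\<^sup>2)"
          by (intro tendsto_intros)
        then show ?case by (rule lim_imp_Liminf[OF trivial_limit_sequentially, symmetric])
      qed
    qed
    also have "\<dots> \<le> liminf (\<lambda>m. \<integral>\<^sup>+x. ennreal ((f (m + n) x - f n x)\<^sup>2) \<partial>lborel)"
      by (rule nn_integral_liminf) simp
    also have "\<dots> \<le> liminf (\<lambda>m. ennreal (4 * (1/4)^n))"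
    proof (intro Liminf_mono always_eventually allI)
      fix m
      have L: "L2 (\<lambda>x. f (m + n) x - f n x)" by (intro L2_diff f)
      have "abs_lsq (\<lambda>x. f (m + n) x - f n x) = X (m + n) - X n"
        using f by (simp add: abs_lsq_diff fX)
      then have "L2norm (\<lambda>x. f (m + n) x - f n x) \<le> 2 * (1/2)^n"
        using norm_abs_lsq[OF L] dist_bound[of m n] by simp
      then have "(L2norm (\<lambda>x. f (m + n) x - f n x))\<^sup>2 \<le> (2 * (1/2)^n)\<^sup>2"
        by (intro power_mono) (simp_all add: L2norm_def)
      then have "(\<integral>x. (f (m + n) x - f n x)\<^sup>2 \<partial>lborel) \<le> 4 * (1/4)^n"
        by (simp add: L2norm_def power_mult_distrib) (simp add: power2_eq_square flip: power_mult_distrib)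
      then show "(\<integral>\<^sup>+x. ennreal ((f (m + n) x - f n x)\<^sup>2) \<partial>lborel) \<le> ennreal (4 * (1/4)^n)"
        by (subst nn_integral_eq_integral) (auto intro: L2_integrable_square L ennreal_leI)
    qed
    also have "\<dots> = ennreal (4 * (1/4)^n)" by (simp add: Liminf_const)
    finally show ?thesis .
  qed
  have gL: "L2 (\<lambda>x. g x - f n x)" for n
    unfolding L2_def
  proof
    show "integrable lborel (\<lambda>x. (g x - f n x)\<^sup>2)"
      using fatou[of n] by (intro integrableI_bounded) (auto intro: le_less_trans)
  qed simp
  have g: "L2 g" using L2_add[OF gL[of 0] f[of 0]] by simp
  have "norm (X n - abs_lsq g) \<le> 2 * (1/2)^n" for n
  proof -
    have "norm (X n - abs_lsq g) = L2norm (\<lambda>x. g x - f n x)"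
      using norm_abs_lsq[OF gL, of n] g f by (simp add: abs_lsq_diff fX norm_minus_commute)
    also have "\<dots> \<le> sqrt ((2 * (1/2)^n)\<^sup>2)"
      unfolding L2norm_def
    proof (rule real_sqrt_le_mono)
      have "ennreal (\<integral>x. (g x - f n x)\<^sup>2 \<partial>lborel) = (\<integral>\<^sup>+x. ennreal ((g x - f n x)\<^sup>2) \<partial>lborel)"
        by (rule nn_integral_eq_integral[symmetric]) (auto intro: L2_integrable_square gL)
      also have "\<dots> \<le> ennreal (4 * (1/4)^n)" by (rule fatou)
      finally have "(\<integral>x. (g x - f n x)\<^sup>2 \<partial>lborel) \<le> 4 * (1/4)^n" by simp
      then show "(\<integral>x. (g x - f n x)\<^sup>2 \<partial>lborel) \<le> (2 * (1/2)^n)\<^sup>2"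
        by (simp add: power_mult_distrib) (simp add: power2_eq_square flip: power_mult_distrib)
    qed
    finally show ?thesis unfolding real_sqrt_abs by simp
  qed
  moreover have "(\<lambda>n. 2 * (1/2)^n :: real) \<longlonglongrightarrow> 0"
    by (intro tendsto_mult_right_zero LIMSEQ_power_zero) simp
  ultimately have "(\<lambda>n. X n - abs_lsq g) \<longlonglongrightarrow> 0"
    by (rule Lim_null_comparison[OF always_eventually[OF allI]])
  then have "X \<longlonglongrightarrow> abs_lsq g" by (rule LIM_zero_cancel)
  then show ?thesis by (auto simp: convergent_def)
qed

instance lsq :: banach
proof
  fix X :: "nat \<Rightarrow> lsq" assume X: "Cauchy X"
  have "\<exists>N. \<forall>m\<ge>N. \<forall>n\<ge>N. norm (X m - X n) < (1/2)^k" for k :: nat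
    using X[unfolded Cauchy_iff] by simp
  then obtain N where N: "\<And>k m n. m \<ge> N k \<Longrightarrow> n \<ge> N k \<Longrightarrow> norm (X m - X n) < (1/2)^k"
    by metis
  \<comment> \<open>The sum makes \<open>r k\<close> dominate \<open>N k\<close>, and the summand
    \<open>k\<close> makes \<open>r\<close> strictly increasing.\<close>
  define r where "r k = (\<Sum>i\<le>k. N i) + k" for k
  have rN: "r k \<ge> N k" for k
  proof -
    have "N k \<le> (\<Sum>i\<le>k. N i)" by (rule member_le_sum) simp_all
    then show ?thesis by (simp add: r_def)
  qed
  have rS: "strict_mono r" by (rule strict_monoI_Suc) (simp add: r_def)
  have "convergent (X \<circ> r)"
  proof (rule rapid_Cauchy_convergent_lsq)
    fix k
    have "r (Suc k) \<ge> N k" using rN[of k] rS by (meson lessI less_imp_le order_trans strict_monoD)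
    then show "norm ((X \<circ> r) (Suc k) - (X \<circ> r) k) \<le> (1/2)^k"
      using N[of k "r (Suc k)" "r k"] rN[of k] by simp
  qed
  then obtain l where "(X \<circ> r) \<longlonglongrightarrow> l" by (auto simp: convergent_def)
  then have "X \<longlonglongrightarrow> l" using X rS by (metis Cauchy_converges_subseq)
  then show "convergent X" by (auto simp: convergent_def)
qed

subsection \<open>Multiplication and translation operators\<close>

text \<open>Dominated convergence for the squares \<open>(F n x - f x)^2\<close> with majorant
  \<open>(w x + |f x|)^2\<close>. The density, translation and test-function arguments all turn
  pointwise into norm convergence in this way.\<close>

lemma abs_lsq_dominated:
  assumes w: "L2 w" and f: "L2 f" and F: "\<And>n. F n \<in> borel_measurable borel"
    and bound: "\<And>n x. \<bar>F n x\<bar> \<le> w x"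
    and lim: "AE x in lborel. (\<lambda>n. F n x) \<longlonglongrightarrow> f x"
  shows "L2 (F n)" and "(\<lambda>n. abs_lsq (F n)) \<longlonglongrightarrow> abs_lsq f"
proof -
  have FL: "L2 (F n)" for n
  proof (rule L2_bound[OF w, where c = 1])
    show "\<bar>F n x\<bar> \<le> \<bar>1 * w x\<bar>" for x using bound[of n x] by simp
  qed (use F in simp)
  then show "L2 (F n)" .
  have [measurable]: "w \<in> borel_measurable borel" "f \<in> borel_measurable borel" "F n \<in> borel_measurable borel" for n
    using w f FL by (simp_all add: L2_borel_measurable)
  have "(\<lambda>n. \<integral>x. (F n x - f x)\<^sup>2 \<partial>lborel) \<longlonglongrightarrow> (\<integral>x. 0 \<partial>(lborel :: real measure))"
  proof (rule integral_dominated_convergence[where w = "\<lambda>x. (w x + \<bar>f x\<bar>)\<^sup>2"])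
    have "L2 (\<lambda>x. \<bar>f x\<bar>)" by (rule L2_bound[OF f, of _ 1]) auto
    then show "integrable lborel (\<lambda>x. (w x + \<bar>f x\<bar>)\<^sup>2)"
      by (intro L2_integrable_square L2_add w)
    show "AE x in lborel. (\<lambda>n. (F n x - f x)\<^sup>2) \<longlonglongrightarrow> 0"
      using lim
    proof eventually_elim
      case (elim x)
      then have "(\<lambda>n. (F n x - f x)\<^sup>2) \<longlonglongrightarrow> (f x - f x)\<^sup>2" by (intro tendsto_intros)
      then show ?case by simp
    qed
    show "AE x in lborel. norm ((F n x - f x)\<^sup>2) \<le> (w x + \<bar>f x\<bar>)\<^sup>2" for n
    proof (rule AE_I2)
      fix x
      have "\<bar>F n x - f x\<bar> \<le> w x + \<bar>f x\<bar>" using bound[of n x] by linarith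
      then have "\<bar>F n x - f x\<bar>\<^sup>2 \<le> (w x + \<bar>f x\<bar>)\<^sup>2" by (intro power_mono) auto
      then show "norm ((F n x - f x)\<^sup>2) \<le> (w x + \<bar>f x\<bar>)\<^sup>2" by simp
    qed
  qed simp_all
  then have "(\<lambda>n. sqrt (\<integral>x. (F n x - f x)\<^sup>2 \<partial>lborel)) \<longlonglongrightarrow> sqrt 0"
    by (intro tendsto_real_sqrt) simp
  moreover have "norm (abs_lsq (F n) - abs_lsq f) = sqrt (\<integral>x. (F n x - f x)\<^sup>2 \<partial>lborel)" for n
    using norm_abs_lsq[OF L2_diff[OF FL f], of n] FL f by (simp add: abs_lsq_diff L2norm_def)
  ultimately have "(\<lambda>n. norm (abs_lsq (F n) - abs_lsq f)) \<longlonglongrightarrow> 0" by simp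
  then show "(\<lambda>n. abs_lsq (F n)) \<longlonglongrightarrow> abs_lsq f"
    by (rule LIM_zero_cancel[OF tendsto_norm_zero_cancel])
qed

definition bmeas :: "(real \<Rightarrow> real) \<Rightarrow> bool" where
  "bmeas b \<longleftrightarrow> b \<in> borel_measurable borel \<and> bounded (range b)"

text \<open>The factor acts on a chosen representative; for \<open>bmeas b\<close> the choice is
  immaterial by \<open>mul_abs_lsq\<close>. For other \<open>b\<close> the product need not be
  square-integrable and the value carries no meaning.\<close>

definition mul :: "(real \<Rightarrow> real) \<Rightarrow> lsq \<Rightarrow> lsq" where
  "mul b f = abs_lsq (\<lambda>x. b x * rep_lsq f x)"

lemma bmeas_indicator: "A \<in> sets borel \<Longrightarrow> bmeas (indicator A)"
  by (auto simp: bmeas_def bounded_iff indicator_def intro!: exI[of _ 1])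

lemma bmeas_times: "bmeas b \<Longrightarrow> bmeas c \<Longrightarrow> bmeas (\<lambda>x. b x * c x)"
  unfolding bmeas_def bounded_iff
proof (elim conjE exE, intro conjI)
  fix B C assume B: "\<forall>x\<in>range b. norm x \<le> B" and C: "\<forall>x\<in>range c. norm x \<le> C"
  have "norm (b x * c x) \<le> B * C" for x
    using B C by (auto simp: abs_mult intro!: mult_mono)
  then show "\<exists>D. \<forall>y\<in>range (\<lambda>x. b x * c x). norm y \<le> D" by blast
qed simp

lemma bmeas_shift: "bmeas b \<Longrightarrow> bmeas (\<lambda>x. b (x + s))"
  unfolding bmeas_def bounded_iff by auto

lemma L2_mul:
  assumes "bmeas b" "L2 f"
  shows "L2 (\<lambda>x. b x * f x)"
proof -
  obtain B where B: "\<And>x. \<bar>b x\<bar> \<le> B" using assms(1) by (auto simp: bmeas_def bounded_iff)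
  show ?thesis
  proof (rule L2_bound[OF assms(2), of _ B])
    show "(\<lambda>x. b x * f x) \<in> borel_measurable lborel"
      using assms by (auto simp: bmeas_def L2_def)
    show "\<bar>b x * f x\<bar> \<le> \<bar>B * f x\<bar>" for x
      using B[of x] by (auto simp: abs_mult intro!: mult_right_mono)
  qed
qed

lemma mul_abs_lsq:
  assumes "bmeas b" "L2 f"
  shows "mul b (abs_lsq f) = abs_lsq (\<lambda>x. b x * f x)"
  unfolding mul_def using rep_abs_lsq[OF assms(2)]
  by (intro abs_lsq_cong L2_mul assms L2_rep) (auto elim: AE_mp)

lemma lsq_cases:
  obtains f' where "L2 f'" "f = abs_lsq f'"
  by (metis L2_rep abs_lsq_rep)

lemma norm_mul_le:
  assumes b: "bmeas b" and B: "\<And>x. \<bar>b x\<bar> \<le> B"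
  shows "norm (mul b f) \<le> B * norm f"
proof -
  obtain f' where f: "L2 f'" "f = abs_lsq f'" by (rule lsq_cases)
  have B0: "0 \<le> B" using B[of 0] by simp
  have "(L2norm (\<lambda>x. b x * f' x)) \<le> sqrt (\<integral>x. B\<^sup>2 * (f' x)\<^sup>2 \<partial>lborel)"
    unfolding L2norm_def
  proof (rule real_sqrt_le_mono, rule integral_mono)
    show "(b x * f' x)\<^sup>2 \<le> B\<^sup>2 * (f' x)\<^sup>2" for x
      using power_mono[OF B abs_ge_zero, of x 2] by (auto simp: power_mult_distrib intro!: mult_right_mono)
  qed (use f b in \<open>auto intro: L2_integrable_square L2_mul\<close>)
  also have "\<dots> = B * L2norm f'" using B0 by (simp add: L2norm_def real_sqrt_mult)
  finally show ?thesis using f b by (simp add: mul_abs_lsq norm_abs_lsq L2_mul)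
qed

lemma bounded_linear_mul:
  assumes b: "bmeas b"
  shows "bounded_linear (mul b)"
proof -
  obtain B where B: "\<And>x. \<bar>b x\<bar> \<le> B" using b by (auto simp: bmeas_def bounded_iff)
  show ?thesis
  proof (rule bounded_linear_intro[where K = B])
    fix f g :: lsq and c :: real
    obtain f' where f: "L2 f'" "f = abs_lsq f'" by (rule lsq_cases)
    obtain g' where g: "L2 g'" "g = abs_lsq g'" by (rule lsq_cases)
    show "mul b (f + g) = mul b f + mul b g"
      using f g b
      by (simp add: mul_abs_lsq L2_add L2_mul distrib_left flip: abs_lsq_add)
    show "mul b (c *\<^sub>R f) = c *\<^sub>R mul b f"
      using f b
      by (simp add: mul_abs_lsq L2_scale L2_mul mult.left_commute flip: abs_lsq_scale)
    show "norm (mul b f) \<le> norm f * B"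
      using norm_mul_le[OF b B, of f] by (simp add: mult.commute)
  qed
qed

lemma inner_mul_left:
  assumes "bmeas b"
  shows "inner (mul b f) g = inner f (mul b g)"
proof -
  obtain f' where f: "L2 f'" "f = abs_lsq f'" by (rule lsq_cases)
  obtain g' where g: "L2 g'" "g = abs_lsq g'" by (rule lsq_cases)
  show ?thesis using assms f g
    by (simp add: mul_abs_lsq inner_abs_lsq L2_mul mult.commute mult.left_commute)
qed

lemma mul_mul:
  assumes "bmeas b" "bmeas c"
  shows "mul b (mul c f) = mul (\<lambda>x. b x * c x) f"
proof -
  obtain f' where f: "L2 f'" "f = abs_lsq f'" by (rule lsq_cases)
  show ?thesis using assms f
    by (simp add: mul_abs_lsq L2_mul bmeas_times mult.assoc)
qed

lemma inner_mul_nonneg: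
  assumes b: "bmeas b" and "\<And>x. 0 \<le> b x"
  shows "0 \<le> inner (mul b f) f"
proof -
  obtain f' where f: "L2 f'" "f = abs_lsq f'" by (rule lsq_cases)
  then show ?thesis using assms
    by (simp add: mul_abs_lsq inner_abs_lsq L2_mul mult.assoc)
qed

text \<open>Only the values of \<open>b\<close> on a set that carries \<open>f\<close> count. With
  the support at time \<open>t\<close> as \<open>A\<close>, this turns the decaying lower bound of
  the damping into a bound of order \<open>1 / s\<close>.\<close>

lemma inner_mul_ge:
  assumes b: "bmeas b" and A: "A \<in> sets borel" and c: "\<And>x. x \<in> A \<Longrightarrow> c \<le> b x"
    and f: "mul (indicator A) f = f"
  shows "c * (norm f)\<^sup>2 \<le> inner (mul b f) f"
proof -
  obtain f' where f': "L2 f'" "f = abs_lsq f'" by (rule lsq_cases)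
  have L: "L2 (\<lambda>x. indicator A x * f' x)" by (intro L2_mul bmeas_indicator A f')
  have eq: "f = abs_lsq (\<lambda>x. indicator A x * f' x)"
    using f f' A by (simp add: mul_abs_lsq bmeas_indicator)
  have "c * (norm f)\<^sup>2 = (\<integral>x. c * (indicator A x * f' x)\<^sup>2 \<partial>lborel)"
    unfolding eq using L by (simp add: norm_abs_lsq L2norm_def)
  also have "\<dots> \<le> (\<integral>x. (b x * (indicator A x * f' x)) * (indicator A x * f' x) \<partial>lborel)"
  proof (rule integral_mono)
    show "c * (indicator A x * f' x)\<^sup>2 \<le> (b x * (indicator A x * f' x)) * (indicator A x * f' x)" for x
      using c[of x] by (auto simp: indicator_def power2_eq_square mult.assoc intro!: mult_right_mono)
  qed (use L b in \<open>auto intro!: L2_integrable_square L2_integrable_mult L2_mul[OF b]\<close>)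
  also have "\<dots> = inner (mul b f) f"
    unfolding eq using L b by (simp add: mul_abs_lsq inner_abs_lsq L2_mul)
  finally show ?thesis .
qed

lemma mul_indicator_eq_iff:
  assumes "A \<in> sets borel"
  shows "mul (indicator A) f = f \<longleftrightarrow> (AE x in lborel. x \<notin> A \<longrightarrow> rep_lsq f x = 0)"
proof -
  have "mul (indicator A) f = f \<longleftrightarrow> abs_lsq (\<lambda>x. indicator A x * rep_lsq f x) = abs_lsq (rep_lsq f)"
    by (simp add: mul_def)
  also have "\<dots> \<longleftrightarrow> (AE x in lborel. indicator A x * rep_lsq f x = rep_lsq f x)"
    by (rule abs_lsq_eq_iff[OF L2_mul[OF bmeas_indicator[OF assms] L2_rep] L2_rep])
  also have "\<dots> \<longleftrightarrow> (AE x in lborel. x \<notin> A \<longrightarrow> rep_lsq f x = 0)"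
    by (intro AE_cong) (auto simp: indicator_def)
  finally show ?thesis .
qed

section \<open>The translation group\<close>

definition tr :: "real \<Rightarrow> lsq \<Rightarrow> lsq" where
  "tr s f = abs_lsq (\<lambda>x. rep_lsq f (x + s))"

lemma L2_shift:
  assumes "L2 f"
  shows "L2 (\<lambda>x. f (x + s))"
  using assms lborel_integrable_real_affine[of "\<lambda>x. (f x)\<^sup>2" 1 s]
  by (auto simp: L2_def add.commute)

text \<open>Translates of null sets are null, which makes \<open>tr\<close> independent of the
  representative.\<close>

lemma AE_shift:
  assumes "AE x in lborel. P x"
  shows "AE x in lborel. P (x + s :: real)"
proof -
  obtain N where N: "{x \<in> space lborel. \<not> P x} \<subseteq> N" "N \<in> null_sets lborel"
    using assms by (auto elim!: AE_E3 simp: eventually_ae_filter)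
  then have "AE x in lborel. x \<notin> N" by (rule_tac AE_not_in)
  then have "AE x in lborel. s + 1 * x \<notin> N"
    using N by (intro AE_borel_affine) auto
  then show ?thesis by eventually_elim (use N(1) in \<open>auto simp: add.commute\<close>)
qed

lemma tr_abs_lsq:
  assumes "L2 f"
  shows "tr s (abs_lsq f) = abs_lsq (\<lambda>x. f (x + s))"
  unfolding tr_def using AE_shift[OF rep_abs_lsq[OF assms]]
  by (intro abs_lsq_cong L2_shift assms L2_rep)

lemma integral_shift: "(\<integral>x. f (x + s) \<partial>lborel) = (\<integral>x. f x \<partial>lborel)" for f :: "real \<Rightarrow> real"
  using lborel_integral_real_affine[of 1 f s] by (simp add: add.commute)

lemma inner_tr_tr: "inner (tr s f) (tr s g) = inner f g"
proof -
  obtain f' where f: "L2 f'" "f = abs_lsq f'" by (rule lsq_cases)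
  obtain g' where g: "L2 g'" "g = abs_lsq g'" by (rule lsq_cases)
  show ?thesis using f g integral_shift[of "\<lambda>x. f' x * g' x" s]
    by (simp add: tr_abs_lsq inner_abs_lsq L2_shift)
qed

lemma norm_tr [simp]: "norm (tr s f) = norm f"
  by (simp add: norm_eq_sqrt_inner inner_tr_tr)

lemma bounded_linear_tr: "bounded_linear (tr s)"
proof (rule bounded_linear_intro[where K = 1])
  fix f g :: lsq and c :: real
  obtain f' where f: "L2 f'" "f = abs_lsq f'" by (rule lsq_cases)
  obtain g' where g: "L2 g'" "g = abs_lsq g'" by (rule lsq_cases)
  show "tr s (f + g) = tr s f + tr s g"
    using f g by (simp add: tr_abs_lsq L2_add L2_shift flip: abs_lsq_add)
  show "tr s (c *\<^sub>R f) = c *\<^sub>R tr s f"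
    using f by (simp add: tr_abs_lsq L2_scale L2_shift flip: abs_lsq_scale)
qed simp

lemma tr_0 [simp]: "tr 0 f = f"
  by (simp add: tr_def)

lemma tr_tr [simp]: "tr s (tr t f) = tr (s + t) f"
proof -
  obtain f' where f: "L2 f'" "f = abs_lsq f'" by (rule lsq_cases)
  then show ?thesis by (simp add: tr_abs_lsq L2_shift add.assoc)
qed

lemma inner_tr_left: "inner (tr s f) g = inner f (tr (- s) g)"
  using inner_tr_tr[of s f "tr (- s) g"] by simp

lemma tr_mul:
  assumes "bmeas b"
  shows "tr s (mul b f) = mul (\<lambda>x. b (x + s)) (tr s f)"
proof -
  obtain f' where f: "L2 f'" "f = abs_lsq f'" by (rule lsq_cases)
  then show ?thesis using assms by (simp add: tr_abs_lsq mul_abs_lsq L2_shift L2_mul bmeas_shift)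
qed

section \<open>Density of continuous functions and strong continuity of translations\<close>

lemma L2_bounded_interval:
  assumes "f \<in> borel_measurable borel" "\<And>x. \<bar>f x\<bar> \<le> B * indicator {-L..L} x"
  shows "L2 f"
proof (rule L2_bound[of "indicator {-L..L}" f B])
  have "(\<lambda>x. (indicator {-L..L} x :: real)\<^sup>2) = indicator {-L..L}"
    by (auto simp: indicator_def)
  then show "L2 (indicator {-L..L})" by (simp add: L2_def integrable_real_indicator emeasure_lborel_Icc_eq)
  show "\<bar>f x\<bar> \<le> \<bar>B * indicator {- L..L} x\<bar>" for x using assms(2)[of x] by linarith
qed (use assms in simp)

text \<open>Truncation in height and in space reduces to a bounded function of bounded support,
  which off a negligible set is a pointwise limit of continuous functions. Clamping these and
  cutting them off supplies the majorant for dominated convergence.\<close>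

lemma continuous_dense_lsq:
  fixes f :: lsq
  assumes "0 < e"
  obtains g B L where "continuous_on UNIV g" "\<And>x. \<bar>g x\<bar> \<le> B * indicator {-L..L} x"
    "L2 g" "norm (f - abs_lsq g) < e"
proof -
  define f0 where "f0 = rep_lsq f"
  have f0: "L2 f0" "abs_lsq f0 = f" by (simp_all add: f0_def L2_rep)
  have [measurable]: "f0 \<in> borel_measurable borel" using f0 by (simp add: L2_borel_measurable)
  define F where "F n x = max (- real n) (min (real n) (f0 x)) * indicator {- real n..real n} x" for n x
  have w: "L2 (\<lambda>x. \<bar>f0 x\<bar>)" by (rule L2_bound[OF f0(1), of _ 1]) auto
  have F_meas [measurable]: "F n \<in> borel_measurable borel" for n unfolding F_def by measurable
  have F_le: "\<bar>F n x\<bar> \<le> \<bar>f0 x\<bar>" for n x unfolding F_def by (auto simp: indicator_def)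
  have F_le': "\<bar>F n x\<bar> \<le> real n * indicator {- real n..real n} x" for n x
    unfolding F_def by (auto simp: indicator_def)
  have "(\<lambda>n. F n x) \<longlonglongrightarrow> f0 x" for x
  proof (rule tendsto_eventually)
    obtain N :: nat where N: "\<bar>f0 x\<bar> + \<bar>x\<bar> \<le> real N" using real_arch_simple by blast
    show "\<forall>\<^sub>F n in sequentially. F n x = f0 x"
      using eventually_ge_at_top[of N]
    proof eventually_elim
      case (elim n)
      then have "\<bar>f0 x\<bar> + \<bar>x\<bar> \<le> real n" using N by linarith
      then show ?case unfolding F_def by (auto simp: indicator_def)
    qed
  qed
  then have "(\<lambda>n. abs_lsq (F n)) \<longlonglongrightarrow> abs_lsq f0"
    by (intro abs_lsq_dominated[OF w f0(1) F_meas F_le]) simp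
  then have "\<forall>\<^sub>F n in sequentially. dist (abs_lsq (F n)) f < e / 2"
    using assms f0 by (intro tendstoD) auto
  then obtain n where n: "dist (abs_lsq (F n)) f < e / 2" by (auto simp: eventually_sequentially)
  have Fn: "L2 (F n)" by (rule abs_lsq_dominated(1)[OF w f0(1) F_meas F_le]) (use \<open>\<And>x. (\<lambda>n. F n x) \<longlonglongrightarrow> f0 x\<close> in simp)
  have "F n measurable_on UNIV"
    by (intro lebesgue_measurable_imp_measurable_on) (auto intro: measurable_completion)
  then obtain N g where N: "negligible N" and g: "\<And>k. continuous_on UNIV (g k)"
    and glim: "\<And>x. x \<notin> N \<Longrightarrow> (\<lambda>k. g k x) \<longlonglongrightarrow> F n x"
    by (auto simp: measurable_on_def)
  define M where "M = real n"
  \<comment> \<open>The second factor is \<open>1\<close> on \<open>[-M, M]\<close> and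
    \<open>0\<close> outside \<open>[-(M+1), M+1]\<close>. Since \<open>F n\<close> is bounded by
    \<open>M\<close> and vanishes off \<open>[-M, M]\<close>, neither factor changes the
    limit.\<close>
  define G where "G k x = max (- M) (min M (g k x)) * max 0 (min 1 (M + 1 - \<bar>x\<bar>))" for k x
  have G_cont: "continuous_on UNIV (G k)" for k
    unfolding G_def using g by (intro continuous_intros)
  have M0: "0 \<le> M" by (simp add: M_def)
  have G_le: "\<bar>G k x\<bar> \<le> M * indicator {-(M+1)..M+1} x" for k x
  proof -
    have "\<bar>max (- M) (min M (g k x))\<bar> \<le> M" using M0 by auto
    moreover have "\<bar>max 0 (min 1 (M + 1 - \<bar>x\<bar>))\<bar> \<le> indicator {-(M+1)..M+1} x"
      by (auto simp: indicator_def)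
    ultimately show ?thesis unfolding G_def abs_mult using M0 by (intro mult_mono) auto
  qed
  have G_meas: "G k \<in> borel_measurable borel" for k
    by (rule borel_measurable_continuous_onI[OF G_cont])
  have wM: "L2 (\<lambda>x. M * indicator {-(M+1)..M+1} x)"
    by (rule L2_bounded_interval[of _ M "M+1"]) (use M0 in \<open>auto simp: indicator_def\<close>)
  have Glim: "AE x in lborel. (\<lambda>k. G k x) \<longlonglongrightarrow> F n x"
  proof -
    have "AE x in lebesgue. x \<notin> N" using N by (intro AE_not_in) (simp add: negligible_iff_null_sets)
    then have "AE x in lborel. x \<notin> N" by (simp add: AE_completion_iff)
    then show ?thesis
    proof eventually_elim
      case (elim x)
      then have "(\<lambda>k. G k x) \<longlonglongrightarrow> max (- M) (min M (F n x)) * max 0 (min 1 (M + 1 - \<bar>x\<bar>))"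
        unfolding G_def using glim by (intro tendsto_intros) auto
      also have "max (- M) (min M (F n x)) * max 0 (min 1 (M + 1 - \<bar>x\<bar>)) = F n x"
        unfolding F_def M_def by (auto simp: indicator_def)
      finally show ?case .
    qed
  qed
  have "(\<lambda>k. abs_lsq (G k)) \<longlonglongrightarrow> abs_lsq (F n)"
    by (rule abs_lsq_dominated(2)[OF wM Fn G_meas G_le Glim])
  then have "\<forall>\<^sub>F k in sequentially. dist (abs_lsq (G k)) (abs_lsq (F n)) < e / 2"
    using assms by (intro tendstoD) auto
  then obtain k where k: "dist (abs_lsq (G k)) (abs_lsq (F n)) < e / 2"
    by (auto simp: eventually_sequentially)
  have "dist f (abs_lsq (G k)) < e"
    by (rule dist_triangle_half_r[OF n]) (use k in \<open>simp add: dist_commute\<close>)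
  moreover have "L2 (G k)" by (rule abs_lsq_dominated(1)[OF wM Fn G_meas G_le Glim])
  ultimately show thesis using that[OF G_cont G_le] by (simp add: dist_norm)
qed

text \<open>Translations are isometries, so approximating \<open>f\<close> approximates
  \<open>tr s f\<close> uniformly in \<open>s\<close>, and uniform limits preserve continuity. For
  continuous functions of bounded support the claim is dominated convergence.\<close>

lemma continuous_on_tr: "continuous_on UNIV (\<lambda>s. tr s f)"
proof -
  have "\<exists>g. (\<exists>g' B L. continuous_on UNIV g' \<and> (\<forall>x. \<bar>g' x\<bar> \<le> B * indicator {-L..L} x) \<and> L2 g' \<and> g = abs_lsq g')
      \<and> norm (f - g) < 1 / Suc n" for n
    using continuous_dense_lsq[of "1 / Suc n" f] by (metis of_nat_0_less_iff zero_less_Suc zero_less_divide_1_iff)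
  then obtain g where g: "\<And>n. \<exists>g' B L. continuous_on UNIV g' \<and> (\<forall>x. \<bar>g' x\<bar> \<le> B * indicator {-L..L} x) \<and> L2 g' \<and> g n = abs_lsq g'"
    and gf: "\<And>n. norm (f - g n) < 1 / Suc n" by metis
  have lim: "uniform_limit UNIV (\<lambda>n s. tr s (g n)) (\<lambda>s. tr s f) sequentially"
  proof (rule uniform_limitI)
    fix e :: real assume e: "0 < e"
    then have "\<forall>\<^sub>F n in sequentially. inverse (real (Suc n)) < e"
      using order_tendstoD(2)[OF LIMSEQ_inverse_real_of_nat] by blast
    then show "\<forall>\<^sub>F n in sequentially. \<forall>s\<in>UNIV. dist (tr s (g n)) (tr s f) < e"
    proof eventually_elim
      case (elim n)
      have "dist (tr s (g n)) (tr s f) = norm (f - g n)" for s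
        unfolding dist_norm linear_diff[OF bounded_linear.linear[OF bounded_linear_tr], symmetric]
        by (simp add: norm_minus_commute)
      then show ?case using gf[of n] elim by (auto simp: inverse_eq_divide)
    qed
  qed
  have cont: "continuous_on UNIV (\<lambda>s. tr s (g n))" for n
  proof -
    obtain g' B L where g': "continuous_on UNIV g'" "\<And>x. \<bar>g' x\<bar> \<le> B * indicator {-L..L} x" "L2 g'" "g n = abs_lsq g'"
      using g[of n] by blast
    have B: "\<bar>g' x\<bar> \<le> \<bar>B\<bar>" for x
      using g'(2)[of x] by (cases "x \<in> {-L..L}") auto
    have L: "g' x = 0" if "\<bar>x\<bar> > L" for x
      using g'(2)[of x] that by (cases "x \<in> {-L..L}") auto
    show ?thesis
    proof (rule continuous_at_imp_continuous_on, intro ballI)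
      fix s :: real
      show "isCont (\<lambda>s. tr s (g n)) s"
        unfolding isCont_def tendsto_at_iff_sequentially comp_def
      proof (intro allI impI)
        fix X :: "nat \<Rightarrow> real" assume "X \<longlonglongrightarrow> s"
        \<comment> \<open>Bounded shifts keep all translates inside the single interval
          \<open>[-(L+K), L+K]\<close>, on which a constant is a square-integrable majorant.\<close>
        then obtain K where K: "\<And>i. \<bar>X i\<bar> \<le> K"
          by (metis Bseq_def convergentI convergent_imp_Bseq real_norm_def)
        have "(\<lambda>i. abs_lsq (\<lambda>x. g' (x + X i))) \<longlonglongrightarrow> abs_lsq (\<lambda>x. g' (x + s))"
        proof (rule abs_lsq_dominated(2))
          show "L2 (\<lambda>x. \<bar>B\<bar> * indicator {-(L+K)..L+K} x)"
            by (rule L2_bounded_interval[of _ "\<bar>B\<bar>" "L+K"]) (auto simp: indicator_def)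
          show "L2 (\<lambda>x. g' (x + s))" by (intro L2_shift g')
          show "(\<lambda>x. g' (x + X i)) \<in> borel_measurable borel" for i
            using L2_shift[OF g'(3)] by (rule L2_borel_measurable)
          show "\<bar>g' (x + X i)\<bar> \<le> \<bar>B\<bar> * indicator {- (L + K)..L + K} x" for i x
          proof (cases "\<bar>x\<bar> \<le> L + K")
            case True then show ?thesis using B[of "x + X i"] by (auto simp: indicator_def)
          next
            case False
            then have "\<bar>x + X i\<bar> > L" using K[of i] by linarith
            then show ?thesis using L by (auto simp: indicator_def)
          qed
          show "AE x in lborel. (\<lambda>i. g' (x + X i)) \<longlonglongrightarrow> g' (x + s)"
          proof (rule AE_I2)
            fix x
            have "(\<lambda>i. x + X i) \<longlonglongrightarrow> x + s" using \<open>X \<longlonglongrightarrow> s\<close> by (intro tendsto_intros)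
            moreover have "isCont g' (x + s)" using g'(1) by (simp add: continuous_on_eq_continuous_at)
            ultimately show "(\<lambda>i. g' (x + X i)) \<longlonglongrightarrow> g' (x + s)" by (rule isCont_tendsto_compose[rotated])
          qed
        qed
        then show "(\<lambda>i. tr (X i) (g n)) \<longlonglongrightarrow> tr s (g n)" using g'(3,4) by (simp add: tr_abs_lsq)
      qed
    qed
  qed
  show ?thesis by (rule uniform_limit_theorem[OF _ lim]) (simp_all add: cont)
qed

text \<open>Strong continuity of \<open>tr\<close> concerns one fixed argument. Joint continuity
  follows because the error \<open>tr (r t') (F t' - F t)\<close> has the norm of
  \<open>F t' - F t\<close>.\<close>

lemma continuous_on_tr_compose:
  assumes r: "continuous_on S r" and F: "continuous_on S F"
  shows "continuous_on S (\<lambda>t. tr (r t) (F t))"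
  unfolding continuous_on_def
proof (intro ballI)
  fix t assume t: "t \<in> S"
  have "((\<lambda>t'. tr (r t') (F t)) \<longlongrightarrow> tr (r t) (F t)) (at t within S)"
    using continuous_on_compose2[OF continuous_on_tr r] t by (simp add: continuous_on_def)
  moreover have "((\<lambda>t'. tr (r t') (F t' - F t)) \<longlongrightarrow> 0) (at t within S)"
  proof (rule tendsto_norm_zero_cancel)
    have "((\<lambda>t'. F t' - F t) \<longlongrightarrow> 0) (at t within S)"
      using F t by (intro LIM_zero) (simp add: continuous_on_def)
    then show "((\<lambda>t'. norm (tr (r t') (F t' - F t))) \<longlongrightarrow> 0) (at t within S)"
      by (simp add: tendsto_norm_zero)
  qed
  ultimately have "((\<lambda>t'. tr (r t') (F t) + tr (r t') (F t' - F t)) \<longlongrightarrow> tr (r t) (F t) + 0) (at t within S)"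
    by (rule tendsto_add)
  then show "((\<lambda>t'. tr (r t') (F t')) \<longlongrightarrow> tr (r t) (F t)) (at t within S)"
    by (simp flip: linear_add[OF bounded_linear.linear[OF bounded_linear_tr]])
qed

subsection \<open>Test functions\<close>

text \<open>In this form the derivative matches the difference quotient in
  \<open>weak_solution\<close> and can be tested along sequences.\<close>

lemma has_vector_derivative_iff_quotient:
  fixes f :: "real \<Rightarrow> 'a::real_normed_vector"
  shows "(f has_vector_derivative D) (at x within S) \<longleftrightarrow>
    ((\<lambda>y. (f y - f x) /\<^sub>R (y - x)) \<longlongrightarrow> D) (at x within S)"
proof -
  have eq: "norm ((1 / norm (y - x)) *\<^sub>R (f y - (f x + (y - x) *\<^sub>R D))) = norm ((f y - f x) /\<^sub>R (y - x) - D)"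
    if "y \<noteq> x" for y
  proof -
    have "(f y - (f x + (y - x) *\<^sub>R D)) /\<^sub>R (y - x)
        = (f y - f x) /\<^sub>R (y - x) - ((y - x) *\<^sub>R D) /\<^sub>R (y - x)"
      by (simp only: scaleR_diff_right[symmetric] diff_diff_eq)
    also have "((y - x) *\<^sub>R D) /\<^sub>R (y - x) = D" using that by simp
    finally have "(f y - f x) /\<^sub>R (y - x) - D = (f y - (f x + (y - x) *\<^sub>R D)) /\<^sub>R (y - x)" by simp
    then show ?thesis by (simp add: divide_inverse)
  qed
  have "(f has_vector_derivative D) (at x within S) \<longleftrightarrow>
      ((\<lambda>y. (1 / norm (y - x)) *\<^sub>R (f y - (f x + (y - x) *\<^sub>R D))) \<longlongrightarrow> 0) (at x within S)"
    by (simp add: has_vector_derivative_def has_derivative_within bounded_linear_scaleR_left)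
  also have "\<dots> \<longleftrightarrow> ((\<lambda>y. norm ((f y - f x) /\<^sub>R (y - x) - D)) \<longlongrightarrow> 0) (at x within S)"
    by (subst tendsto_norm_zero_iff[symmetric], rule Lim_cong_within) (use eq in auto)
  also have "\<dots> \<longleftrightarrow> ((\<lambda>y. (f y - f x) /\<^sub>R (y - x)) \<longlongrightarrow> D) (at x within S)"
    by (simp only: tendsto_norm_zero_iff LIM_zero_iff)
  finally show ?thesis .
qed

text \<open>Differentiability up to a finite order, with the recursion passing to
  \<open>deriv f\<close>. Closure under sums, products and affine substitution then follows by
  induction on the order with \<open>f\<close> arbitrary.\<close>

primrec kdiff :: "nat \<Rightarrow> (real \<Rightarrow> real) \<Rightarrow> bool" where
  "kdiff 0 f \<longleftrightarrow> (\<forall>x. f differentiable (at x))"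
| "kdiff (Suc n) f \<longleftrightarrow> (\<forall>x. f differentiable (at x)) \<and> kdiff n (deriv f)"

lemma kdiff_iff: "kdiff n f \<longleftrightarrow> (\<forall>k\<le>n. \<forall>x. ((deriv ^^ k) f) differentiable (at x))"
proof (induction n arbitrary: f)
  case (Suc n)
  have "(\<forall>k\<le>Suc n. P k) \<longleftrightarrow> P 0 \<and> (\<forall>k\<le>n. P (Suc k))" for P
    using All_less_Suc2[of "Suc n" P] by (simp add: less_Suc_eq_le)
  from this[of "\<lambda>k. \<forall>x. ((deriv ^^ k) f) differentiable (at x)"] show ?case
    by (simp add: Suc.IH funpow_Suc_right del: funpow.simps)
qed simp

lemma smooth_fun_iff_kdiff: "smooth_fun f \<longleftrightarrow> (\<forall>n. kdiff n f)"
  by (auto simp: smooth_fun_def kdiff_iff)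

lemma kdiff_differentiable: "kdiff n f \<Longrightarrow> f differentiable (at x)"
  by (cases n) auto

lemma kdiff_Suc_D: "kdiff (Suc n) f \<Longrightarrow> kdiff n f"
  by (simp add: kdiff_iff)

lemma differentiable_has_deriv: "f differentiable (at x) \<Longrightarrow> (f has_real_derivative deriv f x) (at x)"
  for f :: "real \<Rightarrow> real"
  by (simp add: DERIV_deriv_iff_real_differentiable)

lemma kdiff_SucI:
  assumes "\<And>x. (f has_real_derivative f' x) (at x)" "kdiff n f'"
  shows "kdiff (Suc n) f"
proof -
  have "deriv f = f'" using assms(1) DERIV_imp_deriv by blast
  with assms show ?thesis by (auto simp: real_differentiable_def)
qed

lemma kdiff_const: "kdiff n (\<lambda>x. c)"
proof (induction n arbitrary: c)
  case (Suc n)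
  show ?case by (rule kdiff_SucI[where f' = "\<lambda>x. 0"]) (auto intro: Suc)
qed simp

lemma kdiff_add: "kdiff n f \<Longrightarrow> kdiff n g \<Longrightarrow> kdiff n (\<lambda>x. f x + g x)"
proof (induction n arbitrary: f g)
  case (Suc n)
  show ?case
  proof (rule kdiff_SucI)
    show "((\<lambda>x. f x + g x) has_real_derivative deriv f x + deriv g x) (at x)" for x
      using Suc.prems by (intro DERIV_add differentiable_has_deriv) auto
    show "kdiff n (\<lambda>x. deriv f x + deriv g x)" using Suc by simp
  qed
qed (simp add: differentiable_add)

lemma kdiff_mult: "kdiff n f \<Longrightarrow> kdiff n g \<Longrightarrow> kdiff n (\<lambda>x. f x * g x)"
proof (induction n arbitrary: f g)
  case (Suc n)
  show ?case
  proof (rule kdiff_SucI)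
    show "((\<lambda>x. f x * g x) has_real_derivative deriv f x * g x + deriv g x * f x) (at x)" for x
      using Suc.prems by (intro DERIV_mult differentiable_has_deriv) auto
    show "kdiff n (\<lambda>x. deriv f x * g x + deriv g x * f x)"
      using Suc.prems kdiff_Suc_D[OF Suc.prems(1)] kdiff_Suc_D[OF Suc.prems(2)]
      by (intro kdiff_add Suc.IH) auto
  qed
qed (simp add: differentiable_mult)

lemma DERIV_affine_compose:
  fixes f :: "real \<Rightarrow> real"
  assumes "(f has_real_derivative D) (at (c * x + d))"
  shows "((\<lambda>x. f (c * x + d)) has_real_derivative c * D) (at x)"
proof -
  have "((\<lambda>x. c * x + d) has_real_derivative c) (at x)"
    by (auto intro!: derivative_eq_intros)
  from DERIV_chain2[OF assms this] show ?thesis by (simp add: mult.commute)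
qed

lemma kdiff_affine: "kdiff n f \<Longrightarrow> kdiff n (\<lambda>x. f (c * x + d))"
proof (induction n arbitrary: f)
  case 0
  then have "(f has_real_derivative deriv f x) (at x)" for x
    by (intro differentiable_has_deriv) simp
  from DERIV_affine_compose[OF this] show ?case
    unfolding kdiff.simps real_differentiable_def by blast
next
  case (Suc n)
  show ?case
  proof (rule kdiff_SucI)
    show "((\<lambda>x. f (c * x + d)) has_real_derivative c * deriv f (c * x + d)) (at x)" for x
      using Suc.prems by (intro DERIV_affine_compose differentiable_has_deriv) simp
    show "kdiff n (\<lambda>x. c * deriv f (c * x + d))"
      using Suc by (intro kdiff_mult kdiff_const) auto
  qed
qed

lemma smooth_fun_add: "smooth_fun f \<Longrightarrow> smooth_fun g \<Longrightarrow> smooth_fun (\<lambda>x. f x + g x)"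
  by (simp add: smooth_fun_iff_kdiff kdiff_add)

lemma smooth_fun_mult: "smooth_fun f \<Longrightarrow> smooth_fun g \<Longrightarrow> smooth_fun (\<lambda>x. f x * g x)"
  by (simp add: smooth_fun_iff_kdiff kdiff_mult)

lemma smooth_fun_affine: "smooth_fun f \<Longrightarrow> smooth_fun (\<lambda>x. f (c * x + d))"
  by (simp add: smooth_fun_iff_kdiff kdiff_affine)

lemma smooth_fun_deriv: "smooth_fun f \<Longrightarrow> smooth_fun (deriv f)"
  unfolding smooth_fun_iff_kdiff by (metis kdiff.simps(2))

lemma smooth_fun_antideriv:
  assumes "\<And>x. (f has_real_derivative f' x) (at x)" "smooth_fun f'"
  shows "smooth_fun f"
proof -
  have "kdiff (Suc n) f" for n
    using assms by (intro kdiff_SucI) (auto simp: smooth_fun_iff_kdiff)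
  then show ?thesis unfolding smooth_fun_iff_kdiff by (blast intro: kdiff_Suc_D)
qed

lemma smooth_fun_has_deriv: "smooth_fun f \<Longrightarrow> (f has_real_derivative deriv f x) (at x)"
  unfolding smooth_fun_iff_kdiff by (intro differentiable_has_deriv) (metis kdiff_differentiable)

lemma smooth_fun_continuous: "smooth_fun f \<Longrightarrow> continuous_on S f"
  by (meson DERIV_isCont continuous_at_imp_continuous_on smooth_fun_has_deriv)

section \<open>Smooth functions of compact support\<close>

definition flat_exp :: "nat \<Rightarrow> real \<Rightarrow> real" where
  "flat_exp k x = (if 0 < x then (1 / x)^k * exp (- (1 / x)) else 0)"

text \<open>The powers of \<open>1 / x\<close> close the family under differentiation: index
  \<open>k\<close> leads to \<open>k + 1\<close> and \<open>k + 2\<close>, so smoothness needs only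
  first derivatives of every member. At \<open>0\<close> the quotient vanishes because the
  exponential beats every power of \<open>1 / x\<close>.\<close>

lemma flat_exp_deriv:
  "(flat_exp k has_real_derivative - real k * flat_exp (Suc k) x + flat_exp (Suc (Suc k)) x) (at x)"
proof -
  consider "x < 0" | "x = 0" | "0 < x" by linarith
  then show ?thesis
  proof cases
    case 1
    have "((\<lambda>_. 0) has_real_derivative 0) (at x)" by simp
    then have "(flat_exp k has_real_derivative 0) (at x)"
      by (rule has_field_derivative_transform_within_open[of _ _ _ "{..<0}"])
        (use 1 in \<open>auto simp: flat_exp_def\<close>)
    then show ?thesis using 1 by (simp add: flat_exp_def)
  next
    case 3
    have "((\<lambda>x. (1 / x)^k * exp (- (1 / x))) has_real_derivative
        - real k * flat_exp (Suc k) x + flat_exp (Suc (Suc k)) x) (at x)"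
    proof (cases k)
      case 0
      then show ?thesis using 3
        by (auto intro!: derivative_eq_intros simp: flat_exp_def power2_eq_square field_simps)
    next
      case (Suc j)
      then show ?thesis using 3
        by (auto intro!: derivative_eq_intros simp: flat_exp_def power2_eq_square field_simps)
          (cases j; simp)
    qed
    then show ?thesis
      by (rule has_field_derivative_transform_within_open[of _ _ _ "{0<..}"])
        (use 3 in \<open>auto simp: flat_exp_def\<close>)
  next
    case 2
    have "((\<lambda>h. flat_exp k h / h) \<longlongrightarrow> 0) (at_right 0)"
    proof -
      have "((\<lambda>h. (inverse h)^(Suc k) / exp (inverse h)) \<longlongrightarrow> (0::real)) (at_right 0)"
        by (rule filterlim_compose[OF tendsto_power_div_exp_0 filterlim_inverse_at_top_right])
      moreover have "\<forall>\<^sub>F h in at_right 0. (inverse h)^(Suc k) / exp (inverse h) = flat_exp k h / h"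
        unfolding eventually_at_right_field
        by (intro exI[of _ 1]) (auto simp: flat_exp_def exp_minus field_simps)
      ultimately show ?thesis by (rule Lim_transform_eventually)
    qed
    moreover have "((\<lambda>h. flat_exp k h / h) \<longlongrightarrow> 0) (at_left 0)"
      by (rule tendsto_eventually) (auto simp: flat_exp_def eventually_at_left_field intro!: exI[of _ "-1"])
    ultimately have "((\<lambda>h. flat_exp k h / h) \<longlongrightarrow> 0) (at 0)"
      by (simp add: filterlim_split_at)
    then show ?thesis using 2 by (simp add: DERIV_def flat_exp_def)
  qed
qed

lemma smooth_flat_exp: "smooth_fun (flat_exp k)"
proof -
  have "kdiff n (flat_exp k)" for n
  proof (induction n arbitrary: k)
    case 0
    then show ?case using flat_exp_deriv by (auto simp: real_differentiable_def)
  next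
    case (Suc n)
    show ?case
      by (rule kdiff_SucI[OF flat_exp_deriv]) (intro kdiff_add kdiff_mult kdiff_const Suc)
  qed
  then show ?thesis by (simp add: smooth_fun_iff_kdiff)
qed

text \<open>For \<open>n > 0\<close> a product of two one-sided flat functions, positive exactly
  between \<open>a\<close> and \<open>b\<close>. Growing \<open>n\<close> steepens both flanks, so
  that the bumps tend to the indicator of the open interval while staying below it.\<close>

definition bump :: "real \<Rightarrow> real \<Rightarrow> real \<Rightarrow> real \<Rightarrow> real" where
  "bump n a b x = flat_exp 0 (n * (x - a)) * flat_exp 0 (n * (b - x))"

lemma smooth_bump: "smooth_fun (bump n a b)"
proof -
  have "bump n a b = (\<lambda>x. flat_exp 0 (n * x + (- n * a)) * flat_exp 0 ((- n) * x + n * b))"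
    by (auto simp: bump_def algebra_simps)
  then show ?thesis by (simp only: smooth_fun_mult smooth_fun_affine smooth_flat_exp)
qed

lemma flat_exp_0_bounds: "0 \<le> flat_exp 0 x" "flat_exp 0 x \<le> 1"
  by (simp_all add: flat_exp_def)

lemma bump_nonneg: "0 \<le> bump n a b x"
  by (simp add: bump_def flat_exp_0_bounds)

lemma bump_le:
  assumes "0 < n"
  shows "bump n a b x \<le> indicator {a<..<b} x"
proof (cases "x \<in> {a<..<b}")
  case True
  then show ?thesis by (simp add: bump_def mult_le_one flat_exp_0_bounds)
next
  case False
  then have "flat_exp 0 (n * (x - a)) = 0 \<or> flat_exp 0 (n * (b - x)) = 0"
    using assms by (auto simp: flat_exp_def zero_less_mult_iff)
  then show ?thesis by (auto simp: bump_def)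
qed

lemma bump_pos: "0 < n \<Longrightarrow> a < x \<Longrightarrow> x < b \<Longrightarrow> 0 < bump n a b x"
  by (simp add: bump_def flat_exp_def)

lemma bump_eq_0: "0 < n \<Longrightarrow> x \<notin> {a<..<b} \<Longrightarrow> bump n a b x = 0"
  using bump_le[of n a b x] bump_nonneg[of n a b x] by auto

lemma bump_lim: "(\<lambda>n. bump (real (Suc n)) a b x) \<longlonglongrightarrow> indicator {a<..<b} x"
proof (cases "x \<in> {a<..<b}")
  case True
  have *: "(\<lambda>n. flat_exp 0 (real (Suc n) * y)) \<longlonglongrightarrow> 1" if "0 < y" for y
  proof -
    have "(\<lambda>n. exp (- (inverse (real (Suc n)) * (1 / y)))) \<longlonglongrightarrow> exp (- (0 * (1 / y)))"
      by (intro tendsto_intros LIMSEQ_inverse_real_of_nat)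
    moreover have "flat_exp 0 (real (Suc n) * y) = exp (- (inverse (real (Suc n)) * (1 / y)))" for n
      using that by (simp add: flat_exp_def field_simps del: of_nat_Suc)
    ultimately show ?thesis by simp
  qed
  have "(\<lambda>n. bump (real (Suc n)) a b x) \<longlonglongrightarrow> 1 * 1"
    unfolding bump_def using True by (intro tendsto_mult *) auto
  then show ?thesis using True by simp
next
  case False
  then show ?thesis by (simp add: bump_eq_0)
qed

section \<open>Supports of test functions and their translation orbits\<close>

lemma fsupp_subset: "closed S \<Longrightarrow> (\<And>x. x \<notin> S \<Longrightarrow> f x = 0) \<Longrightarrow> fsupp f \<subseteq> S"
  unfolding fsupp_def by (rule closure_minimal) auto

lemma fsupp_compact_iff: "compact (fsupp f) \<longleftrightarrow> (\<exists>L. \<forall>x. L < \<bar>x\<bar> \<longrightarrow> f x = 0)"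
proof
  assume "compact (fsupp f)"
  then have "bounded (fsupp f)" by (rule compact_imp_bounded)
  then obtain L where L: "\<forall>x\<in>fsupp f. norm x \<le> L" unfolding bounded_iff by (elim exE)
  have "f x = 0" if "L < \<bar>x\<bar>" for x
  proof (rule ccontr)
    assume "f x \<noteq> 0"
    then have "x \<in> fsupp f" unfolding fsupp_def by (intro subsetD[OF closure_subset]) simp
    then have "norm x \<le> L" using L by (rule bspec[rotated])
    then show False using that by simp
  qed
  then show "\<exists>L. \<forall>x. L < \<bar>x\<bar> \<longrightarrow> f x = 0" by blast
next
  assume "\<exists>L. \<forall>x. L < \<bar>x\<bar> \<longrightarrow> f x = 0"
  then obtain L where L: "\<And>x. L < \<bar>x\<bar> \<Longrightarrow> f x = 0" by blast
  have "fsupp f \<subseteq> {-L..L}"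
  proof (rule fsupp_subset)
    fix x assume "x \<notin> {-L..L}"
    then have "L < \<bar>x\<bar>" by auto
    then show "f x = 0" by (rule L)
  qed simp
  then have "bounded (fsupp f)" by (rule bounded_subset[OF bounded_closed_interval])
  then show "compact (fsupp f)" by (simp add: compact_eq_bounded_closed fsupp_def)
qed

lemma test_fun_iff: "test_fun f \<longleftrightarrow> smooth_fun f \<and> (\<exists>L. \<forall>x. L < \<bar>x\<bar> \<longrightarrow> f x = 0)"
  by (simp add: test_fun_def fsupp_compact_iff)

lemma test_fun_smooth: "test_fun f \<Longrightarrow> smooth_fun f"
  by (simp add: test_fun_def)

lemma test_fun_bump:
  assumes "0 < n"
  shows "test_fun (bump n a b)"
  unfolding test_fun_iff
proof (intro conjI exI[of _ "\<bar>a\<bar> + \<bar>b\<bar>"] allI impI)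
  fix x assume "\<bar>a\<bar> + \<bar>b\<bar> < \<bar>x\<bar>"
  then have "x \<notin> {a<..<b}" by auto
  then show "bump n a b x = 0" by (rule bump_eq_0[OF assms])
qed (rule smooth_bump)

lemma deriv_eq_0_outside:
  assumes "\<And>x. L < \<bar>x\<bar> \<Longrightarrow> f x = 0" "L < \<bar>x :: real\<bar>"
  shows "deriv f x = (0::real)"
proof -
  have "((\<lambda>_. 0) has_real_derivative 0) (at x)" by simp
  then have "(f has_real_derivative 0) (at x)"
    by (rule has_field_derivative_transform_within_open[of _ _ _ "{x. L < \<bar>x\<bar>}"])
      (use assms in \<open>auto intro!: open_Collect_less continuous_intros\<close>)
  then show ?thesis by (rule DERIV_imp_deriv)
qed

lemma test_fun_deriv: "test_fun f \<Longrightarrow> test_fun (deriv f)"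
  unfolding test_fun_iff using deriv_eq_0_outside smooth_fun_deriv by metis

lemma continuous_compact_support_bounded:
  fixes f :: "real \<Rightarrow> real"
  assumes "continuous_on UNIV f" "\<And>x. L < \<bar>x\<bar> \<Longrightarrow> f x = 0"
  obtains B where "0 \<le> B" "\<And>x. \<bar>f x\<bar> \<le> B * indicator {-L..L} x" "\<And>x. \<bar>f x\<bar> \<le> B"
proof -
  have "bounded (f ` {-L..L})"
    using assms(1) by (intro compact_imp_bounded compact_continuous_image) (auto intro: continuous_on_subset)
  then obtain B where B: "B > 0" "\<And>x. x \<in> {-L..L} \<Longrightarrow> \<bar>f x\<bar> \<le> B" by (auto simp: bounded_pos)
  show thesis
  proof (rule that[of B])
    show *: "\<bar>f x\<bar> \<le> B * indicator {-L..L} x" for x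
      using B(2)[of x] assms(2)[of x] by (auto simp: indicator_def)
    show "\<bar>f x\<bar> \<le> B" for x
      using *[of x] B(1) by (cases "x \<in> {-L..L}") auto
  qed (use B in simp)
qed

lemma test_fun_L2:
  assumes "test_fun f"
  shows "L2 f"
proof -
  obtain L where L: "\<And>x. L < \<bar>x\<bar> \<Longrightarrow> f x = 0" using assms by (auto simp: test_fun_iff)
  have c: "continuous_on UNIV f" using assms by (simp add: smooth_fun_continuous test_fun_def)
  obtain B where "\<And>x. \<bar>f x\<bar> \<le> B * indicator {-L..L} x"
    using continuous_compact_support_bounded[OF c L] by metis
  then show ?thesis by (rule L2_bounded_interval[OF borel_measurable_continuous_onI[OF c]])
qed

text \<open>The difference quotients converge pointwise. They are bounded by the Lipschitz constant
  \<open>B\<close> on one common interval, so dominated convergence applies.\<close>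

lemma tr_test_fun_deriv_0:
  assumes "test_fun f"
  shows "((\<lambda>s. tr s (abs_lsq f)) has_vector_derivative abs_lsq (deriv f)) (at 0)"
  unfolding has_vector_derivative_iff_quotient tendsto_at_iff_sequentially comp_def
proof (intro allI impI)
  fix X :: "nat \<Rightarrow> real" assume X0: "\<forall>i. X i \<in> UNIV - {0}" and X: "X \<longlonglongrightarrow> 0"
  have X0: "X i \<noteq> 0" for i using X0 by auto
  obtain K where K: "\<And>i. \<bar>X i\<bar> \<le> K"
    using X by (metis Bseq_def convergentI convergent_imp_Bseq real_norm_def)
  obtain L where L: "\<And>x. L < \<bar>x\<bar> \<Longrightarrow> f x = 0" using assms by (auto simp: test_fun_iff)
  have L': "deriv f x = 0" if "L < \<bar>x\<bar>" for x using L that by (rule deriv_eq_0_outside)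
  have f: "(f has_real_derivative deriv f x) (at x)" for x
    using assms by (intro smooth_fun_has_deriv test_fun_smooth)
  have L2f: "L2 f" "L2 (deriv f)" using assms by (auto intro: test_fun_L2 test_fun_deriv)
  have c: "continuous_on UNIV (deriv f)"
    using assms by (intro smooth_fun_continuous test_fun_smooth test_fun_deriv)
  obtain B where B: "0 \<le> B" "\<And>x. \<bar>deriv f x\<bar> \<le> B"
    using continuous_compact_support_bounded[OF c L'] by metis
  have lip: "\<bar>f y - f x\<bar> \<le> B * \<bar>y - x\<bar>" for x y
    using field_differentiable_bound[of UNIV f "deriv f" B y x] f B(2) by simp
  have "(\<lambda>i. abs_lsq (\<lambda>x. (f (x + X i) - f x) / X i)) \<longlonglongrightarrow> abs_lsq (deriv f)"
  proof (rule abs_lsq_dominated(2))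
    show "L2 (\<lambda>x. B * indicator {-(L+K)..L+K} x)"
      by (rule L2_bounded_interval[of _ B "L+K"]) (use B in \<open>auto simp: indicator_def\<close>)
    show "L2 (deriv f)" by fact
    show "(\<lambda>x. (f (x + X i) - f x) / X i) \<in> borel_measurable borel" for i
      using L2_borel_measurable[OF L2_shift[OF L2f(1)]] L2_borel_measurable[OF L2f(1)] by measurable
    show "\<bar>(f (x + X i) - f x) / X i\<bar> \<le> B * indicator {- (L + K)..L + K} x" for i x
    proof (cases "\<bar>x\<bar> \<le> L + K")
      case True
      then show ?thesis using lip[of "x + X i" x] X0[of i] by (auto simp: indicator_def divide_le_eq)
    next
      case False
      then have "\<bar>x + X i\<bar> > L" "\<bar>x\<bar> > L" using K[of i] by linarith+
      then show ?thesis using L B(1) by (auto simp: indicator_def)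
    qed
    show "AE x in lborel. (\<lambda>i. (f (x + X i) - f x) / X i) \<longlonglongrightarrow> deriv f x"
      using f X X0 unfolding DERIV_def tendsto_at_iff_sequentially comp_def by auto
  qed
  moreover have "abs_lsq (\<lambda>x. (f (x + X i) - f x) / X i) = (tr (X i) (abs_lsq f) - tr 0 (abs_lsq f)) /\<^sub>R (X i - 0)" for i
    using abs_lsq_scale[OF L2_diff[OF L2_shift[OF L2f(1)] L2f(1)], of "inverse (X i)" "X i"] L2f
    by (simp add: tr_abs_lsq abs_lsq_diff L2_shift field_simps)
  ultimately show "(\<lambda>i. (tr (X i) (abs_lsq f) - tr 0 (abs_lsq f)) /\<^sub>R (X i - 0)) \<longlonglongrightarrow> abs_lsq (deriv f)"
    by simp
qed

lemma tr_test_fun_deriv: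
  assumes "test_fun f"
  shows "((\<lambda>s. tr s (abs_lsq f)) has_vector_derivative tr t (abs_lsq (deriv f))) (at t within S)"
proof -
  have "((\<lambda>s. s - t) has_vector_derivative 1) (at t)" by (auto intro!: derivative_eq_intros)
  moreover have "((\<lambda>s. tr s (abs_lsq f)) has_vector_derivative abs_lsq (deriv f)) (at (t - t))"
    using tr_test_fun_deriv_0[OF assms] by simp
  ultimately have "((\<lambda>s. tr (s - t) (abs_lsq f)) has_vector_derivative abs_lsq (deriv f)) (at t)"
    using vector_diff_chain_at[of "\<lambda>s. s - t" 1 t "\<lambda>s. tr s (abs_lsq f)"] by (simp add: comp_def)
  from bounded_linear.has_vector_derivative[OF bounded_linear_tr this, of t]
  have "((\<lambda>s. tr s (abs_lsq f)) has_vector_derivative tr t (abs_lsq (deriv f))) (at t)" by simp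
  then show ?thesis by (rule has_vector_derivative_at_within)
qed

lemma abs_lsq_sum:
  assumes "finite I" "\<And>i. i \<in> I \<Longrightarrow> L2 (f i)"
  shows "L2 (\<lambda>x. \<Sum>i\<in>I. f i x) \<and> abs_lsq (\<lambda>x. \<Sum>i\<in>I. f i x) = (\<Sum>i\<in>I. abs_lsq (f i))"
  using assms
proof (induction I rule: finite_induct)
  case empty
  then show ?case by (simp add: L2_zero zero_lsq_def)
next
  case (insert i I)
  then show ?case by (simp add: L2_add abs_lsq_add)
qed

lemma L2_indicator_interval:
  assumes "A \<in> sets borel" "A \<subseteq> {a..b}"
  shows "L2 (indicator A)"
proof (rule L2_bounded_interval[of _ 1 "\<bar>a\<bar> + \<bar>b\<bar>"])
  fix x
  show "\<bar>indicator A x\<bar> \<le> 1 * (indicator {- (\<bar>a\<bar> + \<bar>b\<bar>)..\<bar>a\<bar> + \<bar>b\<bar>} x :: real)"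
  proof (cases "x \<in> A")
    case True
    then have "a \<le> x" "x \<le> b" using assms(2) by auto
    then have "x \<in> {- (\<bar>a\<bar> + \<bar>b\<bar>)..\<bar>a\<bar> + \<bar>b\<bar>}" by auto
    with True show ?thesis by simp
  qed simp
qed (use assms in simp)

text \<open>Orthogonality spreads from bumps to open intervals, to half-open intervals since points
  are null, to step functions, and to continuous functions of bounded support, which are
  dense.\<close>

lemma test_fun_separates:
  assumes "\<And>\<phi>. test_fun \<phi> \<Longrightarrow> inner f (abs_lsq \<phi>) = 0"
  shows "f = 0"
proof -
  have open_interval: "inner f (abs_lsq (indicator {a<..<b})) = 0" for a b
  proof -
    have "(\<lambda>n. abs_lsq (bump (real (Suc n)) a b)) \<longlonglongrightarrow> abs_lsq (indicator {a<..<b})"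
    proof (rule abs_lsq_dominated(2))
      show "L2 (indicator {a<..<b})" by (rule L2_indicator_interval[of _ a b]) auto
      then show "L2 (indicator {a<..<b})" .
      show "bump (real (Suc n)) a b \<in> borel_measurable borel" for n
        by (intro borel_measurable_continuous_onI smooth_fun_continuous smooth_bump)
      show "\<bar>bump (real (Suc n)) a b x\<bar> \<le> indicator {a<..<b} x" for n x
        using bump_le[of "real (Suc n)" a b x] bump_nonneg[of "real (Suc n)" a b x] by simp
      show "AE x in lborel. (\<lambda>n. bump (real (Suc n)) a b x) \<longlonglongrightarrow> indicator {a<..<b} x"
        using bump_lim by simp
    qed
    then have "(\<lambda>n. inner f (abs_lsq (bump (real (Suc n)) a b))) \<longlonglongrightarrow> inner f (abs_lsq (indicator {a<..<b}))"
      by (intro tendsto_intros)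
    then show ?thesis using assms[OF test_fun_bump] by (simp add: LIMSEQ_const_iff)
  qed
  \<comment> \<open>Half-open intervals tile the line without overlap, as the step functions below
    require.\<close>
  have half_open: "inner f (abs_lsq (indicator {a..<b})) = 0" for a b
  proof -
    have "abs_lsq (indicator {a..<b}) = abs_lsq (indicator {a<..<b})"
    proof (rule abs_lsq_cong)
      have "AE x in lborel. x \<noteq> a" by (rule AE_lborel_singleton)
      then show "AE x in lborel. indicator {a..<b} x = (indicator {a<..<b} x :: real)"
        by eventually_elim (auto simp: indicator_def)
    qed (rule L2_indicator_interval[of _ a b]; force)+
    then show ?thesis by (simp add: open_interval)
  qed
  have cont: "inner f (abs_lsq g) = 0"
    if g: "continuous_on UNIV g" "\<And>x. \<bar>g x\<bar> \<le> B * indicator {-L..L} x" "L2 g" for g B L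
  proof -
    have gB: "\<bar>g x\<bar> \<le> \<bar>B\<bar>" for x
      using g(2)[of x] by (cases "x \<in> {-L..L}") auto
    have g0: "g x = 0" if "\<bar>x\<bar> > L" for x
      using g(2)[of x] that by (cases "x \<in> {-L..L}") auto
    \<comment> \<open>The sample is taken at the left end of the grid cell of width
      \<open>1 / Suc m\<close> containing \<open>x\<close>.\<close>
    define S where "S m x = g (real_of_int \<lfloor>real (Suc m) * x\<rfloor> / real (Suc m))" for m x
    have floor_close: "\<bar>real_of_int \<lfloor>real (Suc m) * x\<rfloor> / real (Suc m) - x\<bar> \<le> inverse (real (Suc m))" for m x
    proof -
      have "\<bar>real_of_int \<lfloor>real (Suc m) * x\<rfloor> - real (Suc m) * x\<bar> \<le> 1" by linarith
      moreover have "real_of_int \<lfloor>real (Suc m) * x\<rfloor> / real (Suc m) - x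
          = (real_of_int \<lfloor>real (Suc m) * x\<rfloor> - real (Suc m) * x) / real (Suc m)"
        by (simp add: field_simps del: of_nat_Suc)
      ultimately show ?thesis
        by (simp add: inverse_eq_divide divide_right_mono del: of_nat_Suc)
    qed
    have "inner f (abs_lsq (S m)) = 0" and S_meas: "S m \<in> borel_measurable borel" for m
    proof -
      \<comment> \<open>Only these finitely many grid points can carry a nonzero sample.\<close>
      define I where "I = {k::int. \<bar>real_of_int k / real (Suc m)\<bar> \<le> L}"
      have "I \<subseteq> {\<lfloor>- L * real (Suc m)\<rfloor>..\<lceil>L * real (Suc m)\<rceil>}"
        unfolding I_def by (auto simp: abs_le_iff field_simps le_ceiling_iff floor_le_iff simp del: of_nat_Suc)
      then have I: "finite I" by (rule finite_subset) simp
      let ?J = "\<lambda>k::int. {real_of_int k / real (Suc m)..<(real_of_int k + 1) / real (Suc m)}"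
      have J: "indicator (?J k) x = (if k = \<lfloor>real (Suc m) * x\<rfloor> then 1 else 0 :: real)" for k x
      proof -
        have "x \<in> ?J k \<longleftrightarrow> real_of_int k \<le> real (Suc m) * x \<and> real (Suc m) * x < real_of_int k + 1"
          by (auto simp: field_simps simp del: of_nat_Suc)
        also have "\<dots> \<longleftrightarrow> k = \<lfloor>real (Suc m) * x\<rfloor>" by (subst eq_commute, subst floor_eq_iff, rule refl)
        finally show ?thesis by (auto simp: indicator_def)
      qed
      have Seq: "S m = (\<lambda>x. \<Sum>k\<in>I. g (real_of_int k / real (Suc m)) * indicator (?J k) x)"
      proof
        fix x
        have "(\<Sum>k\<in>I. g (real_of_int k / real (Suc m)) * indicator (?J k) x)
            = (\<Sum>k\<in>I. if k = \<lfloor>real (Suc m) * x\<rfloor> then g (real_of_int k / real (Suc m)) else 0)"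
          unfolding J by (intro sum.cong) auto
        also have "\<dots> = (if \<lfloor>real (Suc m) * x\<rfloor> \<in> I then S m x else 0)"
          using I by (simp add: sum.delta S_def)
        also have "\<dots> = S m x"
          using g0[of "real_of_int \<lfloor>real (Suc m) * x\<rfloor> / real (Suc m)"] by (auto simp: I_def S_def)
        finally show "S m x = (\<Sum>k\<in>I. g (real_of_int k / real (Suc m)) * indicator (?J k) x)" by simp
      qed
      have LJ: "L2 (indicator (?J k))" for k
        by (rule L2_indicator_interval[of _ "real_of_int k / real (Suc m)" "(real_of_int k + 1) / real (Suc m)"]) force+
      have "abs_lsq (S m) = (\<Sum>k\<in>I. g (real_of_int k / real (Suc m)) *\<^sub>R abs_lsq (indicator (?J k)))"
        unfolding Seq using abs_lsq_sum[OF I, of "\<lambda>k x. g (real_of_int k / real (Suc m)) * indicator (?J k) x"] LJ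
        by (simp add: L2_scale abs_lsq_scale)
      then show "inner f (abs_lsq (S m)) = 0" by (simp add: inner_sum_right half_open del: of_nat_Suc)
      show "S m \<in> borel_measurable borel" unfolding Seq by measurable
    qed
    moreover have "(\<lambda>m. abs_lsq (S m)) \<longlonglongrightarrow> abs_lsq g"
    proof (rule abs_lsq_dominated(2))
      show "L2 (\<lambda>x. \<bar>B\<bar> * indicator {-(L+1)..L+1} x)"
        by (rule L2_bounded_interval[of _ "\<bar>B\<bar>" "L+1"]) (auto simp: indicator_def)
      show "L2 g" "\<And>m. S m \<in> borel_measurable borel" by fact+
      show "\<bar>S m x\<bar> \<le> \<bar>B\<bar> * indicator {- (L + 1)..L + 1} x" for m x
      proof (cases "\<bar>x\<bar> \<le> L + 1")
        case True then show ?thesis using gB by (auto simp: indicator_def S_def)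
      next
        case False
        have "inverse (real (Suc m)) \<le> 1" by (simp add: field_simps)
        with False floor_close[of m x] have "\<bar>real_of_int \<lfloor>real (Suc m) * x\<rfloor> / real (Suc m)\<bar> > L" by linarith
        then show ?thesis using g0 by (auto simp: indicator_def S_def)
      qed
      show "AE x in lborel. (\<lambda>m. S m x) \<longlonglongrightarrow> g x"
      proof (rule AE_I2)
        fix x
        have "(\<lambda>m. real_of_int \<lfloor>real (Suc m) * x\<rfloor> / real (Suc m) - x) \<longlonglongrightarrow> 0"
          by (rule Lim_null_comparison[OF _ LIMSEQ_inverse_real_of_nat]) (use floor_close in simp)
        then have "(\<lambda>m. real_of_int \<lfloor>real (Suc m) * x\<rfloor> / real (Suc m)) \<longlonglongrightarrow> x" by (rule LIM_zero_cancel)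
        moreover have "isCont g x" using g(1) by (simp add: continuous_on_eq_continuous_at)
        ultimately show "(\<lambda>m. S m x) \<longlonglongrightarrow> g x" unfolding S_def by (rule isCont_tendsto_compose[rotated])
      qed
    qed
    then have "(\<lambda>m. inner f (abs_lsq (S m))) \<longlonglongrightarrow> inner f (abs_lsq g)" by (intro tendsto_intros)
    ultimately show ?thesis by (simp add: LIMSEQ_const_iff)
  qed
  show "f = 0"
  proof (rule ccontr)
    assume "f \<noteq> 0"
    then have "0 < norm f" by simp
    then obtain g B L where g: "continuous_on UNIV g" "\<And>x. \<bar>g x\<bar> \<le> B * indicator {-L..L} x"
      "L2 g" "norm (f - abs_lsq g) < norm f" by (rule continuous_dense_lsq) blast
    \<comment> \<open>A vector orthogonal to \<open>f\<close> cannot be closer to \<open>f\<close>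
      than \<open>norm f\<close>, yet \<open>g\<close> is both.\<close>
    have "(norm f)\<^sup>2 = inner f (f - abs_lsq g)"
      using cont[OF g(1-3)] by (simp add: inner_diff_right power2_norm_eq_inner)
    also have "\<dots> \<le> norm f * norm (f - abs_lsq g)" by (rule norm_cauchy_schwarz)
    also have "\<dots> < norm f * norm f" using g(4) \<open>0 < norm f\<close> by simp
    finally show False by (simp add: power2_eq_square)
  qed
qed

subsection \<open>Weak derivatives, supports and linear evolution equations\<close>

lemma at_within_atLeast_eq:
  fixes t :: real
  assumes "a \<le> t" "t < b"
  shows "at t within {a..} = at t within {a..b}"
  by (rule at_within_nhd[of t "{..<b}"]) (use assms in auto)

lemma continuous_on_atLeastI:
  fixes f :: "real \<Rightarrow> 'a::topological_space"
  assumes "\<And>b. continuous_on {a..b} f"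
  shows "continuous_on {a..} f"
  unfolding continuous_on_def
proof
  fix t assume t: "t \<in> {a..}"
  then have "(f \<longlongrightarrow> f t) (at t within {a..t + 1})"
    using assms[of "t + 1"] by (auto simp: continuous_on_def)
  then show "(f \<longlongrightarrow> f t) (at t within {a..})"
    using at_within_atLeast_eq[of a t "t + 1"] t by simp
qed

lemma integral_has_vector_derivative_atLeast:
  fixes f :: "real \<Rightarrow> 'a::banach"
  assumes "continuous_on {a..} f" "a \<le> t"
  shows "((\<lambda>u. integral {a..u} f) has_vector_derivative f t) (at t within {a..})"
proof -
  have "continuous_on {a..t + 1} f" using assms(1) by (rule continuous_on_subset) auto
  then have "((\<lambda>u. integral {a..u} f) has_vector_derivative f t) (at t within {a..t + 1})"
    by (rule integral_has_vector_derivative) (use assms in auto)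
  then show ?thesis using at_within_atLeast_eq[of a t "t + 1"] assms by simp
qed

lemma integral_bounded_linear:
  fixes f :: "real \<Rightarrow> 'a::banach" and h :: "'a \<Rightarrow> 'b::banach"
  assumes "continuous_on {a..} f" "bounded_linear h"
  shows "h (integral {a..t} f) = integral {a..t} (\<lambda>s. h (f s))"
proof -
  have "continuous_on {a..t} f" using assms(1) by (rule continuous_on_subset) auto
  then have "f integrable_on {a..t}" by (rule integrable_continuous_real)
  from integral_linear[OF this assms(2)] show ?thesis by (simp add: comp_def)
qed

lemma zero_derivative_atLeast_constant:
  fixes f :: "real \<Rightarrow> 'a::real_normed_vector"
  assumes "\<And>t. 0 \<le> t \<Longrightarrow> (f has_vector_derivative 0) (at t within {0..})" "0 \<le> t"
  shows "f t = f 0"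
proof -
  obtain c where "\<And>x. x \<in> {0..} \<Longrightarrow> f x = c"
    using has_vector_derivative_zero_constant[of "{0::real..}" f] assms(1) by auto
  then show ?thesis using assms(2) by simp
qed

section \<open>Weak derivatives in space\<close>

definition wd :: "lsq \<Rightarrow> lsq \<Rightarrow> bool" where
  "wd f g \<longleftrightarrow> (\<forall>\<phi>. test_fun \<phi> \<longrightarrow> inner f (abs_lsq (deriv \<phi>)) = - inner g (abs_lsq \<phi>))"

lemma wdD: "wd f g \<Longrightarrow> test_fun \<phi> \<Longrightarrow> inner f (abs_lsq (deriv \<phi>)) = - inner g (abs_lsq \<phi>)"
  by (simp add: wd_def)

lemma wd_diff: "wd f g \<Longrightarrow> wd f' g' \<Longrightarrow> wd (f - f') (g - g')"
  by (simp add: wd_def inner_diff_left)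

lemma wd_scaleR: "wd f g \<Longrightarrow> wd (c *\<^sub>R f) (c *\<^sub>R g)"
  by (simp add: wd_def)

lemma deriv_shift:
  assumes "smooth_fun f"
  shows "deriv (\<lambda>x. f (x + s)) = (\<lambda>x. deriv f (x + s))"
proof
  fix x
  have "((\<lambda>x. f (1 * x + s)) has_real_derivative 1 * deriv f (1 * x + s)) (at x)"
    by (rule DERIV_affine_compose) (rule smooth_fun_has_deriv[OF assms])
  then show "deriv (\<lambda>x. f (x + s)) x = deriv f (x + s)" by (simp add: DERIV_imp_deriv)
qed

lemma test_fun_shift:
  assumes "test_fun f"
  shows "test_fun (\<lambda>x. f (x + s))"
proof -
  obtain L where L: "\<And>x. L < \<bar>x\<bar> \<Longrightarrow> f x = 0" using assms by (auto simp: test_fun_iff)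
  have "f (x + s) = 0" if "L + \<bar>s\<bar> < \<bar>x\<bar>" for x using that by (intro L) linarith
  moreover have "smooth_fun (\<lambda>x. f (1 * x + s))"
    using assms by (intro smooth_fun_affine test_fun_smooth)
  ultimately show ?thesis by (auto simp: test_fun_iff)
qed

lemma wd_tr:
  assumes "wd f g"
  shows "wd (tr s f) (tr s g)"
  unfolding wd_def
proof (intro allI impI)
  fix \<phi> assume \<phi>: "test_fun \<phi>"
  have L: "L2 \<phi>" "L2 (deriv \<phi>)" using \<phi> by (auto intro: test_fun_L2 test_fun_deriv)
  have "inner f (abs_lsq (deriv (\<lambda>x. \<phi> (x + - s)))) = - inner g (abs_lsq (\<lambda>x. \<phi> (x + - s)))"
    by (rule wdD[OF assms test_fun_shift[OF \<phi>]])
  then show "inner (tr s f) (abs_lsq (deriv \<phi>)) = - inner (tr s g) (abs_lsq \<phi>)"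
    unfolding deriv_shift[OF test_fun_smooth[OF \<phi>]]
    using tr_abs_lsq[OF L(1), of "- s"] tr_abs_lsq[OF L(2), of "- s"] by (simp add: inner_tr_left)
qed

lemma tr_uminus_test_fun_deriv:
  assumes "test_fun \<phi>"
  shows "((\<lambda>s. tr (- s) (abs_lsq \<phi>)) has_vector_derivative - tr (- t) (abs_lsq (deriv \<phi>))) (at t within S)"
proof -
  have "(uminus has_vector_derivative - 1) (at t)" by (auto intro!: derivative_eq_intros)
  from vector_diff_chain_at[OF this tr_test_fun_deriv[OF assms]]
  show ?thesis by (simp add: comp_def has_vector_derivative_at_within)
qed

text \<open>A weak derivative is a norm derivative of the translation orbit. The difference of
  \<open>tr s f\<close> and the integral of \<open>tr r g\<close> is constant, because in a pairing
  the translation can be moved onto the test function, whose orbit is known to be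
  differentiable.\<close>

lemma wd_tr_deriv:
  assumes "wd f g"
  shows "((\<lambda>s. tr s f) has_vector_derivative g) (at 0)"
proof -
  \<comment> \<open>Starting at \<open>-1\<close> makes \<open>0\<close> an interior point, so the
    derivative obtained there is two-sided.\<close>
  define W where "W s = integral {-1..s} (\<lambda>r. tr r g)" for s
  have W: "(W has_vector_derivative tr s g) (at s within {-1..1})" if "s \<in> {-1..1}" for s
    unfolding W_def using that
    by (intro integral_has_vector_derivative continuous_on_subset[OF continuous_on_tr]) auto
  have const: "tr s f - W s = tr 0 f - W 0" if s: "s \<in> {-1..1}" for s
  proof -
    have "(tr s f - W s) - (tr 0 f - W 0) = 0"
    proof (rule test_fun_separates)
      fix \<phi> assume \<phi>: "test_fun \<phi>"
      have "((\<lambda>s. inner f (tr (- s) (abs_lsq \<phi>)) - inner (W s) (abs_lsq \<phi>)) has_vector_derivative 0)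
          (at r within {-1..1})" if "r \<in> {-1..1}" for r
      proof -
        have "((\<lambda>s. inner f (tr (- s) (abs_lsq \<phi>))) has_vector_derivative
            inner f (- tr (- r) (abs_lsq (deriv \<phi>)))) (at r within {-1..1})"
          by (rule bounded_linear.has_vector_derivative[OF bounded_linear_inner_right tr_uminus_test_fun_deriv[OF \<phi>]])
        moreover have "((\<lambda>s. inner (W s) (abs_lsq \<phi>)) has_vector_derivative inner (tr r g) (abs_lsq \<phi>)) (at r within {-1..1})"
          by (rule bounded_linear.has_vector_derivative[OF bounded_linear_inner_left W[OF that]])
        moreover have "inner f (- tr (- r) (abs_lsq (deriv \<phi>))) = inner (tr r g) (abs_lsq \<phi>)"
          using wdD[OF wd_tr[OF assms] \<phi>, of r] by (simp add: inner_tr_left)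
        ultimately show ?thesis using has_vector_derivative_diff by fastforce
      qed
      then obtain c where "\<And>r. r \<in> {-1..1} \<Longrightarrow> inner f (tr (- r) (abs_lsq \<phi>)) - inner (W r) (abs_lsq \<phi>) = c"
        using has_vector_derivative_zero_constant[of "{-1..1::real}"
            "\<lambda>s. inner f (tr (- s) (abs_lsq \<phi>)) - inner (W s) (abs_lsq \<phi>)"] by auto
      from this[OF s] this[of 0] show "inner ((tr s f - W s) - (tr 0 f - W 0)) (abs_lsq \<phi>) = 0"
        by (simp add: inner_diff_left inner_tr_left)
    qed
    then show ?thesis by simp
  qed
  have "((\<lambda>s. W s + (tr 0 f - W 0)) has_vector_derivative tr 0 g) (at 0 within {-1..1})"
    using W[of 0] by (auto intro!: derivative_eq_intros)
  then have "((\<lambda>s. W s + (tr 0 f - W 0)) has_vector_derivative g) (at 0)"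
    using at_within_Icc_at[of "-1" "0::real" 1] by simp
  then show ?thesis
    by (rule has_vector_derivative_transform_within_open[of _ _ _ "{-1<..<1}"])
      (use const in \<open>auto simp: algebra_simps\<close>)
qed

text \<open>Translations are isometries, so the inner product of two translated functions is constant;
  its derivative at \<open>0\<close> is the integration-by-parts formula.\<close>

lemma wd_skew:
  assumes "wd f g" "wd u v"
  shows "inner f v = - inner g u"
proof -
  have "((\<lambda>s. inner (tr s f) (tr s u)) has_vector_derivative inner (tr 0 f) v + inner g (tr 0 u)) (at 0)"
    by (rule bounded_bilinear.has_vector_derivative[OF bounded_bilinear_inner wd_tr_deriv[OF assms(1)] wd_tr_deriv[OF assms(2)]])
  then have "((\<lambda>s::real. inner f u) has_vector_derivative inner f v + inner g u) (at 0)"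
    by (simp add: inner_tr_tr)
  moreover have "((\<lambda>s::real. inner f u) has_vector_derivative 0) (at 0)" by simp
  ultimately have "inner f v + inner g u = 0" by (rule vector_derivative_unique_at)
  then show ?thesis by simp
qed

lemma wd_integral:
  fixes F G :: "real \<Rightarrow> lsq"
  assumes F: "continuous_on {0..} F" and G: "continuous_on {0..} G"
    and wd: "\<And>s. 0 \<le> s \<Longrightarrow> wd (F s) (G s)"
  shows "wd (integral {0..t} F) (integral {0..t} G)"
  unfolding wd_def
proof (intro allI impI)
  fix \<phi> assume \<phi>: "test_fun \<phi>"
  have "inner (integral {0..t} F) (abs_lsq (deriv \<phi>)) = integral {0..t} (\<lambda>s. inner (F s) (abs_lsq (deriv \<phi>)))"
    by (rule integral_bounded_linear[OF F bounded_linear_inner_left])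
  also have "\<dots> = integral {0..t} (\<lambda>s. - inner (G s) (abs_lsq \<phi>))"
    using wdD[OF wd \<phi>] by (intro integral_cong) auto
  also have "\<dots> = - inner (integral {0..t} G) (abs_lsq \<phi>)"
    by (simp add: integral_bounded_linear[OF G bounded_linear_inner_left])
  finally show "inner (integral {0..t} F) (abs_lsq (deriv \<phi>)) = - inner (integral {0..t} G) (abs_lsq \<phi>)" .
qed

text \<open>A fixed-point equation for a bounded linear operator, so that sums, limits and integrals
  inherit it at once; \<open>supported_iff\<close> gives the pointwise meaning.\<close>

definition supported :: "real \<Rightarrow> lsq \<Rightarrow> bool" where
  "supported r f \<longleftrightarrow> mul (indicator {-r..r}) f = f"

lemma bounded_linear_cut: "bounded_linear (mul (indicator {-r..r::real}))"
  by (intro bounded_linear_mul bmeas_indicator) simp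

lemma supported_iff: "supported r f \<longleftrightarrow> (AE x in lborel. r < \<bar>x\<bar> \<longrightarrow> rep_lsq f x = 0)"
proof -
  have "supported r f \<longleftrightarrow> (AE x in lborel. x \<notin> {-r..r} \<longrightarrow> rep_lsq f x = 0)"
    unfolding supported_def by (rule mul_indicator_eq_iff) simp
  also have "\<dots> \<longleftrightarrow> (AE x in lborel. r < \<bar>x\<bar> \<longrightarrow> rep_lsq f x = 0)"
    by (intro AE_cong) (auto simp: abs_if)
  finally show ?thesis .
qed

lemma supported_abs_lsq:
  assumes "L2 f" "AE x in lborel. r < \<bar>x\<bar> \<longrightarrow> f x = 0"
  shows "supported r (abs_lsq f)"
  unfolding supported_iff using assms(2) rep_abs_lsq[OF assms(1)] by eventually_elim auto

lemma supported_add: "supported r f \<Longrightarrow> supported r g \<Longrightarrow> supported r (f + g)"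
  by (simp add: supported_def bounded_linear.linear[OF bounded_linear_cut, THEN linear_add])

lemma supported_diff: "supported r f \<Longrightarrow> supported r g \<Longrightarrow> supported r (f - g)"
  by (simp add: supported_def bounded_linear.linear[OF bounded_linear_cut, THEN linear_diff])

lemma supported_scaleR: "supported r f \<Longrightarrow> supported r (c *\<^sub>R f)"
  by (simp add: supported_def bounded_linear.linear[OF bounded_linear_cut, THEN linear_cmul])

lemma supported_uminus: "supported r f \<Longrightarrow> supported r (- f)"
  using supported_scaleR[of r f "-1"] by simp

lemma supported_mono:
  assumes "supported r f" "r \<le> r'"
  shows "supported r' f"
  using assms(1) unfolding supported_iff by (rule AE_mp) (use assms(2) in auto)

lemma supported_mul:
  assumes "bmeas b" "supported r f"
  shows "supported r (mul b f)"
proof -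
  have I: "bmeas (indicator {-r..r})" by (rule bmeas_indicator) simp
  have "mul (indicator {-r..r}) (mul b f) = mul b (mul (indicator {-r..r}) f)"
    unfolding mul_mul[OF I assms(1)] mul_mul[OF assms(1) I] by (simp add: mult.commute)
  then show ?thesis using assms(2) by (simp add: supported_def)
qed

lemma supported_tr:
  assumes "supported r f" "\<bar>s\<bar> \<le> d"
  shows "supported (r + d) (tr s f)"
proof -
  have I: "bmeas (indicator {-r..r} :: real \<Rightarrow> real)" by (rule bmeas_indicator) simp
  have J: "bmeas (indicator {-(r+d)..r+d} :: real \<Rightarrow> real)" by (rule bmeas_indicator) simp
  have eq: "tr s f = mul (\<lambda>x. indicator {-r..r} (x + s)) (tr s f)"
    using assms(1) tr_mul[OF I, of s f] by (simp add: supported_def)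
  have "indicator {-(r+d)..r+d} x * indicator {-r..r} (x + s) = (indicator {-r..r} (x + s) :: real)" for x
    using assms(2) by (auto simp: indicator_def)
  then have "mul (indicator {-(r+d)..r+d}) (mul (\<lambda>x. indicator {-r..r} (x + s)) (tr s f))
      = mul (\<lambda>x. indicator {-r..r} (x + s)) (tr s f)"
    by (simp only: mul_mul[OF J bmeas_shift[OF I]])
  then show ?thesis unfolding supported_def using eq by simp
qed

lemma supported_limit:
  assumes "\<And>n. supported r (X n)" "X \<longlonglongrightarrow> f"
  shows "supported r f"
proof -
  have "(\<lambda>n. mul (indicator {-r..r}) (X n)) \<longlonglongrightarrow> mul (indicator {-r..r}) f"
    by (rule bounded_linear.tendsto[OF bounded_linear_cut assms(2)])
  then have "X \<longlonglongrightarrow> mul (indicator {-r..r}) f" using assms(1) by (simp add: supported_def)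
  then show ?thesis unfolding supported_def using assms(2) by (rule LIMSEQ_unique)
qed

lemma supported_integral:
  fixes F :: "real \<Rightarrow> lsq"
  assumes "continuous_on {0..} F" "\<And>s. 0 \<le> s \<Longrightarrow> s \<le> t \<Longrightarrow> supported r (F s)"
  shows "supported r (integral {0..t} F)"
proof -
  have "mul (indicator {-r..r}) (integral {0..t} F) = integral {0..t} (\<lambda>s. mul (indicator {-r..r}) (F s))"
    by (rule integral_bounded_linear[OF assms(1) bounded_linear_cut])
  also have "\<dots> = integral {0..t} F"
    using assms(2) by (intro integral_cong) (auto simp: supported_def)
  finally show ?thesis by (simp add: supported_def)
qed

text \<open>For shifts shorter than \<open>e\<close> the orbit \<open>tr s f\<close> stays supported
  in the interval enlarged by \<open>e\<close>, hence so does its derivative \<open>g\<close>.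
  Letting \<open>e\<close> run through \<open>1 / Suc n\<close> removes the enlargement.\<close>

lemma supported_wd:
  assumes "wd f g" "supported r f"
  shows "supported r g"
proof -
  have *: "supported (r + e) g" if "0 < e" for e
  proof -
    have "((\<lambda>s. mul (indicator {-(r+e)..r+e}) (tr s f)) has_vector_derivative mul (indicator {-(r+e)..r+e}) g) (at 0)"
      by (rule bounded_linear.has_vector_derivative[OF bounded_linear_cut wd_tr_deriv[OF assms(1)]])
    then have "((\<lambda>s. tr s f) has_vector_derivative mul (indicator {-(r+e)..r+e}) g) (at 0)"
      by (rule has_vector_derivative_transform_within_open[of _ _ _ "{-e<..<e}"])
        (use that supported_tr[OF assms(2), of _ e] in \<open>auto simp: supported_def abs_le_iff\<close>)
    from vector_derivative_unique_at[OF this wd_tr_deriv[OF assms(1)]]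
    show ?thesis by (simp add: supported_def)
  qed
  have "AE x in lborel. \<forall>n. r + 1 / real (Suc n) < \<bar>x\<bar> \<longrightarrow> rep_lsq g x = 0"
    using * unfolding supported_iff AE_all_countable by simp
  then show ?thesis
    unfolding supported_iff
  proof eventually_elim
    case (elim x)
    show ?case
    proof
      assume "r < \<bar>x\<bar>"
      then obtain n where "inverse (real (Suc n)) < \<bar>x\<bar> - r"
        using reals_Archimedean[of "\<bar>x\<bar> - r"] by auto
      then have "r + 1 / real (Suc n) < \<bar>x\<bar>" unfolding inverse_eq_divide by linarith
      then show "rep_lsq g x = 0" using elim by blast
    qed
  qed
qed

text \<open>The iterates are kept as explicit functions because finite propagation speed is proved
  for each of them and then passed to the limit.\<close>

primrec picard :: "(real \<Rightarrow> 'a \<Rightarrow> 'a) \<Rightarrow> 'a \<Rightarrow> nat \<Rightarrow> real \<Rightarrow> 'a::banach" where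
  "picard A y 0 t = y"
| "picard A y (Suc n) t = y + integral {0..t} (\<lambda>s. A s (picard A y n s))"

lemma continuous_on_picard:
  fixes A :: "real \<Rightarrow> 'a::banach \<Rightarrow> 'a"
  assumes "\<And>F. continuous_on {0..} F \<Longrightarrow> continuous_on {0..} (\<lambda>t. A t (F t))"
  shows "continuous_on {0..} (picard A y n)"
proof (induction n)
  case 0
  have "picard A y 0 = (\<lambda>t. y)" by (simp add: fun_eq_iff)
  then show ?case by simp
next
  case (Suc n)
  have eq: "picard A y (Suc n) = (\<lambda>t. y + integral {0..t} (\<lambda>s. A s (picard A y n s)))"
    by (simp add: fun_eq_iff)
  have "continuous_on {0..} (\<lambda>t. integral {0..t} (\<lambda>s. A s (picard A y n s)))"
    using integral_has_vector_derivative_atLeast[OF assms[OF Suc]]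
    by (intro continuous_on_vector_derivative) auto
  then show ?case unfolding eq by (intro continuous_intros)
qed

text \<open>Successive iterates differ by at most \<open>norm y\<close> times
  \<open>(K t)^(n+1) / (n+1)!\<close>, which is summable uniformly on bounded intervals. Continuity
  of \<open>A\<close> is demanded only along continuous curves, because translations are strongly
  but not norm continuous in time.\<close>

lemma linear_ode_solution:
  fixes A :: "real \<Rightarrow> 'a::banach \<Rightarrow> 'a"
  assumes A_diff: "\<And>t x y. A t (x - y) = A t x - A t y"
    and A_bound: "\<And>t x. norm (A t x) \<le> M * norm x"
    and A_cont: "\<And>F. continuous_on {0..} F \<Longrightarrow> continuous_on {0..} (\<lambda>t. A t (F t))"
  obtains Y where "continuous_on {0..} Y"
    "\<And>t. 0 \<le> t \<Longrightarrow> Y t = y + integral {0..t} (\<lambda>s. A s (Y s))"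
    "\<And>t. 0 \<le> t \<Longrightarrow> (\<lambda>n. picard A y n t) \<longlonglongrightarrow> Y t"
proof -
  define X where "X = picard A y"
  \<comment> \<open>A positive constant is wanted, since the passage to the limit divides by
    it.\<close>
  define K where "K = max M 1"
  have K: "0 < K" by (simp add: K_def)
  have A_bound': "norm (A t x) \<le> K * norm x" for t x
    using A_bound[of t x] mult_right_mono[of M K "norm x"] by (simp add: K_def)
  have X_cont: "continuous_on {0..} (X n)" for n
    unfolding X_def using A_cont by (rule continuous_on_picard)
  have AX_int: "(\<lambda>s. A s (X n s)) integrable_on {0..t}" for n t
    by (intro integrable_continuous_real continuous_on_subset[OF A_cont[OF X_cont]]) auto
  have step: "norm (X (Suc n) t - X n t) \<le> norm y * ((K * t)^(Suc n) / fact (Suc n))" if "0 \<le> t" for n t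
    using that
  proof (induction n arbitrary: t)
    case 0
    have "norm (integral {0..t} (\<lambda>s. A s y)) \<le> integral {0..t} (\<lambda>s. K * norm y)"
      using AX_int[of 0 t] A_bound' by (intro integral_norm_bound_integral) (auto simp: X_def)
    then show ?case using 0 by (simp add: X_def algebra_simps)
  next
    case (Suc n)
    have "X (Suc (Suc n)) t - X (Suc n) t = integral {0..t} (\<lambda>s. A s (X (Suc n) s) - A s (X n s))"
      using AX_int[of "Suc n" t] AX_int[of n t] by (simp add: X_def integral_diff)
    also have "norm \<dots> \<le> integral {0..t} (\<lambda>s. norm y * K^(Suc (Suc n)) / fact (Suc n) * s^(Suc n))"
    proof (rule integral_norm_bound_integral)
      show "(\<lambda>s. A s (X (Suc n) s) - A s (X n s)) integrable_on {0..t}"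
        by (intro integrable_diff AX_int)
      show "(\<lambda>s. norm y * K^(Suc (Suc n)) / fact (Suc n) * s^(Suc n)) integrable_on {0..t}"
        by (intro integrable_continuous_real continuous_intros)
      fix s assume s: "s \<in> {0..t}"
      have "norm (A s (X (Suc n) s) - A s (X n s)) \<le> K * norm (X (Suc n) s - X n s)"
        using A_bound'[of s "X (Suc n) s - X n s"] by (simp add: A_diff)
      also have "\<dots> \<le> K * (norm y * ((K * s)^(Suc n) / fact (Suc n)))"
        using Suc.IH[of s] s K by (intro mult_left_mono) auto
      also have "\<dots> = norm y * K^(Suc (Suc n)) / fact (Suc n) * s^(Suc n)"
        by (simp add: power_mult_distrib del: fact_Suc)
      finally show "norm (A s (X (Suc n) s) - A s (X n s)) \<le> \<dots>" .
    qed
    also have "\<dots> = norm y * K^(Suc (Suc n)) / fact (Suc n) * (t^(Suc (Suc n)) / real (Suc (Suc n)))"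
    proof -
      have "((\<lambda>s. s^(Suc n)) has_integral t^(Suc (Suc n)) / real (Suc (Suc n)) - 0^(Suc (Suc n)) / real (Suc (Suc n))) {0..t}"
      proof (rule fundamental_theorem_of_calculus)
        show "((\<lambda>s. s^(Suc (Suc n)) / real (Suc (Suc n))) has_vector_derivative s^(Suc n)) (at s within {0..t})" for s
          unfolding has_real_derivative_iff_has_vector_derivative[symmetric]
          by (auto intro!: derivative_eq_intros simp del: of_nat_Suc power_Suc)
      qed (use Suc in simp)
      then show ?thesis by (simp add: integral_unique del: power_Suc of_nat_Suc fact_Suc)
    qed
    also have "\<dots> = norm y * ((K * t)^(Suc (Suc n)) / fact (Suc (Suc n)))"
      by (simp only: power_mult_distrib fact_Suc[of "Suc n"]) (simp add: field_simps)
    finally show ?case .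
  qed
  define Y where "Y t = y + (\<Sum>n. X (Suc n) t - X n t)" for t
  have unif: "uniform_limit {0..T} X Y sequentially" if "0 \<le> T" for T
  proof -
    have "uniform_limit {0..T} (\<lambda>n t. \<Sum>i<n. X (Suc i) t - X i t) (\<lambda>t. \<Sum>i. X (Suc i) t - X i t) sequentially"
    proof (rule Weierstrass_m_test)
      show "summable (\<lambda>n. norm y * ((K * T)^(Suc n) / fact (Suc n)))"
        using summable_exp[of "K * T"]
        by (intro summable_mult summable_Suc_iff[THEN iffD2, of "\<lambda>n. (K * T)^n / fact n"])
          (simp add: divide_inverse mult.commute)
      fix n t assume t: "t \<in> {0..T}"
      then have "norm (X (Suc n) t - X n t) \<le> norm y * ((K * t)^(Suc n) / fact (Suc n))"
        by (intro step) simp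
      also have "\<dots> \<le> norm y * ((K * T)^(Suc n) / fact (Suc n))"
        using t K by (intro mult_left_mono divide_right_mono power_mono) auto
      finally show "norm (X (Suc n) t - X n t) \<le> \<dots>" .
    qed
    moreover have "(\<Sum>i<n. X (Suc i) t - X i t) = X n t - y" for n t
      by (induction n) (simp_all add: X_def)
    ultimately have "uniform_limit {0..T} (\<lambda>n t. X n t - y) (\<lambda>t. \<Sum>i. X (Suc i) t - X i t) sequentially"
      by simp
    then have "uniform_limit {0..T} (\<lambda>n t. y + (X n t - y))
        (\<lambda>t. y + (\<Sum>i. X (Suc i) t - X i t)) sequentially"
      by (intro uniform_limit_intros)
    then show ?thesis by (simp add: Y_def[abs_def])
  qed
  have Y_cont: "continuous_on {0..} Y"
  proof (rule continuous_on_atLeastI)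
    fix b :: real
    show "continuous_on {0..b} Y"
    proof (cases "0 \<le> b")
      case True
      have "continuous_on {0..b} (X n)" for n using X_cont by (rule continuous_on_subset) auto
      then show ?thesis by (intro uniform_limit_theorem[OF _ unif[OF True]]) simp_all
    qed simp
  qed
  have X_lim: "(\<lambda>n. X n t) \<longlonglongrightarrow> Y t" if "0 \<le> t" for t
    by (rule tendsto_uniform_limitI[OF unif[OF that]]) (use that in simp)
  have Y_eq: "Y t = y + integral {0..t} (\<lambda>s. A s (Y s))" if t: "0 \<le> t" for t
  proof -
    have "uniform_limit {0..t} (\<lambda>n s. A s (X n s)) (\<lambda>s. A s (Y s)) sequentially"
    proof (rule uniform_limitI)
      fix e :: real assume "0 < e"
      then have "0 < e / K" using K by simp
      from uniform_limitD[OF unif[OF t] this]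
      show "\<forall>\<^sub>F n in sequentially. \<forall>s\<in>{0..t}. dist (A s (X n s)) (A s (Y s)) < e"
      proof eventually_elim
        case (elim n)
        show ?case
        proof
          fix s assume "s \<in> {0..t}"
          with elim have "norm (X n s - Y s) < e / K" by (simp add: dist_norm)
          then have "K * norm (X n s - Y s) < e" using K by (simp add: field_simps)
          moreover have "norm (A s (X n s) - A s (Y s)) \<le> K * norm (X n s - Y s)"
            using A_bound'[of s "X n s - Y s"] by (simp add: A_diff)
          ultimately show "dist (A s (X n s)) (A s (Y s)) < e" by (simp add: dist_norm)
        qed
      qed
    qed
    moreover have "continuous_on {0..t} (\<lambda>s. A s (X n s))" for n
      by (intro continuous_on_subset[OF A_cont[OF X_cont]]) auto
    ultimately obtain I J where I: "\<And>n. ((\<lambda>s. A s (X n s)) has_integral I n) {0..t}"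
      and J: "((\<lambda>s. A s (Y s)) has_integral J) {0..t}" and IJ: "I \<longlonglongrightarrow> J"
      by (rule uniform_limit_integral) auto
    have "X (Suc n) t = y + I n" for n using I[of n] by (simp add: X_def integral_unique)
    moreover have "(\<lambda>n. y + I n) \<longlonglongrightarrow> y + J" by (intro tendsto_intros IJ)
    ultimately have "(\<lambda>n. X (Suc n) t) \<longlonglongrightarrow> y + J" by simp
    moreover have "(\<lambda>n. X (Suc n) t) \<longlonglongrightarrow> Y t" using X_lim[OF t] by (rule LIMSEQ_Suc)
    ultimately have "y + J = Y t" by (rule LIMSEQ_unique)
    then show ?thesis using J by (simp add: integral_unique)
  qed
  show thesis using that[OF Y_cont Y_eq] X_lim by (simp add: X_def)
qed

subsection \<open>Existence of solutions\<close>

text \<open>The distributional equation in time becomes a classical derivative of the pairing with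
  each spatial test function, one-sided at \<open>0\<close>; \<open>weak_eq_iff_derivative\<close>
  shows that the two agree for continuous curves. Continuity of \<open>U\<close> is implied by its
  derivative.\<close>

definition wsol ::
  "(real \<Rightarrow> real) \<Rightarrow> (real \<Rightarrow> real) \<Rightarrow> (real \<Rightarrow> lsq) \<Rightarrow> (real \<Rightarrow> lsq) \<Rightarrow> (real \<Rightarrow> lsq) \<Rightarrow> bool" where
  "wsol a V U Ut Ux \<longleftrightarrow>
     continuous_on {0..} Ut \<and> continuous_on {0..} Ux \<and>
     (\<forall>t\<ge>0. wd (U t) (Ux t)) \<and>
     (\<forall>t\<ge>0. (U has_vector_derivative Ut t) (at t within {0..})) \<and>
     (\<forall>\<phi> t. test_fun \<phi> \<longrightarrow> 0 \<le> t \<longrightarrow>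
        ((\<lambda>t. inner (Ut t) (abs_lsq \<phi>)) has_vector_derivative
          - inner (Ux t) (abs_lsq (deriv \<phi>)) - inner (mul V (U t)) (abs_lsq \<phi>)
          - inner (mul a (Ut t)) (abs_lsq \<phi>)) (at t within {0..}))"

lemma wsol_continuous:
  assumes "wsol a V U Ut Ux"
  shows "continuous_on {0..} U"
  using assms unfolding wsol_def by (intro continuous_on_vector_derivative) auto

lemma wsol_diff:
  assumes "bmeas a" "bmeas V" "wsol a V U Ut Ux" "wsol a V U' Ut' Ux'"
  shows "wsol a V (\<lambda>t. U t - U' t) (\<lambda>t. Ut t - Ut' t) (\<lambda>t. Ux t - Ux' t)"
  unfolding wsol_def
proof (intro conjI allI impI)
  note [simp] = bounded_linear.linear[OF bounded_linear_mul, THEN linear_diff]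
  show "continuous_on {0..} (\<lambda>t. Ut t - Ut' t)" "continuous_on {0..} (\<lambda>t. Ux t - Ux' t)"
    using assms(3,4) by (auto simp: wsol_def intro!: continuous_intros)
  show "wd (U t - U' t) (Ux t - Ux' t)" if "0 \<le> t" for t
    using assms(3,4) that by (auto simp: wsol_def intro!: wd_diff)
  show "((\<lambda>t. U t - U' t) has_vector_derivative Ut t - Ut' t) (at t within {0..})" if "0 \<le> t" for t
    using assms(3,4) that by (auto simp: wsol_def intro!: has_vector_derivative_diff)
  fix \<phi> and t :: real assume "test_fun \<phi>" "0 \<le> t"
  then have "((\<lambda>t. inner (Ut t) (abs_lsq \<phi>) - inner (Ut' t) (abs_lsq \<phi>)) has_vector_derivative
      (- inner (Ux t) (abs_lsq (deriv \<phi>)) - inner (mul V (U t)) (abs_lsq \<phi>) - inner (mul a (Ut t)) (abs_lsq \<phi>))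
      - (- inner (Ux' t) (abs_lsq (deriv \<phi>)) - inner (mul V (U' t)) (abs_lsq \<phi>) - inner (mul a (Ut' t)) (abs_lsq \<phi>)))
      (at t within {0..})"
    using assms(3,4) unfolding wsol_def by (intro has_vector_derivative_diff) blast+
  then show "((\<lambda>t. inner (Ut t - Ut' t) (abs_lsq \<phi>)) has_vector_derivative
      - inner (Ux t - Ux' t) (abs_lsq (deriv \<phi>)) - inner (mul V (U t - U' t)) (abs_lsq \<phi>)
      - inner (mul a (Ut t - Ut' t)) (abs_lsq \<phi>)) (at t within {0..})"
    using assms(1,2) by (simp add: inner_diff_left algebra_simps)
qed

lemma norm_fst_le': "norm (fst y) \<le> norm y"
  and norm_snd_le': "norm (snd y) \<le> norm y"
  for y :: "'a::real_normed_vector \<times> 'b::real_normed_vector"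
  using norm_fst_le[of "fst y" "snd y"] norm_snd_le[of "snd y" "fst y"] by simp_all

text \<open>The characteristic variables \<open>u\<^sub>t \<plusminus> u\<^sub>x\<close>, pulled back along the characteristics, solve a linear
  ordinary differential equation with bounded right-hand side.\<close>

lemma wsol_exists:
  assumes a: "bmeas a" and V: "bmeas V" and u0: "wd u0 u0x"
    and supp: "supported r u0" "supported r u1" and r: "0 \<le> r"
  obtains U Ut Ux where "wsol a V U Ut Ux" "U 0 = u0" "Ut 0 = u1"
    "\<And>t. 0 \<le> t \<Longrightarrow> supported (r + t) (U t)"
proof -
  obtain B where B: "\<And>x. \<bar>a x\<bar> \<le> B" using a by (auto simp: bmeas_def bounded_iff)
  obtain B' where B': "\<And>x. \<bar>V x\<bar> \<le> B'" using V by (auto simp: bmeas_def bounded_iff)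
  have B0: "0 \<le> B" "0 \<le> B'" using B[of 0] B'[of 0] by simp_all
  \<comment> \<open>The components of \<open>z\<close> are \<open>u_t + u_x\<close> pulled back by
    \<open>tr (- t)\<close>, \<open>u_t - u_x\<close> pulled back by \<open>tr t\<close>, and
    \<open>u\<close>. So \<open>P\<close> recovers \<open>u_t\<close>, \<open>F\<close> is
    \<open>- V u - a u_t\<close>, and no spatial derivative is left in \<open>A\<close>.\<close>
  define P where "P t z = (1/2) *\<^sub>R (tr t (fst z) + tr (- t) (fst (snd z)))" for t and z :: "lsq \<times> lsq \<times> lsq"
  define F where "F t z = - mul V (snd (snd z)) - mul a (P t z)" for t z
  define A where "A t z = (tr (- t) (F t z), tr t (F t z), P t z)" for t z
  define z0 where "z0 = (u1 + u0x, u1 - u0x, u0)"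
  note tr_diff = bounded_linear.linear[OF bounded_linear_tr, THEN linear_diff]
  note tr_add = bounded_linear.linear[OF bounded_linear_tr, THEN linear_add]
  note mul_diff = bounded_linear.linear[OF bounded_linear_mul, THEN linear_diff]
  have P_diff: "P t (x - y) = P t x - P t y" for t x y
    by (simp add: P_def tr_diff algebra_simps)
  have F_diff: "F t (x - y) = F t x - F t y" for t x y
    by (simp add: F_def P_diff mul_diff a V)
  have A_diff: "A t (x - y) = A t x - A t y" for t x y
    by (simp add: A_def F_diff P_diff tr_diff)
  have P_bound: "norm (P t z) \<le> norm z" for t z
  proof -
    have "norm (P t z) \<le> (1/2) * (norm (fst z) + norm (fst (snd z)))"
      unfolding P_def using norm_triangle_ineq[of "tr t (fst z)" "tr (- t) (fst (snd z))"] by simp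
    also have "norm (fst z) \<le> norm z" by (rule norm_fst_le')
    also have "norm (fst (snd z)) \<le> norm z" using norm_fst_le'[of "snd z"] norm_snd_le'[of z] by simp
    finally show ?thesis by simp
  qed
  have F_bound: "norm (F t z) \<le> (B + B') * norm z" for t z
  proof -
    have "norm (F t z) \<le> norm (mul V (snd (snd z))) + norm (mul a (P t z))"
      unfolding F_def using norm_triangle_ineq4[of "- mul V (snd (snd z))" "mul a (P t z)"] by simp
    also have "\<dots> \<le> B' * norm (snd (snd z)) + B * norm (P t z)"
      by (intro add_mono norm_mul_le a V B B')
    also have "\<dots> \<le> B' * norm z + B * norm z"
      using B0 P_bound norm_snd_le'[of z] norm_snd_le'[of "snd z"] by (intro add_mono mult_left_mono) (auto intro: order_trans)
    finally show ?thesis by (simp add: algebra_simps)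
  qed
  have A_bound: "norm (A t z) \<le> (2 * (B + B') + 1) * norm z" for t z
  proof -
    have "norm (A t z) \<le> norm (F t z) + (norm (F t z) + norm (P t z))"
      unfolding A_def using norm_Pair_le[of "tr (- t) (F t z)" "(tr t (F t z), P t z)"]
        norm_Pair_le[of "tr t (F t z)" "P t z"] by simp
    then show ?thesis using F_bound[of t z] P_bound[of t z] by (simp add: algebra_simps)
  qed
  have P_cont: "continuous_on {0..} (\<lambda>t. P t (G t))" if "continuous_on {0..} G" for G
    unfolding P_def using that by (intro continuous_intros continuous_on_tr_compose)
  have F_cont: "continuous_on {0..} (\<lambda>t. F t (G t))" if "continuous_on {0..} G" for G
    unfolding F_def using that P_cont[OF that]
    by (intro continuous_intros bounded_linear.continuous_on[OF bounded_linear_mul] a V)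
  have A_cont: "continuous_on {0..} (\<lambda>t. A t (G t))" if "continuous_on {0..} G" for G
    unfolding A_def using P_cont[OF that] F_cont[OF that]
    by (intro continuous_intros continuous_on_tr_compose)
  obtain Y where Y_cont: "continuous_on {0..} Y"
    and Y_eq: "\<And>t. 0 \<le> t \<Longrightarrow> Y t = z0 + integral {0..t} (\<lambda>s. A s (Y s))"
    and Y_lim: "\<And>t. 0 \<le> t \<Longrightarrow> (\<lambda>n. picard A z0 n t) \<longlonglongrightarrow> Y t"
    by (rule linear_ode_solution[of A "2 * (B + B') + 1" z0, OF A_diff A_bound A_cont]) (assumption | rule that)+

  \<comment> \<open>Supports are tracked after the pull-back has been undone, since
    \<open>u_t + u_x\<close> and \<open>u_t - u_x\<close> themselves are what spreads with unit
    speed.\<close>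
  define S where "S t z \<longleftrightarrow> supported (r + t) (tr t (fst z)) \<and> supported (r + t) (tr (- t) (fst (snd z)))
      \<and> supported (r + t) (snd (snd z))" for t z
  have suppx: "supported r u0x" using u0 supp(1) by (rule supported_wd)
  have z0_supp: "supported r (fst z0)" "supported r (fst (snd z0))" "supported r (snd (snd z0))"
    using suppx supp by (simp_all add: z0_def supported_add supported_diff)
  have S_z0: "S t z0" if "0 \<le> t" for t
    unfolding S_def using z0_supp that by (auto intro: supported_tr supported_mono)
  have S_P: "supported (r + t) (P t z)" if "S t z" for t z
    using that unfolding S_def P_def by (auto intro!: supported_scaleR supported_add)
  have S_F: "supported (r + t) (F t z)" if "S t z" for t z
    using that S_P[OF that] unfolding F_def
    by (auto intro!: supported_diff supported_uminus supported_mul a V simp: S_def)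
  have S_picard: "S t (picard A z0 n t)" if "0 \<le> t" for n t
    using that
  proof (induction n arbitrary: t)
    case 0 then show ?case by (simp add: S_z0)
  next
    case (Suc n)
    define G where "G = picard A z0 n"
    have G: "continuous_on {0..} G" unfolding G_def by (rule continuous_on_picard[OF A_cont])
    note cF = F_cont[OF G] and cP = P_cont[OF G]
    have cF': "continuous_on {0..} (\<lambda>s. tr (- s) (F s (G s)))" "continuous_on {0..} (\<lambda>s. tr s (F s (G s)))"
      by (intro continuous_on_tr_compose continuous_intros cF)+
    have SG: "S s (G s)" if "0 \<le> s" for s using Suc.IH[OF that] by (simp add: G_def)
    have eq: "picard A z0 (Suc n) t = z0 + integral {0..t} (\<lambda>s. A s (G s))" by (simp add: G_def)
    have 1: "fst (picard A z0 (Suc n) t) = fst z0 + integral {0..t} (\<lambda>s. tr (- s) (F s (G s)))"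
      unfolding eq using integral_bounded_linear[OF A_cont[OF G] bounded_linear_fst, of t] by (simp add: A_def)
    have 2: "fst (snd (picard A z0 (Suc n) t)) = fst (snd z0) + integral {0..t} (\<lambda>s. tr s (F s (G s)))"
      unfolding eq using integral_bounded_linear[OF A_cont[OF G] bounded_linear_compose[OF bounded_linear_fst bounded_linear_snd], of t]
      by (simp add: A_def)
    have 3: "snd (snd (picard A z0 (Suc n) t)) = snd (snd z0) + integral {0..t} (\<lambda>s. P s (G s))"
      unfolding eq using integral_bounded_linear[OF A_cont[OF G] bounded_linear_compose[OF bounded_linear_snd bounded_linear_snd], of t]
      by (simp add: A_def)
    \<comment> \<open>Duhamel's principle: a source at time \<open>s\<close>, supported within
      radius \<open>r + s\<close>, travels for the remaining time \<open>t - s\<close>, and the two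
      lengths add up to \<open>r + t\<close>.\<close>
    have "supported (r + t) (integral {0..t} (\<lambda>s. tr (t - s) (F s (G s))))"
    proof (rule supported_integral)
      show "continuous_on {0..} (\<lambda>s. tr (t - s) (F s (G s)))"
        by (intro continuous_on_tr_compose continuous_intros cF)
      fix s assume s: "0 \<le> s" "s \<le> t"
      then have "supported (r + s + (t - s)) (tr (t - s) (F s (G s)))"
        by (intro supported_tr S_F SG) auto
      then show "supported (r + t) (tr (t - s) (F s (G s)))" by simp
    qed
    then have "supported (r + t) (tr t (fst (picard A z0 (Suc n) t)))"
      unfolding 1 tr_add integral_bounded_linear[OF cF'(1) bounded_linear_tr]
      using supported_tr[OF z0_supp(1), of t t] Suc.prems by (auto intro!: supported_add)
    moreover
    have "supported (r + t) (integral {0..t} (\<lambda>s. tr (- t + s) (F s (G s))))"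
    proof (rule supported_integral)
      show "continuous_on {0..} (\<lambda>s. tr (- t + s) (F s (G s)))"
        by (intro continuous_on_tr_compose continuous_intros cF)
      fix s assume s: "0 \<le> s" "s \<le> t"
      then have "supported (r + s + (t - s)) (tr (- t + s) (F s (G s)))"
        by (intro supported_tr S_F SG) auto
      then show "supported (r + t) (tr (- t + s) (F s (G s)))" by simp
    qed
    then have "supported (r + t) (tr (- t) (fst (snd (picard A z0 (Suc n) t))))"
      unfolding 2 tr_add integral_bounded_linear[OF cF'(2) bounded_linear_tr]
      using supported_tr[OF z0_supp(2), of "- t" t] Suc.prems by (auto intro!: supported_add)
    moreover
    have "supported (r + t) (integral {0..t} (\<lambda>s. P s (G s)))"
      using supported_mono[OF S_P[OF SG], of _ "r + t"] by (intro supported_integral[OF cP]) simp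
    then have "supported (r + t) (snd (snd (picard A z0 (Suc n) t)))"
      unfolding 3 using supported_mono[OF z0_supp(3), of "r + t"] Suc.prems by (auto intro!: supported_add)
    ultimately show ?case by (simp only: S_def)
  qed
  define Z1 Z2 U where "Z1 t = fst (Y t)" and "Z2 t = fst (snd (Y t))" and "U t = snd (snd (Y t))" for t
  define Ut where "Ut t = P t (Y t)" for t
  define Ux where "Ux t = (1/2) *\<^sub>R (tr t (Z1 t) - tr (- t) (Z2 t))" for t
  have Ut_eq: "Ut t = (1/2) *\<^sub>R (tr t (Z1 t) + tr (- t) (Z2 t))" for t
    by (simp add: Ut_def P_def Z1_def Z2_def)
  have U_supp: "supported (r + t) (U t)" if "0 \<le> t" for t
    unfolding U_def
    by (rule supported_limit[of _ "\<lambda>n. snd (snd (picard A z0 n t))"])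
      (use S_picard[OF that] Y_lim[OF that] in \<open>auto simp: S_def intro!: tendsto_snd\<close>)
  have Y_deriv: "(Y has_vector_derivative A t (Y t)) (at t within {0..})" if "0 \<le> t" for t
  proof -
    have "((\<lambda>t. z0 + integral {0..t} (\<lambda>s. A s (Y s))) has_vector_derivative 0 + A t (Y t)) (at t within {0..})"
      by (intro has_vector_derivative_add has_vector_derivative_const
          integral_has_vector_derivative_atLeast A_cont Y_cont that)
    then have "((\<lambda>t. z0 + integral {0..t} (\<lambda>s. A s (Y s))) has_vector_derivative A t (Y t)) (at t within {0..})"
      by simp
    then show ?thesis
      by (rule has_vector_derivative_transform[rotated 2]) (use that Y_eq in auto)
  qed
  have Z1_deriv: "(Z1 has_vector_derivative tr (- t) (F t (Y t))) (at t within {0..})"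
    and Z2_deriv: "(Z2 has_vector_derivative tr t (F t (Y t))) (at t within {0..})"
    and U_deriv: "(U has_vector_derivative Ut t) (at t within {0..})" if "0 \<le> t" for t
    unfolding Z1_def Z2_def U_def Ut_def
    using bounded_linear.has_vector_derivative[OF bounded_linear_fst Y_deriv[OF that]]
      bounded_linear.has_vector_derivative[OF bounded_linear_compose[OF bounded_linear_fst bounded_linear_snd] Y_deriv[OF that]]
      bounded_linear.has_vector_derivative[OF bounded_linear_compose[OF bounded_linear_snd bounded_linear_snd] Y_deriv[OF that]]
    by (simp_all add: A_def)
  \<comment> \<open>The pull-backs are differentiable in norm, but \<open>tr t (Z1 t)\<close> is
    treated only in pairings: there the translation falls on the test function and contributes the
    term with \<open>deriv \<phi>\<close>.\<close>
  have p_deriv: "((\<lambda>t. inner (tr t (Z1 t)) (abs_lsq \<phi>)) has_vector_derivative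
      inner (F t (Y t)) (abs_lsq \<phi>) - inner (tr t (Z1 t)) (abs_lsq (deriv \<phi>))) (at t within {0..})"
    and q_deriv: "((\<lambda>t. inner (tr (- t) (Z2 t)) (abs_lsq \<phi>)) has_vector_derivative
      inner (F t (Y t)) (abs_lsq \<phi>) + inner (tr (- t) (Z2 t)) (abs_lsq (deriv \<phi>))) (at t within {0..})"
    if "0 \<le> t" "test_fun \<phi>" for t \<phi>
    using bounded_bilinear.has_vector_derivative[OF bounded_bilinear_inner
        Z1_deriv[OF that(1)] tr_uminus_test_fun_deriv[OF that(2)]]
      bounded_bilinear.has_vector_derivative[OF bounded_bilinear_inner
        Z2_deriv[OF that(1)] tr_test_fun_deriv[OF that(2)]]
    by (simp_all add: inner_tr_left add.commute inner_tr_tr)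
  have Y0: "Y 0 = z0" using Y_eq[of 0] by simp
  have init: "U 0 = u0" "Ut 0 = u1" "Ux 0 = u0x"
    by (simp_all add: Ut_eq Ux_def U_def Z1_def Z2_def Y0 z0_def flip: scaleR_add_left)
  have wsol: "wsol a V U Ut Ux"
    unfolding wsol_def
  proof (intro conjI allI impI)
    show "continuous_on {0..} Ut" unfolding Ut_def by (rule P_cont[OF Y_cont])
    show "continuous_on {0..} Ux" unfolding Ux_def Z1_def Z2_def
      by (intro continuous_intros continuous_on_tr_compose Y_cont)
    show "(U has_vector_derivative Ut t) (at t within {0..})" if "0 \<le> t" for t by (rule U_deriv[OF that])
    show "((\<lambda>t. inner (Ut t) (abs_lsq \<phi>)) has_vector_derivative
          - inner (Ux t) (abs_lsq (deriv \<phi>)) - inner (mul V (U t)) (abs_lsq \<phi>)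
          - inner (mul a (Ut t)) (abs_lsq \<phi>)) (at t within {0..})"
      if "test_fun \<phi>" "0 \<le> t" for \<phi> t
    proof -
      have "((\<lambda>t. (1/2) *\<^sub>R (inner (tr t (Z1 t)) (abs_lsq \<phi>) + inner (tr (- t) (Z2 t)) (abs_lsq \<phi>)))
          has_vector_derivative (1/2) *\<^sub>R ((inner (F t (Y t)) (abs_lsq \<phi>) - inner (tr t (Z1 t)) (abs_lsq (deriv \<phi>)))
            + (inner (F t (Y t)) (abs_lsq \<phi>) + inner (tr (- t) (Z2 t)) (abs_lsq (deriv \<phi>))))) (at t within {0..})"
        by (intro bounded_linear.has_vector_derivative[OF bounded_linear_scaleR_right]
            has_vector_derivative_add p_deriv q_deriv that)
      moreover have "F t (Y t) = - mul V (U t) - mul a (Ut t)" by (simp add: F_def U_def Ut_def)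
      ultimately show ?thesis
        by (simp add: Ut_eq Ux_def inner_add_left inner_diff_left algebra_simps)
    qed
    show "wd (U t) (Ux t)" if t: "0 \<le> t" for t
      unfolding wd_def
    proof (intro allI impI)
      fix \<phi> assume \<phi>: "test_fun \<phi>"
      \<comment> \<open>The weak form of \<open>u_tx = u_xt\<close>: the defect of the relation
        between \<open>U\<close> and \<open>Ux\<close> is conserved, and it vanishes at time
        \<open>0\<close>.\<close>
      have "inner (U t) (abs_lsq (deriv \<phi>)) + inner (Ux t) (abs_lsq \<phi>)
          = inner (U 0) (abs_lsq (deriv \<phi>)) + inner (Ux 0) (abs_lsq \<phi>)"
      proof (rule zero_derivative_atLeast_constant[OF _ t])
        fix s :: real assume s: "0 \<le> s"
        have "((\<lambda>t. inner (U t) (abs_lsq (deriv \<phi>))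
              + (1/2) *\<^sub>R (inner (tr t (Z1 t)) (abs_lsq \<phi>) - inner (tr (- t) (Z2 t)) (abs_lsq \<phi>)))
            has_vector_derivative inner (Ut s) (abs_lsq (deriv \<phi>))
              + (1/2) *\<^sub>R ((inner (F s (Y s)) (abs_lsq \<phi>) - inner (tr s (Z1 s)) (abs_lsq (deriv \<phi>)))
              - (inner (F s (Y s)) (abs_lsq \<phi>) + inner (tr (- s) (Z2 s)) (abs_lsq (deriv \<phi>))))) (at s within {0..})"
          by (intro has_vector_derivative_add has_vector_derivative_diff p_deriv q_deriv s \<phi>
              bounded_linear.has_vector_derivative[OF bounded_linear_scaleR_right]
              bounded_linear.has_vector_derivative[OF bounded_linear_inner_left] U_deriv)
        then show "((\<lambda>t. inner (U t) (abs_lsq (deriv \<phi>)) + inner (Ux t) (abs_lsq \<phi>)) has_vector_derivative 0) (at s within {0..})"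
          by (simp add: Ut_eq Ux_def inner_add_left inner_diff_left algebra_simps)
      qed
      also have "\<dots> = 0" using wdD[OF u0 \<phi>] by (simp add: init)
      finally show "inner (U t) (abs_lsq (deriv \<phi>)) = - inner (Ux t) (abs_lsq \<phi>)" by simp
    qed
  qed
  show thesis using that[OF wsol init(1,2) U_supp] by blast
qed

subsection \<open>Energy identities\<close>

lemma decreasing_atLeast:
  fixes f :: "real \<Rightarrow> real"
  assumes "\<And>t. 0 \<le> t \<Longrightarrow> (f has_vector_derivative f' t) (at t within {0..})"
    and "\<And>t. 0 \<le> t \<Longrightarrow> f' t \<le> 0" and "0 \<le> t"
  shows "f t \<le> f 0"
proof (cases "t = 0")
  case False
  then have t: "0 < t" using assms(3) by simp
  have "continuous_on {0..} f" by (rule continuous_on_vector_derivative) (use assms(1) in auto)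
  then have "continuous_on {0..t} f" by (rule continuous_on_subset) auto
  moreover have "(f has_real_derivative f' x) (at x)" if "0 < x" for x
  proof -
    have "at x within {0..} = at x" using that by (intro at_within_interior) (simp add: interior_real_atLeast)
    then show ?thesis using assms(1)[of x] that by (simp add: has_real_derivative_iff_has_vector_derivative)
  qed
  ultimately show ?thesis using t assms(2)
    by (intro DERIV_nonpos_imp_decreasing_open[of 0 t f]) (auto intro!: exI)
qed simp

lemma inner_self_deriv:
  fixes F :: "real \<Rightarrow> 'a::real_inner"
  assumes "(F has_vector_derivative F') (at t within S)"
  shows "((\<lambda>t. inner (F t) (F t)) has_vector_derivative 2 * inner (F t) F') (at t within S)"
  using bounded_bilinear.has_vector_derivative[OF bounded_bilinear_inner assms assms]
  by (simp add: inner_commute)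

lemma inner_mul_self_deriv:
  assumes "bmeas b" "(F has_vector_derivative F') (at t within S)"
  shows "((\<lambda>t. inner (mul b (F t)) (F t)) has_vector_derivative 2 * inner (mul b (F t)) F') (at t within S)"
proof -
  have "((\<lambda>t. mul b (F t)) has_vector_derivative mul b F') (at t within S)"
    by (rule bounded_linear.has_vector_derivative[OF bounded_linear_mul[OF assms(1)] assms(2)])
  from bounded_bilinear.has_vector_derivative[OF bounded_bilinear_inner this assms(2)]
  show ?thesis using inner_mul_left[OF assms(1), of F' "F t"] by (simp add: inner_commute)
qed

text \<open>The equation integrated once in time, which only involves \<open>u\<close> and \<open>u\<^sub>t\<close> and can therefore
  be tested with \<open>u\<close> itself.\<close>

lemma wsol_integrated:
  assumes a: "bmeas a" and V: "bmeas V" and sol: "wsol a V U Ut Ux" and t: "0 \<le> t"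
  shows "wd (integral {0..t} Ux)
    (Ut t - Ut 0 + mul V (integral {0..t} U) + mul a (U t - U 0))"
  unfolding wd_def
proof (intro allI impI)
  fix \<phi> assume \<phi>: "test_fun \<phi>"
  let ?D = "\<lambda>t. inner (Ut t) (abs_lsq \<phi>) + inner (integral {0..t} Ux) (abs_lsq (deriv \<phi>))
      + inner (mul V (integral {0..t} U)) (abs_lsq \<phi>) + inner (mul a (U t)) (abs_lsq \<phi>)"
  have "?D t = ?D 0"
  proof (rule zero_derivative_atLeast_constant[OF _ t])
    fix s :: real assume s: "0 \<le> s"
    have "(?D has_vector_derivative
        (- inner (Ux s) (abs_lsq (deriv \<phi>)) - inner (mul V (U s)) (abs_lsq \<phi>) - inner (mul a (Ut s)) (abs_lsq \<phi>))
        + inner (Ux s) (abs_lsq (deriv \<phi>)) + inner (mul V (U s)) (abs_lsq \<phi>) + inner (mul a (Ut s)) (abs_lsq \<phi>))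
        (at s within {0..})"
      using sol s \<phi> wsol_continuous[OF sol] unfolding wsol_def
      by (intro has_vector_derivative_add bounded_linear.has_vector_derivative[OF bounded_linear_inner_left]
          bounded_linear.has_vector_derivative[OF bounded_linear_mul] a V integral_has_vector_derivative_atLeast)
        blast+
    then show "(?D has_vector_derivative 0) (at s within {0..})" by simp
  qed
  then show "inner (integral {0..t} Ux) (abs_lsq (deriv \<phi>))
      = - inner (Ut t - Ut 0 + mul V (integral {0..t} U) + mul a (U t - U 0)) (abs_lsq \<phi>)"
    using a V by (simp add: inner_add_left inner_diff_left bounded_linear.linear[OF bounded_linear_mul, THEN linear_diff]
        bounded_linear.linear[OF bounded_linear_mul, THEN linear_0])
qed

text \<open>Pairing the integrated equation with \<open>U t\<close> by \<open>wd_skew\<close>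
  produces the inner product of \<open>Ux t\<close> with its own time integral, which is half the
  derivative of a square.\<close>

lemma wsol_integrated_energy:
  assumes a: "bmeas a" and V: "bmeas V" and sol: "wsol a V U Ut Ux" and t: "0 \<le> t"
  shows "((\<lambda>t. inner (U t) (U t) + inner (integral {0..t} Ux) (integral {0..t} Ux)
      + inner (mul V (integral {0..t} U)) (integral {0..t} U)) has_vector_derivative
      2 * (inner (Ut 0 + mul a (U 0)) (U t) - inner (mul a (U t)) (U t))) (at t within {0..})"
proof -
  have cont: "continuous_on {0..} U" "continuous_on {0..} Ux"
    using sol wsol_continuous[OF sol] by (auto simp: wsol_def)
  have "wd (U t) (Ux t)" using sol t by (simp add: wsol_def)
  from wd_skew[OF wsol_integrated[OF a V sol t] this]
  have skew: "inner (integral {0..t} Ux) (Ux t)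
      = - inner (Ut t - Ut 0 + mul V (integral {0..t} U) + mul a (U t - U 0)) (U t)" .
  have "((\<lambda>t. inner (U t) (U t) + inner (integral {0..t} Ux) (integral {0..t} Ux)
      + inner (mul V (integral {0..t} U)) (integral {0..t} U)) has_vector_derivative
      2 * inner (U t) (Ut t) + 2 * inner (integral {0..t} Ux) (Ux t)
      + 2 * inner (mul V (integral {0..t} U)) (U t)) (at t within {0..})"
    using sol t unfolding wsol_def
    by (intro has_vector_derivative_add inner_self_deriv inner_mul_self_deriv V
        integral_has_vector_derivative_atLeast cont) auto
  then show ?thesis
    unfolding skew using a
    by (simp add: inner_add_left inner_diff_left inner_commute algebra_simps
        bounded_linear.linear[OF bounded_linear_mul, THEN linear_diff])
qed

text \<open>For the difference of two solutions the source in the integrated energy identity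
  vanishes, so a sum of nonnegative terms starts at zero and cannot grow. One of its terms is the
  squared norm of the difference itself.\<close>

lemma wsol_unique:
  assumes a: "bmeas a" "\<And>x. 0 \<le> a x" and V: "bmeas V" "\<And>x. 0 \<le> V x"
    and sol: "wsol a V U Ut Ux" "wsol a V U' Ut' Ux'"
    and init: "U 0 = U' 0" "Ut 0 = Ut' 0" and t: "0 \<le> t"
  shows "U t = U' t"
proof -
  define w where "w t = U t - U' t" for t
  define wt where "wt t = Ut t - Ut' t" for t
  define wx where "wx t = Ux t - Ux' t" for t
  have w: "wsol a V w wt wx"
    unfolding w_def[abs_def] wt_def[abs_def] wx_def[abs_def] by (rule wsol_diff[OF a(1) V(1) sol])
  have w0: "w 0 = 0" "wt 0 = 0" using init by (simp_all add: w_def wt_def)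
  have mul0: "mul a 0 = 0" "mul V 0 = 0"
    using a V by (simp_all add: bounded_linear.linear[OF bounded_linear_mul, THEN linear_0])
  have "inner (w t) (w t) + inner (integral {0..t} wx) (integral {0..t} wx)
      + inner (mul V (integral {0..t} w)) (integral {0..t} w)
    \<le> inner (w 0) (w 0) + inner (integral {0..0} wx) (integral {0..0} wx)
      + inner (mul V (integral {0..0} w)) (integral {0..0} w)"
    by (rule decreasing_atLeast[OF wsol_integrated_energy[OF a(1) V(1) w]])
      (use t in \<open>simp_all add: w0 mul0 inner_mul_nonneg a\<close>)
  also have "\<dots> = 0" by (simp add: w0 mul0)
  finally have "inner (w t) (w t) + inner (integral {0..t} wx) (integral {0..t} wx)
      + inner (mul V (integral {0..t} w)) (integral {0..t} w) \<le> 0" .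
  moreover have "0 \<le> inner (mul V (integral {0..t} w)) (integral {0..t} w)"
    by (rule inner_mul_nonneg[OF V])
  moreover have "0 \<le> inner (integral {0..t} wx) (integral {0..t} wx)" by simp
  ultimately have "inner (w t) (w t) = 0" using inner_ge_zero[of "w t"] by linarith
  then show ?thesis by (simp add: w_def)
qed

text \<open>The curves \<open>v\<close>, \<open>w\<close> and \<open>vx\<close> stand for
  \<open>u_t\<close>, \<open>u_tt\<close> and \<open>u_tx\<close>. The last clause is the equation:
  \<open>u_xx\<close> exists and equals \<open>w + V u + a v\<close>.\<close>

definition ssol ::
  "(real \<Rightarrow> real) \<Rightarrow> (real \<Rightarrow> real) \<Rightarrow> (real \<Rightarrow> lsq) \<Rightarrow> (real \<Rightarrow> lsq) \<Rightarrow> (real \<Rightarrow> lsq) \<Rightarrow>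
    (real \<Rightarrow> lsq) \<Rightarrow> (real \<Rightarrow> lsq) \<Rightarrow> bool" where
  "ssol a V u v w ux vx \<longleftrightarrow>
     (\<forall>t\<ge>0. (u has_vector_derivative v t) (at t within {0..}) \<and>
        (v has_vector_derivative w t) (at t within {0..}) \<and>
        (ux has_vector_derivative vx t) (at t within {0..}) \<and>
        wd (u t) (ux t) \<and> wd (v t) (vx t) \<and> wd (ux t) (w t + mul V (u t) + mul a (v t)))"

lemma ssol_wsol:
  assumes "ssol a V u v w ux vx"
  shows "wsol a V u v ux"
  unfolding wsol_def
proof (intro conjI allI impI)
  show "continuous_on {0..} v" "continuous_on {0..} ux"
    using assms by (auto simp: ssol_def intro!: continuous_on_vector_derivative)
  show "wd (u t) (ux t)" "(u has_vector_derivative v t) (at t within {0..})" if "0 \<le> t" for t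
    using assms that by (simp_all add: ssol_def)
  fix \<phi> and t :: real assume \<phi>: "test_fun \<phi>" and t: "0 \<le> t"
  have "((\<lambda>t. inner (v t) (abs_lsq \<phi>)) has_vector_derivative inner (w t) (abs_lsq \<phi>)) (at t within {0..})"
    using assms t by (intro bounded_linear.has_vector_derivative[OF bounded_linear_inner_left]) (simp add: ssol_def)
  moreover have "inner (ux t) (abs_lsq (deriv \<phi>)) = - inner (w t + mul V (u t) + mul a (v t)) (abs_lsq \<phi>)"
    using assms t \<phi> by (intro wdD) (simp_all add: ssol_def)
  ultimately show "((\<lambda>t. inner (v t) (abs_lsq \<phi>)) has_vector_derivative
      - inner (ux t) (abs_lsq (deriv \<phi>)) - inner (mul V (u t)) (abs_lsq \<phi>)
      - inner (mul a (v t)) (abs_lsq \<phi>)) (at t within {0..})"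
    by (simp add: inner_add_left)
qed

lemma has_vector_derivative_shift_atLeast:
  assumes "(f has_vector_derivative f') (at (t + h) within {0..})" "0 \<le> (h::real)"
  shows "((\<lambda>t. f (t + h)) has_vector_derivative f') (at t within {0..})"
proof -
  have "((\<lambda>t. t + h) has_vector_derivative 1) (at t within {0..})" by (auto intro!: derivative_eq_intros)
  moreover have "(f has_vector_derivative f') (at (t + h) within (\<lambda>t. t + h) ` {0..})"
    using assms(1) by (rule has_vector_derivative_within_subset) (use assms(2) in auto)
  ultimately show ?thesis using vector_diff_chain_within[of "\<lambda>t. t + h" 1 t "{0..}" f f'] by (simp add: comp_def)
qed

text \<open>Averaging in time commutes with the equation because the coefficients do not depend on time,
  and it turns a weak solution into a strong one.\<close>

lemma wsol_steklov:
  assumes a: "bmeas a" and V: "bmeas V" and sol: "wsol a V U Ut Ux" and h: "0 < h"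
  shows "ssol a V
    (\<lambda>t. (1/h) *\<^sub>R (integral {0..t + h} U - integral {0..t} U))
    (\<lambda>t. (1/h) *\<^sub>R (U (t + h) - U t))
    (\<lambda>t. (1/h) *\<^sub>R (Ut (t + h) - Ut t))
    (\<lambda>t. (1/h) *\<^sub>R (integral {0..t + h} Ux - integral {0..t} Ux))
    (\<lambda>t. (1/h) *\<^sub>R (Ux (t + h) - Ux t))"
proof -
  have cont: "continuous_on {0..} U" "continuous_on {0..} Ut" "continuous_on {0..} Ux"
    using sol wsol_continuous[OF sol] by (auto simp: wsol_def)
  have wdU: "wd (U t) (Ux t)" if "0 \<le> t" for t using sol that by (simp add: wsol_def)
  have diff_quot: "((\<lambda>t. (1/h) *\<^sub>R (f (t + h) - f t)) has_vector_derivative (1/h) *\<^sub>R (f' (t + h) - f' t)) (at t within {0..})"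
    if "\<And>t. 0 \<le> t \<Longrightarrow> (f has_vector_derivative f' t) (at t within {0..})" "0 \<le> t"
    for f f' :: "real \<Rightarrow> lsq" and t
    by (intro bounded_linear.has_vector_derivative[OF bounded_linear_scaleR_right] has_vector_derivative_diff
        has_vector_derivative_shift_atLeast that) (use that(2) h in auto)
  note lin = bounded_linear.linear[OF bounded_linear_mul, THEN linear_diff]
    bounded_linear.linear[OF bounded_linear_mul, THEN linear_cmul]
  show ?thesis
    unfolding ssol_def
  proof (intro allI impI conjI)
    fix t :: real assume t: "0 \<le> t"
    show "((\<lambda>t. (1/h) *\<^sub>R (integral {0..t + h} U - integral {0..t} U)) has_vector_derivative (1/h) *\<^sub>R (U (t + h) - U t)) (at t within {0..})"
      using diff_quot[OF integral_has_vector_derivative_atLeast[OF cont(1)] t] by simp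
    show "((\<lambda>t. (1/h) *\<^sub>R (integral {0..t + h} Ux - integral {0..t} Ux)) has_vector_derivative (1/h) *\<^sub>R (Ux (t + h) - Ux t)) (at t within {0..})"
      using diff_quot[OF integral_has_vector_derivative_atLeast[OF cont(3)] t] by simp
    show "((\<lambda>t. (1/h) *\<^sub>R (U (t + h) - U t)) has_vector_derivative (1/h) *\<^sub>R (Ut (t + h) - Ut t)) (at t within {0..})"
      by (rule diff_quot[OF _ t]) (use sol in \<open>simp add: wsol_def\<close>)
    show "wd ((1/h) *\<^sub>R (integral {0..t + h} U - integral {0..t} U)) ((1/h) *\<^sub>R (integral {0..t + h} Ux - integral {0..t} Ux))"
      by (intro wd_scaleR wd_diff wd_integral cont wdU)
    show "wd ((1/h) *\<^sub>R (U (t + h) - U t)) ((1/h) *\<^sub>R (Ux (t + h) - Ux t))"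
      by (intro wd_scaleR wd_diff wdU) (use t h in auto)
    \<comment> \<open>Subtracting the integrated equation at the two times cancels the initial terms
      and leaves \<open>u_xx\<close> of the average.\<close>
    have "wd (integral {0..t + h} Ux - integral {0..t} Ux)
        ((Ut (t + h) - Ut 0 + mul V (integral {0..t + h} U) + mul a (U (t + h) - U 0))
        - (Ut t - Ut 0 + mul V (integral {0..t} U) + mul a (U t - U 0)))"
      by (intro wd_diff wsol_integrated[OF a V sol]) (use t h in auto)
    from wd_scaleR[OF this, of "1/h"]
    show "wd ((1/h) *\<^sub>R (integral {0..t + h} Ux - integral {0..t} Ux))
        ((1/h) *\<^sub>R (Ut (t + h) - Ut t)
          + mul V ((1/h) *\<^sub>R (integral {0..t + h} U - integral {0..t} U))
          + mul a ((1/h) *\<^sub>R (U (t + h) - U t)))"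
      by (simp add: lin a V algebra_simps)
  qed
qed

section \<open>Weighted energy decay for strong solutions\<close>

definition energy_l :: "(real \<Rightarrow> real) \<Rightarrow> lsq \<Rightarrow> lsq \<Rightarrow> lsq \<Rightarrow> real" where
  "energy_l V u v ux = (inner v v + inner ux ux + inner (mul V u) u) / 2"

text \<open>Below, \<open>F\<close> is the functional produced by the multiplier, and \<open>J\<close> is the energy of the equation
  integrated in time: its dissipation absorbs the terms in \<open>F'\<close> that have the wrong sign.\<close>

lemma ssol_decay:
  assumes a: "bmeas a" "\<And>x. a1 / (1 + \<bar>x\<bar>) \<le> a x" and V: "bmeas V" "\<And>x. 0 \<le> V x"
    and k: "0 < k" "k \<le> 2" "k \<le> a1" and r: "0 \<le> r"
    and sol: "ssol a V u v w ux vx"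
    and supp: "\<And>t. 0 \<le> t \<Longrightarrow> supported (r + t) (u t)" "\<And>t. 0 \<le> t \<Longrightarrow> supported (r + t) (v t)"
    and G: "v 0 + mul a (u 0) = mul V G"
    and t: "0 \<le> t"
  shows "(1 + r + t) powr k * energy_l V (u t) (v t) (ux t)
    \<le> 2 * ((1 + r) powr k * energy_l V (u 0) (v 0) (ux 0)
        + (k/2) * (1 + r) powr (k - 1) * inner (u 0) (v 0)
        - (k * (k - 1) / 4) * (1 + r) powr (k - 2) * inner (u 0) (u 0)
        + (k/4) * (1 + r) powr (k - 1) * inner (mul a (u 0)) (u 0)
        + inner (u 0) (u 0) + 2 * inner (mul V G) G)"
proof -
  have wsol: "wsol a V u v ux" by (rule ssol_wsol[OF sol])
  define s where "s t = 1 + r + t" for t :: real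
  have s1: "1 \<le> s t" if "0 \<le> t" for t using that r by (simp add: s_def)
  have a_nonneg: "0 \<le> a x" for x
    using a(2)[of x] k by (meson abs_ge_zero add_nonneg_nonneg divide_nonneg_nonneg less_imp_le order_trans zero_le_one)
  have cu: "continuous_on {0..} u" "continuous_on {0..} ux" using wsol wsol_continuous[OF wsol] by (auto simp: wsol_def)
  \<comment> \<open>Finite propagation speed enters here: on the support \<open>1 + |x|\<close> is
    at most \<open>s t\<close>, so the damping is at least \<open>k / s t\<close>.\<close>
  have a_ge: "(k / s t) * inner f f \<le> inner (mul a f) f" if "0 \<le> t" "supported (r + t) f" for t f
  proof -
    have "(k / s t) * (norm f)\<^sup>2 \<le> inner (mul a f) f"
    proof (rule inner_mul_ge[OF a(1)])
      show "mul (indicator {-(r + t)..r + t}) f = f" using that(2) by (simp add: supported_def)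
      fix x assume "x \<in> {-(r + t)..r + t}"
      then have "1 + \<bar>x\<bar> \<le> s t" by (auto simp: s_def)
      then have "k / s t \<le> a1 / (1 + \<bar>x\<bar>)" using k by (intro frac_le) auto
      also have "\<dots> \<le> a x" by (rule a)
      finally show "k / s t \<le> a x" .
    qed simp
    then show ?thesis by (simp add: power2_norm_eq_inner)
  qed
  define W where "W t = integral {0..t} u" for t
  define Wx where "Wx t = integral {0..t} ux" for t
  \<comment> \<open>The last two terms are chosen for their derivatives. They cancel the products
    \<open><u, v>\<close> and \<open><a u, v>\<close> created by the multiplier and leave only
    \<open><u, u>\<close> and \<open><a u, u>\<close>.\<close>
  define F where "F t = s t powr k * ((inner (v t) (v t) + inner (ux t) (ux t) + inner (mul V (u t)) (u t)) / 2)
      + (k/2) * (s t powr (k - 1) * inner (u t) (v t))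
      - (k * (k - 1) / 4) * (s t powr (k - 2) * inner (u t) (u t))
      + (k/4) * (s t powr (k - 1) * inner (mul a (u t)) (u t))" for t
  \<comment> \<open>Since the source \<open>v 0 + a u 0\<close> equals \<open>V G\<close>, its
    contribution to the integrated energy identity is the time derivative of
    \<open>2 <V G, W>\<close>. Subtracting that leaves pure dissipation.\<close>
  define J where "J t = (inner (u t) (u t) + inner (Wx t) (Wx t) + inner (mul V (W t)) (W t)) - 2 * inner (mul V G) (W t)" for t
  have J_deriv: "(J has_vector_derivative - 2 * inner (mul a (u t)) (u t)) (at t within {0..})" if "0 \<le> t" for t
  proof -
    have "(J has_vector_derivative 2 * (inner (v 0 + mul a (u 0)) (u t) - inner (mul a (u t)) (u t))
        - 2 * inner (mul V G) (u t)) (at t within {0..})"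
      unfolding J_def W_def Wx_def
      by (intro has_vector_derivative_diff wsol_integrated_energy[OF a(1) V(1) wsol that]
          bounded_linear.has_vector_derivative[OF bounded_linear_mult_right]
          bounded_linear.has_vector_derivative[OF bounded_linear_inner_right]
          integral_has_vector_derivative_atLeast cu that)
    then show ?thesis by (simp add: G algebra_simps)
  qed
  define F' where "F' t = k * (s t powr (k - 1) * inner (v t) (v t)) - s t powr k * inner (mul a (v t)) (v t)
      + (k * (k - 1) / 4) * (s t powr (k - 2) * inner (mul a (u t)) (u t))
      - (k * (k - 1) * (k - 2) / 4) * (s t powr (k - 3) * inner (u t) (u t))" for t
  have F_deriv: "(F has_vector_derivative F' t) (at t within {0..})" if t: "0 \<le> t" for t
  proof -
    have sp: "((\<lambda>t. s t powr c) has_real_derivative c * s t powr (c - 1)) (at t within {0..})" for c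
      unfolding s_def using r t by (auto intro!: derivative_eq_intros)
    have du: "(u has_vector_derivative v t) (at t within {0..})"
      and dv: "(v has_vector_derivative w t) (at t within {0..})"
      and dux: "(ux has_vector_derivative vx t) (at t within {0..})"
      and wd1: "wd (u t) (ux t)" and wd2: "wd (v t) (vx t)"
      and wd3: "wd (ux t) (w t + mul V (u t) + mul a (v t))"
      using sol t by (simp_all add: ssol_def)
    note D = inner_self_deriv[OF dv] inner_self_deriv[OF dux] inner_mul_self_deriv[OF V(1) du]
      inner_self_deriv[OF du] inner_mul_self_deriv[OF a(1) du]
      bounded_bilinear.has_vector_derivative[OF bounded_bilinear_inner du dv]
    note D' = D[folded has_real_derivative_iff_has_vector_derivative]
    \<comment> \<open>This identity and the next are integrations by parts in space with the
      equation inserted for \<open>u_xx\<close>.\<close>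
    have sk1: "inner (ux t) (vx t) = - inner (w t) (v t) - inner (mul V (u t)) (v t) - inner (mul a (v t)) (v t)"
      using wd_skew[OF wd3 wd2] by (simp add: inner_add_left)
    have sk2: "inner (ux t) (ux t) = - inner (u t) (w t) - inner (mul V (u t)) (u t) - inner (mul a (u t)) (v t)"
      using wd_skew[OF wd3 wd1] inner_mul_left[OF a(1), of "v t" "u t"] by (simp add: inner_add_left inner_add_right inner_commute)
    have p: "k - 1 - 1 = k - 2" "k - 2 - 1 = k - 3" by simp_all
    have "(F has_real_derivative
        ((inner (v t) (v t) + inner (ux t) (ux t) + inner (mul V (u t)) (u t)) / 2) * (k * s t powr (k - 1))
        + s t powr k * ((2 * inner (v t) (w t) + 2 * inner (ux t) (vx t) + 2 * inner (mul V (u t)) (v t)) / 2)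
        + (k/2) * (inner (u t) (v t) * ((k - 1) * s t powr (k - 1 - 1)) + s t powr (k - 1) * (inner (u t) (w t) + inner (v t) (v t)))
        - (k * (k - 1) / 4) * (inner (u t) (u t) * ((k - 2) * s t powr (k - 2 - 1)) + s t powr (k - 2) * (2 * inner (u t) (v t)))
        + (k/4) * (inner (mul a (u t)) (u t) * ((k - 1) * s t powr (k - 1 - 1)) + s t powr (k - 1) * (2 * inner (mul a (u t)) (v t)))) (at t within {0..})"
      unfolding F_def
      by (rule derivative_eq_intros sp D' refl | simp only: power_one)+ (simp add: algebra_simps)
    also have "(((inner (v t) (v t) + inner (ux t) (ux t) + inner (mul V (u t)) (u t)) / 2) * (k * s t powr (k - 1))
        + s t powr k * ((2 * inner (v t) (w t) + 2 * inner (ux t) (vx t) + 2 * inner (mul V (u t)) (v t)) / 2)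
        + (k/2) * (inner (u t) (v t) * ((k - 1) * s t powr (k - 1 - 1)) + s t powr (k - 1) * (inner (u t) (w t) + inner (v t) (v t)))
        - (k * (k - 1) / 4) * (inner (u t) (u t) * ((k - 2) * s t powr (k - 2 - 1)) + s t powr (k - 2) * (2 * inner (u t) (v t)))
        + (k/4) * (inner (mul a (u t)) (u t) * ((k - 1) * s t powr (k - 1 - 1)) + s t powr (k - 1) * (2 * inner (mul a (u t)) (v t))))
      = F' t"
      unfolding F'_def sk1 sk2 p inner_commute[of "w t" "v t"] by (simp add: field_simps)
    finally show ?thesis by (simp add: has_real_derivative_iff_has_vector_derivative)
  qed
  have s_powr: "s t powr c = s t * s t powr (c - 1)" if "0 \<le> t" for t c
    using s1[OF that] by (simp add: powr_diff)
  have rate: "F' t + - 2 * inner (mul a (u t)) (u t) \<le> 0" if t: "0 \<le> t" for t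
  proof -
    have s: "1 \<le> s t" by (rule s1[OF t])
    have Na: "0 \<le> inner (mul a (u t)) (u t)" by (rule inner_mul_nonneg[OF a(1) a_nonneg])
    have "k * (s t powr (k - 1) * inner (v t) (v t)) = s t powr k * ((k / s t) * inner (v t) (v t))"
      unfolding s_powr[OF t, of k] using s by simp
    also have "\<dots> \<le> s t powr k * inner (mul a (v t)) (v t)"
      using a_ge[OF t supp(2)[OF t]] by (intro mult_left_mono) auto
    finally have 1: "k * (s t powr (k - 1) * inner (v t) (v t)) - s t powr k * inner (mul a (v t)) (v t) \<le> 0" by simp
    have p2: "s t powr (k - 2) \<le> 1" using s k powr_mono[of "k - 2" 0 "s t"] by simp
    \<comment> \<open>For \<open>k <= 2\<close> the weight \<open>s^(k-2)\<close> is at most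
      \<open>1\<close>. Each of the two leftover terms then costs at most half of
      \<open><a u, u>\<close>, within the dissipation \<open>2 <a u, u>\<close> supplied by
      \<open>J\<close>.\<close>
    have "(k * (k - 1) / 4) * (s t powr (k - 2) * inner (mul a (u t)) (u t)) \<le> (1/2) * (1 * inner (mul a (u t)) (u t))"
    proof (intro mult_mono mult_nonneg_nonneg Na p2)
      have "(k - 2) * (k + 1) \<le> 0" using k by (intro mult_nonpos_nonneg) auto
      then show "k * (k - 1) / 4 \<le> 1/2" by (simp add: algebra_simps)
    qed auto
    moreover have "- (k * (k - 1) * (k - 2) / 4) * (s t powr (k - 3) * inner (u t) (u t)) \<le> (1/2) * inner (mul a (u t)) (u t)"
    proof -
      \<comment> \<open>The left-hand side is largest at \<open>k = 3/2\<close>, so a square centred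
        there gives the bound with room to spare.\<close>
      have "- ((k - 1) * (k - 2)) \<le> 2"
        using zero_le_power2[of "k - 3/2"] by (simp add: power2_eq_square algebra_simps)
      then have "- ((k - 1) * (k - 2) / 4) * (k * (s t powr (k - 3) * inner (u t) (u t))) \<le> (1/2) * (k * (s t powr (k - 3) * inner (u t) (u t)))"
        using k by (intro mult_right_mono) auto
      moreover have "k * (s t powr (k - 3) * inner (u t) (u t)) = s t powr (k - 2) * ((k / s t) * inner (u t) (u t))"
        using s_powr[OF t, of "k - 2"] s by simp
      moreover have "\<dots> \<le> 1 * inner (mul a (u t)) (u t)"
        using a_ge[OF t supp(1)[OF t]] p2 k s by (intro mult_mono) auto
      moreover have "- (k * (k - 1) * (k - 2) / 4) * (s t powr (k - 3) * inner (u t) (u t))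
          = - ((k - 1) * (k - 2) / 4) * (k * (s t powr (k - 3) * inner (u t) (u t)))"
        by simp
      ultimately show ?thesis by linarith
    qed
    ultimately show ?thesis using 1 Na unfolding F'_def by linarith
  qed
  have "F t + J t \<le> F 0 + J 0"
    by (rule decreasing_atLeast[OF has_vector_derivative_add[OF F_deriv J_deriv] rate t])
  moreover have "J 0 = inner (u 0) (u 0)"
    using V(1) by (simp add: J_def W_def Wx_def)
  moreover have J_ge: "inner (u t) (u t) - 2 * inner (mul V G) G \<le> J t"
  proof -
    \<comment> \<open>Completing the square bounds the indefinite term of \<open>J\<close> by half
      of its own \<open><V W, W>\<close> and a constant depending on \<open>G\<close>. The factor
      \<open>2\<close> in front of \<open>G\<close> is what produces that half.\<close>
    have "0 \<le> inner (mul V (2 *\<^sub>R G - W t)) (2 *\<^sub>R G - W t)" by (rule inner_mul_nonneg[OF V])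
    also have "\<dots> = 4 * inner (mul V G) G - 4 * inner (mul V G) (W t) + inner (mul V (W t)) (W t)"
      using inner_mul_left[OF V(1), of "W t" G] V(1)
      by (simp add: bounded_linear.linear[OF bounded_linear_mul, THEN linear_diff]
          bounded_linear.linear[OF bounded_linear_mul, THEN linear_cmul] inner_diff_left inner_diff_right inner_commute)
    finally have "2 * inner (mul V G) (W t) \<le> 2 * inner (mul V G) G + inner (mul V (W t)) (W t) / 2" by simp
    moreover have "0 \<le> inner (mul V (W t)) (W t)" by (rule inner_mul_nonneg[OF V])
    moreover have "0 \<le> inner (Wx t) (Wx t)" by simp
    ultimately show ?thesis unfolding J_def by linarith
  qed
  ultimately have mono: "F t + inner (u t) (u t) \<le> F 0 + inner (u 0) (u 0) + 2 * inner (mul V G) G"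
    by linarith
  have "s t powr k * energy_l V (u t) (v t) (ux t) \<le> 2 * (F t + inner (u t) (u t))"
  proof -
    define p2 where "p2 = s t powr (k - 2)"
    have s: "1 \<le> s t" by (rule s1[OF t])
    have p1: "s t powr (k - 1) = s t * p2" using s_powr[OF t, of "k - 1"] by (simp add: p2_def)
    have p0: "s t powr k = s t * (s t * p2)" using s_powr[OF t, of k] p1 by simp
    have p2_le: "0 \<le> p2" "p2 \<le> 1" using s k powr_mono[of "k - 2" 0 "s t"] by (simp_all add: p2_def)
    define qv qx qV where "qv = s t * (s t * p2) * inner (v t) (v t)"
      and "qx = s t * (s t * p2) * inner (ux t) (ux t)"
      and "qV = s t * (s t * p2) * inner (mul V (u t)) (u t)"
    define quv qu quu qa where "quv = k * (s t * p2) * inner (u t) (v t)"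
      and "qu = k * p2 * inner (u t) (u t)" and "quu = k * k * p2 * inner (u t) (u t)"
      and "qa = k * (s t * p2) * inner (mul a (u t)) (u t)"
    note q_defs = qv_def qx_def qV_def quv_def qu_def quu_def qa_def
    \<comment> \<open>This square bounds the cross term of \<open>F\<close> from below at the price
      of half the kinetic part and a quarter of \<open>quu\<close>. Together with the correction in
      \<open>F\<close>, half of \<open>quu\<close> must be paid: one quarter by \<open>qa\<close>,
      the other by the added \<open><u, u>\<close>.\<close>
    have "0 \<le> p2 * inner (s t *\<^sub>R v t + k *\<^sub>R u t) (s t *\<^sub>R v t + k *\<^sub>R u t)" using p2_le by simp
    also have "\<dots> = qv + 2 * quv + quu"
      unfolding q_defs by (simp add: inner_add_left inner_add_right inner_commute algebra_simps)
    finally have "0 \<le> qv + 2 * quv + quu" .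
    moreover have "quu \<le> 4 * inner (u t) (u t)"
    proof -
      have "k * k * p2 * inner (u t) (u t) \<le> 2 * 2 * 1 * inner (u t) (u t)"
        using k p2_le by (intro mult_right_mono mult_mono) auto
      then show ?thesis by (simp add: quu_def)
    qed
    moreover have "quu \<le> qa"
    proof -
      have "(k * (s t * p2)) * ((k / s t) * inner (u t) (u t)) \<le> (k * (s t * p2)) * inner (mul a (u t)) (u t)"
        using a_ge[OF t supp(1)[OF t]] s p2_le k by (intro mult_left_mono) auto
      then show ?thesis unfolding quu_def qa_def using s by (simp add: mult_ac)
    qed
    moreover have "0 \<le> qu" using k p2_le by (simp add: qu_def)
    moreover have "0 \<le> qx" using s p2_le by (simp add: qx_def)
    moreover have "0 \<le> qV" using s p2_le inner_mul_nonneg[OF V] by (simp add: qV_def)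
    moreover have "F t = (qv + qx + qV) / 2 + quv / 2 - (quu - qu) / 4 + qa / 4"
      unfolding F_def p1 p0 p2_def[symmetric] q_defs by (simp add: algebra_simps add_divide_distrib diff_divide_distrib)
    moreover have "s t powr k * energy_l V (u t) (v t) (ux t) = (qv + qx + qV) / 2"
      unfolding energy_l_def p0 q_defs by (simp add: algebra_simps)
    ultimately show ?thesis by (simp add: field_simps)
  qed
  also have "\<dots> \<le> 2 * (F 0 + inner (u 0) (u 0) + 2 * inner (mul V G) G)"
    using mono by simp
  finally show ?thesis by (simp add: F_def s_def energy_l_def mult.assoc)
qed

subsection \<open>Decay of weak solutions and the weak formulation in time\<close>

text \<open>Recovers a solution and its derivatives, also at \<open>t = 0\<close>, as limits of the
  averages with step \<open>h\<close>.\<close>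

lemma has_vector_derivative_right_quotient:
  fixes f :: "real \<Rightarrow> 'a::real_normed_vector"
  assumes "(f has_vector_derivative D) (at t within {0..})" "0 \<le> t"
  shows "((\<lambda>h. (1/h) *\<^sub>R (f (t + h) - f t)) \<longlongrightarrow> D) (at_right 0)"
proof -
  have "filterlim (\<lambda>h. t + h) (at t within {0..}) (at_right 0)"
    unfolding filterlim_at
  proof
    show "\<forall>\<^sub>F h in at_right 0. t + h \<in> {0..} \<and> t + h \<noteq> t"
      using assms(2) by (auto simp: eventually_at_right_field intro!: exI[of _ 1])
    have "((\<lambda>h. t + h) \<longlongrightarrow> t + 0) (at_right 0)" by (intro tendsto_intros)
    then show "((\<lambda>h. t + h) \<longlongrightarrow> t) (at_right 0)" by simp
  qed
  from filterlim_compose[OF assms(1)[unfolded has_vector_derivative_iff_quotient] this]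
  show ?thesis by (simp add: inverse_eq_divide)
qed

text \<open>For the averages, \<open>ssol_decay\<close> bounds the weighted energy by a continuous
  function of their data at time \<open>0\<close>. As \<open>h\<close> tends to \<open>0\<close>
  these data converge to those of the solution, so the bound survives without any second
  derivative.\<close>

lemma wsol_decay:
  assumes a: "bmeas a" "\<And>x. a1 / (1 + \<bar>x\<bar>) \<le> a x"
    and V: "bmeas V" "continuous_on UNIV V" "\<And>x. 0 < V x"
    and k: "0 < k" "k \<le> 2" "k \<le> a1" and R: "0 \<le> R"
    and sol: "wsol a V U Ut Ux"
    and supp: "\<And>t. 0 \<le> t \<Longrightarrow> supported (R + t) (U t)"
  obtains K where "\<And>t. 0 \<le> t \<Longrightarrow> (2 + R + t) powr k * energy_l V (U t) (Ut t) (Ux t) \<le> K"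
proof -
  \<comment> \<open>Averages look ahead by \<open>h < 1\<close>, so their supports may exceed that
    of the solution by up to \<open>1\<close>.\<close>
  define r where "r = R + 1"
  \<comment> \<open>The continuous positive \<open>V\<close> has a positive minimum on
    \<open>[-r, r]\<close>, so its reciprocal cut off there is bounded. It supplies the
    \<open>G\<close> demanded by \<open>ssol_decay\<close>.\<close>
  define b where "b x = indicator {-r..r} x / V x" for x
  have b: "bmeas b"
  proof -
    have "compact {-r..r}" "{-r..r} \<noteq> {}" using R by (auto simp: r_def)
    then obtain y where y: "\<And>x. x \<in> {-r..r} \<Longrightarrow> V y \<le> V x"
      using continuous_attains_inf[of "{-r..r}" V] continuous_on_subset[OF V(2)] by blast
    have "\<bar>b x\<bar> \<le> 1 / V y" for x
      using y[of x] V(3)[of x] V(3)[of y] by (auto simp: b_def indicator_def intro!: divide_left_mono)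
    moreover have "b \<in> borel_measurable borel"
    proof -
      have [measurable]: "V \<in> borel_measurable borel" using V(1) by (simp add: bmeas_def)
      show ?thesis unfolding b_def[abs_def] by measurable
    qed
    ultimately show ?thesis by (auto simp: bmeas_def bounded_iff)
  qed
  have Vb: "mul V (mul b f) = f" if "supported r f" for f
  proof -
    have "V x \<noteq> 0" for x using V(3)[of x] by simp
    then have "(\<lambda>x. V x * b x) = indicator {-r..r}" by (simp add: b_def fun_eq_iff)
    then show ?thesis using that by (simp add: mul_mul[OF V(1) b] supported_def)
  qed
  \<comment> \<open>The right-hand side of \<open>ssol_decay\<close> with this \<open>G\<close>,
    regarded as a function of the data, so that continuity in the data can be used.\<close>
  define Q where "Q u v x = 2 * ((1 + r) powr k * energy_l V u v x
        + (k/2) * (1 + r) powr (k - 1) * inner u v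
        - (k * (k - 1) / 4) * (1 + r) powr (k - 2) * inner u u
        + (k/4) * (1 + r) powr (k - 1) * inner (mul a u) u
        + inner u u + 2 * inner (mul V (mul b (v + mul a u))) (mul b (v + mul a u)))" for u v x
  define u where "u h t = (1/h) *\<^sub>R (integral {0..t + h} U - integral {0..t} U)" for h t
  define v where "v h t = (1/h) *\<^sub>R (U (t + h) - U t)" for h t
  define ux where "ux h t = (1/h) *\<^sub>R (integral {0..t + h} Ux - integral {0..t} Ux)" for h t
  have cont: "continuous_on {0..} U" "continuous_on {0..} Ux"
    using sol wsol_continuous[OF sol] by (auto simp: wsol_def)
  have lim: "((\<lambda>h. u h t) \<longlongrightarrow> U t) (at_right 0)" "((\<lambda>h. v h t) \<longlongrightarrow> Ut t) (at_right 0)"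
    "((\<lambda>h. ux h t) \<longlongrightarrow> Ux t) (at_right 0)" if "0 \<le> t" for t
    unfolding u_def v_def ux_def
    using sol that by (auto simp: wsol_def intro!: has_vector_derivative_right_quotient
        integral_has_vector_derivative_atLeast cont)
  have bound: "(1 + r + t) powr k * energy_l V (u h t) (v h t) (ux h t) \<le> Q (u h 0) (v h 0) (ux h 0)"
    if h: "0 < h" "h < 1" and t: "0 \<le> t" for h t
    unfolding Q_def
  proof (rule ssol_decay[OF a V(1) _ k])
    show "ssol a V (u h) (v h) (\<lambda>t. (1/h) *\<^sub>R (Ut (t + h) - Ut t)) (ux h) (\<lambda>t. (1/h) *\<^sub>R (Ux (t + h) - Ux t))"
      using wsol_steklov[OF a(1) V(1) sol h(1)] unfolding u_def[abs_def] v_def[abs_def] ux_def[abs_def] .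
    show us: "supported (r + t) (u h t)" if t: "0 \<le> t" for t
      unfolding u_def
    proof (intro supported_scaleR supported_diff supported_integral cont)
      show "supported (r + t) (U s)" if "0 \<le> s" "s \<le> t + h" for s
        using that h by (intro supported_mono[OF supp]) (simp_all add: r_def)
      show "supported (r + t) (U s)" if "0 \<le> s" "s \<le> t" for s
        using that h by (intro supported_mono[OF supp]) (simp_all add: r_def)
    qed
    show vs: "supported (r + t) (v h t)" if t: "0 \<le> t" for t
      unfolding v_def
      by (intro supported_scaleR supported_diff supported_mono[OF supp]) (use h t in \<open>auto simp: r_def\<close>)
    have "supported r (v h 0 + mul a (u h 0))"
      using us[of 0] vs[of 0] by (auto intro!: supported_add supported_mul a)
    from Vb[OF this] show "v h 0 + mul a (u h 0) = mul V (mul b (v h 0 + mul a (u h 0)))" by simp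
  qed (use R t V(3) in \<open>auto simp: r_def less_imp_le\<close>)
  note mul_lim = bounded_linear.tendsto[OF bounded_linear_mul]
  have "(1 + r + t) powr k * energy_l V (U t) (Ut t) (Ux t) \<le> Q (U 0) (Ut 0) (Ux 0)" if t: "0 \<le> t" for t
  proof (rule tendsto_le)
    show "((\<lambda>h. Q (u h 0) (v h 0) (ux h 0)) \<longlongrightarrow> Q (U 0) (Ut 0) (Ux 0)) (at_right 0)"
      unfolding Q_def energy_l_def by (intro tendsto_intros mul_lim a(1) V(1) b lim order_refl) simp_all
    show "((\<lambda>h. (1 + r + t) powr k * energy_l V (u h t) (v h t) (ux h t)) \<longlongrightarrow>
        (1 + r + t) powr k * energy_l V (U t) (Ut t) (Ux t)) (at_right 0)"
      unfolding energy_l_def by (intro tendsto_intros mul_lim V(1) lim t) simp_all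
    show "\<forall>\<^sub>F h in at_right 0. (1 + r + t) powr k * energy_l V (u h t) (v h t) (ux h t) \<le> Q (u h 0) (v h 0) (ux h 0)"
      unfolding eventually_at_right_field using bound t by (intro exI[of _ 1]) auto
  qed simp
  then show thesis by (intro that[of "Q (U 0) (Ut 0) (Ux 0)"]) (simp add: r_def add.commute)
qed

section \<open>Distributional derivatives in time\<close>

lemma test_fun_pos_support:
  assumes "test_fun_pos \<theta>"
  obtains c d where "0 < c" "c \<le> d" "\<And>x. x \<notin> {c..d} \<Longrightarrow> \<theta> x = 0" "\<And>x. x \<notin> {c..d} \<Longrightarrow> deriv \<theta> x = 0"
proof -
  have K: "compact (fsupp \<theta>)" "fsupp \<theta> \<subseteq> {0<..}" using assms by (auto simp: test_fun_pos_def)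
  obtain c d where cd: "0 < c" "c \<le> d" "fsupp \<theta> \<subseteq> {c..d}"
  proof (cases "fsupp \<theta> = {}")
    case True
    then show thesis using that[of 1 2] by simp
  next
    case False
    obtain c where c: "c \<in> fsupp \<theta>" "\<And>x. x \<in> fsupp \<theta> \<Longrightarrow> c \<le> x"
      using compact_attains_inf[OF K(1) False] by blast
    obtain d where d: "d \<in> fsupp \<theta>" "\<And>x. x \<in> fsupp \<theta> \<Longrightarrow> x \<le> d"
      using compact_attains_sup[OF K(1) False] by blast
    show thesis using that[of c d] c d K(2) by (auto simp: subset_iff)
  qed
  have z: "\<theta> x = 0" if "x \<notin> {c..d}" for x
    using cd(3) that closure_subset[of "{x. \<theta> x \<noteq> 0}"] unfolding fsupp_def by blast
  have "deriv \<theta> x = 0" if "x \<notin> {c..d}" for x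
  proof (rule DERIV_imp_deriv)
    have "((\<lambda>_. 0) has_real_derivative 0) (at x)" by simp
    then show "(\<theta> has_real_derivative 0) (at x)"
      by (rule has_field_derivative_transform_within_open[of _ _ _ "- {c..d}"]) (use that z in auto)
  qed
  then show thesis using that[OF cd(1,2) z] by blast
qed

lemma continuous_on_atLeast_isCont:
  fixes f :: "real \<Rightarrow> 'a::topological_space"
  assumes "continuous_on {0..} f" "0 < t"
  shows "isCont f t"
proof -
  have "continuous_on {0<..} f" using assms(1) by (rule continuous_on_subset) auto
  then show ?thesis using assms(2) by (simp add: continuous_on_eq_continuous_at)
qed

lemma integrable_compact_interval:
  fixes f :: "real \<Rightarrow> real"
  assumes "\<And>x. c \<le> x \<Longrightarrow> x \<le> d \<Longrightarrow> isCont f x" "\<And>x. x \<notin> {c..d} \<Longrightarrow> f x = 0"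
  shows "integrable lborel f"
proof -
  have "integrable lborel (\<lambda>x. f x * indicator {c..d} x)"
    by (rule borel_integrable_atLeastAtMost) (use assms(1) in auto)
  moreover have "f x * indicator {c..d} x = f x" for x
    by (cases "x \<in> {c..d}") (simp_all add: assms(2))
  ultimately show ?thesis by simp
qed

lemma test_fun_pos_integrable:
  assumes "test_fun_pos \<theta>" "continuous_on {0..} f"
  shows "integrable lborel (\<lambda>t. \<theta> t * f t)" "integrable lborel (\<lambda>t. deriv \<theta> t * f t)"
proof -
  obtain c d where cd: "0 < c" "\<And>x. x \<notin> {c..d} \<Longrightarrow> \<theta> x = 0" "\<And>x. x \<notin> {c..d} \<Longrightarrow> deriv \<theta> x = 0"
    by (rule test_fun_pos_support[OF assms(1)]) blast
  have s: "smooth_fun \<theta>" using assms(1) by (simp add: test_fun_pos_def)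
  have c: "isCont \<theta> x" "isCont (deriv \<theta>) x" for x
    using smooth_fun_continuous[OF s, of UNIV] smooth_fun_continuous[OF smooth_fun_deriv[OF s], of UNIV]
    by (simp_all add: continuous_on_eq_continuous_at)
  show "integrable lborel (\<lambda>t. \<theta> t * f t)"
    by (rule integrable_compact_interval[of c d])
      (use cd c in \<open>auto intro!: continuous_intros continuous_on_atLeast_isCont[OF assms(2)]\<close>)
  show "integrable lborel (\<lambda>t. deriv \<theta> t * f t)"
    by (rule integrable_compact_interval[of c d])
      (use cd c in \<open>auto intro!: continuous_intros continuous_on_atLeast_isCont[OF assms(2)]\<close>)
qed

lemma test_fun_pos_parts:
  fixes f :: "real \<Rightarrow> real"
  assumes \<theta>: "test_fun_pos \<theta>" and f': "continuous_on {0..} f'"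
    and f: "\<And>t. 0 \<le> t \<Longrightarrow> (f has_vector_derivative f' t) (at t within {0..})"
  shows "(\<integral>t. deriv \<theta> t * f t \<partial>lborel) = - (\<integral>t. \<theta> t * f' t \<partial>lborel)"
proof -
  obtain c d where cd: "0 < c" "c \<le> d" "\<And>x. x \<notin> {c..d} \<Longrightarrow> \<theta> x = 0" "\<And>x. x \<notin> {c..d} \<Longrightarrow> deriv \<theta> x = 0"
    by (rule test_fun_pos_support[OF \<theta>]) blast
  have s: "smooth_fun \<theta>" using \<theta> by (simp add: test_fun_pos_def)
  have c: "isCont \<theta> x" "isCont (deriv \<theta>) x" for x
    using smooth_fun_continuous[OF s, of UNIV] smooth_fun_continuous[OF smooth_fun_deriv[OF s], of UNIV]
    by (simp_all add: continuous_on_eq_continuous_at)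
  have fc: "continuous_on {0..} f" by (rule continuous_on_vector_derivative) (use f in auto)
  \<comment> \<open>The support may reach \<open>c\<close> and \<open>d\<close>, but by continuity
    \<open>\<theta>\<close> vanishes there because it vanishes just outside.\<close>
  have zero: "\<theta> c = 0" "\<theta> d = 0"
  proof -
    have "closed {x. \<theta> x = 0}"
      using smooth_fun_continuous[OF s, of UNIV] by (intro closed_Collect_eq) simp_all
    moreover have "{..<c} \<subseteq> {x. \<theta> x = 0}" "{d<..} \<subseteq> {x. \<theta> x = 0}" using cd(3) by auto
    ultimately have "closure {..<c} \<subseteq> {x. \<theta> x = 0}" "closure {d<..} \<subseteq> {x. \<theta> x = 0}"
      by (simp_all only: closure_minimal)
    then show "\<theta> c = 0" "\<theta> d = 0" by (simp_all add: subset_iff)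
  qed
  have "(\<integral>t. (deriv \<theta> t * f t + f' t * \<theta> t) * indicator {c..d} t \<partial>lborel) = \<theta> d * f d - \<theta> c * f c"
  proof (rule integral_FTC_Icc_real[OF cd(2)])
    fix x assume x: "c \<le> x" "x \<le> d"
    have "at x within {0..} = at x" using x cd(1) by (intro at_within_interior) (simp add: interior_real_atLeast)
    then have "(f has_real_derivative f' x) (at x)"
      using f[of x] x cd(1) by (simp add: has_real_derivative_iff_has_vector_derivative)
    then show "((\<lambda>t. \<theta> t * f t) has_real_derivative deriv \<theta> x * f x + f' x * \<theta> x) (at x)"
      by (intro DERIV_mult smooth_fun_has_deriv[OF s])
    show "isCont (\<lambda>t. deriv \<theta> t * f t + f' t * \<theta> t) x"
      using x cd(1) by (intro continuous_intros c continuous_on_atLeast_isCont[OF fc] continuous_on_atLeast_isCont[OF f']) auto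
  qed
  also have "(\<lambda>t. (deriv \<theta> t * f t + f' t * \<theta> t) * indicator {c..d} t) = (\<lambda>t. deriv \<theta> t * f t + \<theta> t * f' t)"
    using cd(3,4) by (auto simp: indicator_def fun_eq_iff)
  finally show ?thesis
    using test_fun_pos_integrable[OF \<theta> f'] test_fun_pos_integrable[OF \<theta> fc] by (simp add: zero)
qed

lemma smooth_step:
  assumes "0 < e"
  obtains S where "\<And>x. (S has_real_derivative bump 1 0 e x) (at x)"
    "\<And>x. x \<le> 0 \<Longrightarrow> S x = 0" "\<And>x. e \<le> x \<Longrightarrow> S x = S e"
proof -
  \<comment> \<open>Starting at \<open>-1\<close> keeps \<open>0\<close> away from the end of the
    interval; for \<open>x < -1\<close> the interval is empty and the integral is
    \<open>0\<close>.\<close>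
  define S where "S x = integral {-1..x} (bump 1 0 e)" for x
  have c: "continuous_on A (bump 1 0 e)" for A by (intro smooth_fun_continuous smooth_bump)
  have z: "bump 1 0 e x = 0" if "x \<le> 0" for x using that by (intro bump_eq_0) auto
  have S0: "S x = 0" if "x \<le> 0" for x
  proof -
    have "S x = integral {-1..x} (\<lambda>_. 0)" unfolding S_def using that z by (intro integral_cong) auto
    then show ?thesis by simp
  qed
  have D: "(S has_real_derivative bump 1 0 e x) (at x)" for x
  proof (cases "x < 0")
    case True
    have "((\<lambda>_. 0) has_real_derivative 0) (at x)" by simp
    then have "(S has_real_derivative 0) (at x)"
      by (rule has_field_derivative_transform_within_open[of _ _ _ "{..<0}"]) (use True S0 in auto)
    then show ?thesis using True z by simp
  next
    case False
    have "(S has_real_derivative bump 1 0 e x) (at x within {-1..x + 1})"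
      unfolding S_def by (rule integral_has_real_derivative[OF c]) (use False in auto)
    moreover have "at x within {-1..x + 1} = at x" using False by (intro at_within_Icc_at) auto
    ultimately show ?thesis by simp
  qed
  have "S x = S e" if "e \<le> x" for x
  proof -
    have "\<exists>c. \<forall>y\<in>{e..}. S y = c"
    proof (rule has_field_derivative_zero_constant)
      fix y assume "y \<in> {e..}"
      then have "bump 1 0 e y = 0" by (intro bump_eq_0) auto
      then show "(S has_real_derivative 0) (at y within {e..})"
        using D[of y] by (simp add: has_field_derivative_at_within)
    qed simp
    then show ?thesis using that by auto
  qed
  then show thesis using that[OF D S0] by blast
qed

text \<open>Du Bois-Reymond. The test function is a difference of two translated smooth steps, so that its
  derivative is a difference of two translated bumps.\<close>

lemma weakly_constant:
  fixes n :: "real \<Rightarrow> real"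
  assumes n: "continuous_on {0..} n"
    and weak: "\<And>\<theta>. test_fun_pos \<theta> \<Longrightarrow> (\<integral>t. deriv \<theta> t * n t \<partial>lborel) = 0"
    and t: "0 \<le> t"
  shows "n t = n 0"
proof -
  have n_cont: "isCont (\<lambda>x. n (x + q)) x" if "0 < x + q" for q x
  proof (rule isCont_o2[where g = n])
    show "isCont n (x + q)" using that by (rule continuous_on_atLeast_isCont[OF n])
  qed simp
  \<comment> \<open>One inequality suffices, since \<open>s\<close> and \<open>t\<close> can be
    exchanged.\<close>
  have le: "n s \<le> n t" if s: "0 < s" and t: "0 < t" for s t
  proof (rule ccontr)
    assume "\<not> n s \<le> n t"
    then have pos0: "0 < n s - n t" by simp
    have "isCont (\<lambda>x. n (x + s) - n (x + t)) 0"
      using s t by (intro continuous_diff n_cont) simp_all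
    then have "\<forall>e>0. \<exists>d>0. \<forall>x. dist x 0 < d \<longrightarrow>
        dist (n (x + s) - n (x + t)) (n (0 + s) - n (0 + t)) < e"
      by (simp only: continuous_at_eps_delta)
    with pos0 have "\<exists>d>0. \<forall>x. dist x 0 < d \<longrightarrow>
        dist (n (x + s) - n (x + t)) (n (0 + s) - n (0 + t)) < n s - n t" by blast
    then obtain d where d: "0 < d"
      "\<And>x. dist x 0 < d \<Longrightarrow> dist (n (x + s) - n (x + t)) (n (0 + s) - n (0 + t)) < n s - n t"
      by blast
    \<comment> \<open>Halving keeps the whole closed interval \<open>[0, e]\<close> inside the
      neighbourhood given by continuity.\<close>
    define e where "e = d / 2"
    have e: "0 < e" using d by (simp add: e_def)
    have pos: "0 < n (x + s) - n (x + t)" if "0 \<le> x" "x \<le> e" for x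
    proof -
      have "dist (n (x + s) - n (x + t)) (n (0 + s) - n (0 + t)) < n s - n t"
        by (rule d(2)) (use that d(1) in \<open>simp add: e_def dist_real_def\<close>)
      then show ?thesis unfolding dist_real_def by simp
    qed
    let ?b = "bump 1 0 e"
    obtain S where S: "\<And>x. (S has_real_derivative ?b x) (at x)"
      "\<And>x. x \<le> 0 \<Longrightarrow> S x = 0" "\<And>x. e \<le> x \<Longrightarrow> S x = S e"
      using smooth_step[OF e] by metis
    \<comment> \<open>A single step is no test function, as it stays at the height
      \<open>S e\<close>; the difference of two has bounded support because the heights
      cancel.\<close>
    define \<theta> where "\<theta> x = S (x - s) - S (x - t)" for x
    have \<theta>': "(\<theta> has_real_derivative ?b (x - s) - ?b (x - t)) (at x)" for x
    proof -
      have "((\<lambda>x. S (x - q)) has_real_derivative ?b (x - q)) (at x)" for q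
        using DERIV_affine_compose[of S "?b (x - q)" 1 x "- q"] S(1)[of "x - q"] by simp
      then show ?thesis unfolding \<theta>_def by (intro DERIV_diff)
    qed
    have smooth: "smooth_fun \<theta>"
    proof (rule smooth_fun_antideriv[OF \<theta>'])
      have "smooth_fun (\<lambda>x. -1)" by (simp add: smooth_fun_iff_kdiff kdiff_const)
      then have "smooth_fun (\<lambda>x. ?b (1 * x + - s) + (-1) * ?b (1 * x + - t))"
        using smooth_fun_affine[OF smooth_bump, of 1 0 e 1 "- s"] smooth_fun_affine[OF smooth_bump, of 1 0 e 1 "- t"]
        by (intro smooth_fun_add smooth_fun_mult)
      then show "smooth_fun (\<lambda>x. ?b (x - s) - ?b (x - t))" by simp
    qed
    have sub: "fsupp \<theta> \<subseteq> {min s t..max s t + e}"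
    proof (rule fsupp_subset)
      fix x assume x: "x \<notin> {min s t..max s t + e}"
      show "\<theta> x = 0"
      proof (cases "x < min s t")
        case True then show ?thesis by (simp add: \<theta>_def S(2))
      next
        case False
        then have "e \<le> x - s" "e \<le> x - t" using x by auto
        then show ?thesis using S(3)[of "x - s"] S(3)[of "x - t"] by (simp add: \<theta>_def)
      qed
    qed simp
    have cpt: "compact (fsupp \<theta>)"
      using bounded_subset[OF bounded_closed_interval sub] by (simp add: compact_eq_bounded_closed fsupp_def)
    have sub0: "fsupp \<theta> \<subseteq> {0<..}" by (rule order_trans[OF sub]) (use s t in auto)
    have "test_fun_pos \<theta>" unfolding test_fun_pos_def by (intro conjI smooth cpt sub0)
    then have "(\<integral>x. deriv \<theta> x * n x \<partial>lborel) = 0" by (rule weak)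
    then have int0: "(\<integral>x. (?b (x - s) - ?b (x - t)) * n x \<partial>lborel) = 0"
      using DERIV_imp_deriv[OF \<theta>'] by simp
    have b_cont: "isCont ?b x" for x
      using smooth_fun_continuous[OF smooth_bump, of UNIV] by (simp add: continuous_on_eq_continuous_at)
    have b_cont': "isCont (\<lambda>x. ?b (x - q)) x" for q x
      by (rule isCont_o2[where g = ?b]) (simp_all add: b_cont)
    have b0: "?b x = 0" if "x \<notin> {0..e}" for x using that by (intro bump_eq_0) auto
    have int: "integrable lborel (\<lambda>x. ?b (x - q) * n x)" if "0 < q" for q
    proof (rule integrable_compact_interval[of q "q + e"])
      show "isCont (\<lambda>x. ?b (x - q) * n x) x" if "q \<le> x" for x
        using n_cont[of x 0] that \<open>0 < q\<close> by (intro continuous_mult b_cont') simp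
      show "?b (x - q) * n x = 0" if "x \<notin> {q..q + e}" for x
        using b0[of "x - q"] that by auto
    qed
    have shift: "(\<integral>x. ?b (x - q) * n x \<partial>lborel) = (\<integral>x. ?b x * n (x + q) \<partial>lborel)" for q
      using integral_shift[of "\<lambda>x. ?b (x - q) * n x" q] by simp
    have int': "integrable lborel (\<lambda>x. ?b x * n (x + q))" if "0 < q" for q
    proof (rule integrable_compact_interval[of 0 e])
      show "isCont (\<lambda>x. ?b x * n (x + q)) x" if "0 \<le> x" for x
        using that \<open>0 < q\<close> by (intro continuous_mult b_cont n_cont) simp
    qed (simp add: b0)
    \<comment> \<open>Moving both bumps to the same place turns the weak identity into a vanishing
      integral of a nonnegative function that is positive on \<open>(0, e)\<close>.\<close>
    have "(\<integral>x. ?b x * (n (x + s) - n (x + t)) \<partial>lborel) = 0"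
      using int0 int[OF s] int[OF t] int'[OF s] int'[OF t]
      by (simp add: left_diff_distrib right_diff_distrib shift)
    moreover have "integrable lborel (\<lambda>x. ?b x * (n (x + s) - n (x + t)))"
      using int'[OF s] int'[OF t] by (simp add: right_diff_distrib)
    moreover have nn: "0 \<le> ?b x * (n (x + s) - n (x + t))" for x
    proof (cases "x \<in> {0..e}")
      case True
      then show ?thesis using pos[of x] bump_nonneg[of 1 0 e x] by simp
    qed (simp add: b0)
    ultimately have "AE x in lborel. ?b x * (n (x + s) - n (x + t)) = 0"
      using integral_nonneg_eq_0_iff_AE[of lborel "\<lambda>x. ?b x * (n (x + s) - n (x + t))"] by simp
    then have "AE x in lborel. x \<notin> {0<..<e}"
    proof eventually_elim
      case (elim x)
      show ?case
      proof
        assume x: "x \<in> {0<..<e}"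
        then have "0 < ?b x * (n (x + s) - n (x + t))"
          by (intro mult_pos_pos bump_pos pos) auto
        with elim show False by linarith
      qed
    qed
    then have "emeasure lborel {0<..<e} = 0"
      using AE_iff_null_sets[of "{0<..<e}" lborel] by (intro null_setsD1) simp
    then show False using e by simp
  qed
  have pos: "n t = n 1" if "0 < t" for t using le[of t 1] le[of 1 t] that by simp
  \<comment> \<open>Test functions do not see time \<open>0\<close>; its value is reached by
    continuity from the right.\<close>
  have "(n \<longlongrightarrow> n 0) (at_right 0)"
  proof (rule tendsto_within_subset)
    show "(n \<longlongrightarrow> n 0) (at 0 within {0..})" using n by (simp add: continuous_on_def)
  qed auto
  moreover have "(n \<longlongrightarrow> n 1) (at_right 0)"
    by (rule tendsto_eventually) (auto simp: eventually_at_right_field intro!: exI[of _ 1] pos)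
  ultimately have "n 0 = n 1" by (rule tendsto_unique[OF trivial_limit_at_right_real])
  moreover have "n t = n 1" if "t \<noteq> 0" using t that by (intro pos) simp
  ultimately show ?thesis by (cases "t = 0") simp_all
qed

text \<open>Adding an antiderivative \<open>M\<close> of \<open>m\<close> cancels the weak
  derivative, so \<open>k + M\<close> is constant and \<open>k\<close> is as differentiable as
  \<open>M\<close>, up to and including time \<open>0\<close>.\<close>

lemma weak_derivative_classical:
  fixes k m :: "real \<Rightarrow> real"
  assumes k: "continuous_on {0..} k" and m: "continuous_on {0..} m"
    and weak: "\<And>\<theta>. test_fun_pos \<theta> \<Longrightarrow> - (\<integral>t. deriv \<theta> t * k t \<partial>lborel) + (\<integral>t. \<theta> t * m t \<partial>lborel) = 0"
    and t: "0 \<le> t"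
  shows "(k has_vector_derivative - m t) (at t within {0..})"
proof -
  define M where "M t = integral {0..t} m" for t
  have M: "(M has_vector_derivative m t) (at t within {0..})" if "0 \<le> t" for t
    unfolding M_def by (rule integral_has_vector_derivative_atLeast[OF m that])
  have Mc: "continuous_on {0..} M" by (rule continuous_on_vector_derivative[OF M]) simp
  have const: "k s + M s = k 0 + M 0" if "0 \<le> s" for s
  proof (rule weakly_constant[where n = "\<lambda>s. k s + M s", OF _ _ that])
    show "continuous_on {0..} (\<lambda>s. k s + M s)" by (intro continuous_on_add k Mc)
    fix \<theta> assume \<theta>: "test_fun_pos \<theta>"
    show "(\<integral>t. deriv \<theta> t * (k t + M t) \<partial>lborel) = 0"
      using weak[OF \<theta>] test_fun_pos_parts[OF \<theta> m M] test_fun_pos_integrable[OF \<theta> k] test_fun_pos_integrable[OF \<theta> Mc]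
      by (simp add: distrib_left)
  qed
  have "((\<lambda>s. k 0 + M 0 - M s) has_vector_derivative - m t) (at t within {0..})"
    using has_vector_derivative_diff[OF has_vector_derivative_const M[OF t], of "k 0 + M 0"] by simp
  then show ?thesis
  proof (rule has_vector_derivative_transform[rotated 2])
    show "k s = k 0 + M 0 - M s" if "s \<in> {0..}" for s using const[of s] that by simp
  qed (use t in simp)
qed

subsection \<open>Weak solutions\<close>

text \<open>Connects limits stated with \<open>L2norm\<close> to the topology of classes. Membership
  is asked only on \<open>S\<close>, because the curves are unconstrained at negative times.\<close>

lemma L2norm_tendsto_iff:
  assumes "\<And>t. t \<in> S \<Longrightarrow> L2 (w t)" "L2 v"
  shows "((\<lambda>t. L2norm (\<lambda>x. w t x - v x)) \<longlongrightarrow> 0) (at t0 within S) \<longleftrightarrow>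
    ((\<lambda>t. abs_lsq (w t)) \<longlongrightarrow> abs_lsq v) (at t0 within S)"
proof -
  have eq: "L2norm (\<lambda>x. w t x - v x) = norm (abs_lsq (w t) - abs_lsq v)" if "t \<in> S" for t
    using norm_abs_lsq[OF L2_diff[OF assms(1)[OF that] assms(2)]] assms(1)[OF that] assms(2)
    by (simp add: abs_lsq_diff)
  have "((\<lambda>t. L2norm (\<lambda>x. w t x - v x)) \<longlongrightarrow> 0) (at t0 within S) \<longleftrightarrow>
      ((\<lambda>t. norm (abs_lsq (w t) - abs_lsq v)) \<longlongrightarrow> 0) (at t0 within S)"
    by (rule Lim_cong_within) (simp_all add: eq)
  then show ?thesis by (simp only: tendsto_norm_zero_iff LIM_zero_iff)
qed

lemma L2_cont_iff:
  "L2_cont w \<longleftrightarrow> (\<forall>t\<ge>0. L2 (w t)) \<and> continuous_on {0..} (\<lambda>t. abs_lsq (w t))"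
proof (cases "\<forall>t\<ge>0. L2 (w t)")
  case True
  then have "((\<lambda>t. L2norm (\<lambda>x. w t x - w t0 x)) \<longlongrightarrow> 0) (at t0 within {0..}) \<longleftrightarrow>
      ((\<lambda>t. abs_lsq (w t)) \<longlongrightarrow> abs_lsq (w t0)) (at t0 within {0..})" if "0 \<le> t0" for t0
    using that by (intro L2norm_tendsto_iff) simp_all
  with True show ?thesis by (simp add: L2_cont_def continuous_on_def Ball_def)
qed (auto simp: L2_cont_def)

lemma L2norm_derivative_iff:
  assumes u: "\<And>t. 0 \<le> t \<Longrightarrow> L2 (u t)" and v: "L2 v" and t0: "0 \<le> t0"
  shows "((\<lambda>t. L2norm (\<lambda>x. (u t x - u t0 x) / (t - t0) - v x)) \<longlongrightarrow> 0) (at t0 within {0..}) \<longleftrightarrow>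
    ((\<lambda>t. abs_lsq (u t)) has_vector_derivative abs_lsq v) (at t0 within {0..})"
proof -
  have q: "L2 (\<lambda>x. (u t x - u t0 x) / (t - t0))"
    "abs_lsq (\<lambda>x. (u t x - u t0 x) / (t - t0)) = (abs_lsq (u t) - abs_lsq (u t0)) /\<^sub>R (t - t0)"
    if "t \<in> {0..}" for t
    using L2_scale[OF L2_diff[OF u[of t] u[OF t0]], of "inverse (t - t0)"]
      abs_lsq_scale[OF L2_diff[OF u[of t] u[OF t0]], of "inverse (t - t0)"] u[of t] u[OF t0] that
    by (simp_all add: abs_lsq_diff divide_inverse mult.commute)
  have "((\<lambda>t. L2norm (\<lambda>x. (u t x - u t0 x) / (t - t0) - v x)) \<longlongrightarrow> 0) (at t0 within {0..}) \<longleftrightarrow>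
      ((\<lambda>t. abs_lsq (\<lambda>x. (u t x - u t0 x) / (t - t0))) \<longlongrightarrow> abs_lsq v) (at t0 within {0..})"
    by (rule L2norm_tendsto_iff[OF q(1) v])
  also have "\<dots> \<longleftrightarrow> ((\<lambda>t. (abs_lsq (u t) - abs_lsq (u t0)) /\<^sub>R (t - t0)) \<longlongrightarrow> abs_lsq v) (at t0 within {0..})"
    by (rule Lim_cong_within) (simp_all only: q(2))
  finally show ?thesis by (simp only: has_vector_derivative_iff_quotient)
qed

lemma wd_abs_lsq_iff:
  assumes "L2 f" "L2 g"
  shows "wd (abs_lsq f) (abs_lsq g) \<longleftrightarrow> weak_deriv f g"
  unfolding wd_def weak_deriv_def
  using assms by (auto simp: inner_abs_lsq test_fun_L2 test_fun_deriv)

definition weak_eq ::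
  "(real \<Rightarrow> real) \<Rightarrow> (real \<Rightarrow> real) \<Rightarrow> (real \<Rightarrow> lsq) \<Rightarrow> (real \<Rightarrow> lsq) \<Rightarrow> (real \<Rightarrow> lsq) \<Rightarrow> bool" where
  "weak_eq a V U Ut Ux \<longleftrightarrow> (\<forall>\<phi> \<theta>. test_fun \<phi> \<longrightarrow> test_fun_pos \<theta> \<longrightarrow>
     - (\<integral>t. deriv \<theta> t * inner (Ut t) (abs_lsq \<phi>) \<partial>lborel)
     + (\<integral>t. \<theta> t * (inner (Ux t) (abs_lsq (deriv \<phi>)) + inner (mul V (U t)) (abs_lsq \<phi>)
          + inner (mul a (Ut t)) (abs_lsq \<phi>)) \<partial>lborel) = 0)"

lemma weak_eq_abs_lsq_iff:
  assumes a: "bmeas a" and V: "bmeas V"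
    and L: "\<And>t. 0 \<le> t \<Longrightarrow> L2 (u t)" "\<And>t. 0 \<le> t \<Longrightarrow> L2 (ut t)" "\<And>t. 0 \<le> t \<Longrightarrow> L2 (ux t)"
  shows "weak_eq a V (\<lambda>t. abs_lsq (u t)) (\<lambda>t. abs_lsq (ut t)) (\<lambda>t. abs_lsq (ux t)) \<longleftrightarrow>
    (\<forall>\<phi> \<theta>. test_fun \<phi> \<longrightarrow> test_fun_pos \<theta> \<longrightarrow>
        - (\<integral>t. deriv \<theta> t * (\<integral>x. ut t x * \<phi> x \<partial>lborel) \<partial>lborel)
        + (\<integral>t. \<theta> t * ((\<integral>x. ux t x * deriv \<phi> x \<partial>lborel)
                        + (\<integral>x. V x * u t x * \<phi> x \<partial>lborel)
                        + (\<integral>x. a x * ut t x * \<phi> x \<partial>lborel)) \<partial>lborel) = 0)"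
proof -
  have eq: "deriv \<theta> t * inner (abs_lsq (ut t)) (abs_lsq \<phi>) = deriv \<theta> t * (\<integral>x. ut t x * \<phi> x \<partial>lborel)"
    "\<theta> t * (inner (abs_lsq (ux t)) (abs_lsq (deriv \<phi>)) + inner (mul V (abs_lsq (u t))) (abs_lsq \<phi>)
        + inner (mul a (abs_lsq (ut t))) (abs_lsq \<phi>))
      = \<theta> t * ((\<integral>x. ux t x * deriv \<phi> x \<partial>lborel) + (\<integral>x. V x * u t x * \<phi> x \<partial>lborel)
        + (\<integral>x. a x * ut t x * \<phi> x \<partial>lborel))"
    if \<phi>: "test_fun \<phi>" and \<theta>: "test_fun_pos \<theta>" for \<phi> \<theta> t
  proof -
    have P: "L2 \<phi>" "L2 (deriv \<phi>)" using \<phi> by (auto intro: test_fun_L2 test_fun_deriv)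
    obtain c d where c: "0 < c" "\<And>x. x \<notin> {c..d} \<Longrightarrow> \<theta> x = 0" "\<And>x. x \<notin> {c..d} \<Longrightarrow> deriv \<theta> x = 0"
      using test_fun_pos_support[OF \<theta>] by metis
    \<comment> \<open>At negative times the functions may fail to be square-integrable and their
      classes are then meaningless, but \<open>\<theta>\<close> and its derivative vanish
      there.\<close>
    have z: "0 \<le> t \<or> \<theta> t = 0 \<and> deriv \<theta> t = 0" using c(1) c(2,3)[of t] by force
    show "deriv \<theta> t * inner (abs_lsq (ut t)) (abs_lsq \<phi>) = deriv \<theta> t * (\<integral>x. ut t x * \<phi> x \<partial>lborel)"
      "\<theta> t * (inner (abs_lsq (ux t)) (abs_lsq (deriv \<phi>)) + inner (mul V (abs_lsq (u t))) (abs_lsq \<phi>)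
        + inner (mul a (abs_lsq (ut t))) (abs_lsq \<phi>))
      = \<theta> t * ((\<integral>x. ux t x * deriv \<phi> x \<partial>lborel) + (\<integral>x. V x * u t x * \<phi> x \<partial>lborel)
        + (\<integral>x. a x * ut t x * \<phi> x \<partial>lborel))"
      using z L[of t] P a V by (auto simp: inner_abs_lsq mul_abs_lsq L2_mul)
  qed
  show ?thesis unfolding weak_eq_def by (simp add: eq cong: imp_cong)
qed

text \<open>For each fixed spatial test function, integration by parts in time gives one direction
  and \<open>weak_derivative_classical\<close> the other.\<close>

lemma weak_eq_iff_derivative:
  assumes a: "bmeas a" and V: "bmeas V"
    and cont: "continuous_on {0..} U" "continuous_on {0..} Ut" "continuous_on {0..} Ux"
  shows "weak_eq a V U Ut Ux \<longleftrightarrow> (\<forall>\<phi> t. test_fun \<phi> \<longrightarrow> 0 \<le> t \<longrightarrow>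
      ((\<lambda>t. inner (Ut t) (abs_lsq \<phi>)) has_vector_derivative
        - inner (Ux t) (abs_lsq (deriv \<phi>)) - inner (mul V (U t)) (abs_lsq \<phi>)
        - inner (mul a (Ut t)) (abs_lsq \<phi>)) (at t within {0..}))"
proof -
  define m where "m \<phi> t = inner (Ux t) (abs_lsq (deriv \<phi>)) + inner (mul V (U t)) (abs_lsq \<phi>)
      + inner (mul a (Ut t)) (abs_lsq \<phi>)" for \<phi> t
  have m: "continuous_on {0..} (m \<phi>)" for \<phi>
    unfolding m_def by (intro continuous_intros cont bounded_linear.continuous_on[OF bounded_linear_mul] a V)
  have k: "continuous_on {0..} (\<lambda>t. inner (Ut t) (abs_lsq \<phi>))" for \<phi>
    by (intro continuous_intros cont)
  have "(\<forall>\<theta>. test_fun_pos \<theta> \<longrightarrow> - (\<integral>t. deriv \<theta> t * inner (Ut t) (abs_lsq \<phi>) \<partial>lborel) + (\<integral>t. \<theta> t * m \<phi> t \<partial>lborel) = 0)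
      \<longleftrightarrow> (\<forall>t\<ge>0. ((\<lambda>t. inner (Ut t) (abs_lsq \<phi>)) has_vector_derivative - m \<phi> t) (at t within {0..}))" for \<phi>
  proof safe
    fix t :: real
    assume "\<forall>\<theta>. test_fun_pos \<theta> \<longrightarrow> - (\<integral>t. deriv \<theta> t * inner (Ut t) (abs_lsq \<phi>) \<partial>lborel) + (\<integral>t. \<theta> t * m \<phi> t \<partial>lborel) = 0"
      and "0 \<le> t"
    then show "((\<lambda>t. inner (Ut t) (abs_lsq \<phi>)) has_vector_derivative - m \<phi> t) (at t within {0..})"
      by (intro weak_derivative_classical[OF k m]) simp_all
  next
    fix \<theta> assume D: "\<forall>t\<ge>0. ((\<lambda>t. inner (Ut t) (abs_lsq \<phi>)) has_vector_derivative - m \<phi> t) (at t within {0..})"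
      and \<theta>: "test_fun_pos \<theta>"
    have "(\<integral>t. deriv \<theta> t * inner (Ut t) (abs_lsq \<phi>) \<partial>lborel) = - (\<integral>t. \<theta> t * - m \<phi> t \<partial>lborel)"
      by (rule test_fun_pos_parts[OF \<theta>]) (use D m in \<open>auto intro: continuous_on_minus\<close>)
    then show "- (\<integral>t. deriv \<theta> t * inner (Ut t) (abs_lsq \<phi>) \<partial>lborel) + (\<integral>t. \<theta> t * m \<phi> t \<partial>lborel) = 0"
      by simp
  qed
  then have *: "weak_eq a V U Ut Ux \<longleftrightarrow> (\<forall>\<phi>. test_fun \<phi> \<longrightarrow>
      (\<forall>t\<ge>0. ((\<lambda>t. inner (Ut t) (abs_lsq \<phi>)) has_vector_derivative - m \<phi> t) (at t within {0..})))"
    unfolding weak_eq_def m_def[symmetric] by blast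
  have "- m \<phi> t = - inner (Ux t) (abs_lsq (deriv \<phi>)) - inner (mul V (U t)) (abs_lsq \<phi>)
        - inner (mul a (Ut t)) (abs_lsq \<phi>)" for \<phi> t by (simp add: m_def)
  then show ?thesis unfolding * by simp
qed

text \<open>The passage between functions and classes: existence uses it from right to left,
  uniqueness from left to right.\<close>

lemma weak_solution_iff_wsol:
  assumes a: "bmeas a" and V: "bmeas V" and data: "L2 u0" "L2 u1"
  shows "weak_solution a V u0 u1 u ut ux \<longleftrightarrow>
    (\<forall>t\<ge>0. L2 (u t) \<and> L2 (ut t) \<and> L2 (ux t)) \<and>
    wsol a V (\<lambda>t. abs_lsq (u t)) (\<lambda>t. abs_lsq (ut t)) (\<lambda>t. abs_lsq (ux t)) \<and>
    abs_lsq (u 0) = abs_lsq u0 \<and> abs_lsq (ut 0) = abs_lsq u1"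
proof (cases "\<forall>t\<ge>0. L2 (u t) \<and> L2 (ut t) \<and> L2 (ux t)")
  case True
  then have L: "\<And>t. 0 \<le> t \<Longrightarrow> L2 (u t)" "\<And>t. 0 \<le> t \<Longrightarrow> L2 (ut t)" "\<And>t. 0 \<le> t \<Longrightarrow> L2 (ux t)" by blast+
  have init: "(AE x in lborel. u 0 x = u0 x) \<longleftrightarrow> abs_lsq (u 0) = abs_lsq u0"
    "(AE x in lborel. ut 0 x = u1 x) \<longleftrightarrow> abs_lsq (ut 0) = abs_lsq u1"
    using L data by (simp_all add: abs_lsq_eq_iff)
  have H1: "(\<forall>t\<ge>0. H1 (u t) (ux t)) \<longleftrightarrow> (\<forall>t\<ge>0. wd (abs_lsq (u t)) (abs_lsq (ux t)))"
    using L by (simp add: H1_def wd_abs_lsq_iff)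
  have D: "(\<forall>t0\<ge>0. ((\<lambda>t. L2norm (\<lambda>x. (u t x - u t0 x) / (t - t0) - ut t0 x)) \<longlongrightarrow> 0) (at t0 within {0..}))
      \<longleftrightarrow> (\<forall>t\<ge>0. ((\<lambda>t. abs_lsq (u t)) has_vector_derivative abs_lsq (ut t)) (at t within {0..}))"
    using L2norm_derivative_iff[of u, OF L(1) L(2)] by simp
  have cont: "continuous_on {0..} (\<lambda>t. abs_lsq (u t))"
    if "\<forall>t\<ge>0. ((\<lambda>t. abs_lsq (u t)) has_vector_derivative abs_lsq (ut t)) (at t within {0..})"
    by (rule continuous_on_vector_derivative) (use that in auto)
  have weak: "weak_solution a V u0 u1 u ut ux \<longleftrightarrow>
      L2_cont u \<and> L2_cont ux \<and> (\<forall>t\<ge>0. wd (abs_lsq (u t)) (abs_lsq (ux t))) \<and> L2_cont ut \<and>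
      (\<forall>t\<ge>0. ((\<lambda>t. abs_lsq (u t)) has_vector_derivative abs_lsq (ut t)) (at t within {0..})) \<and>
      weak_eq a V (\<lambda>t. abs_lsq (u t)) (\<lambda>t. abs_lsq (ut t)) (\<lambda>t. abs_lsq (ux t)) \<and>
      abs_lsq (u 0) = abs_lsq u0 \<and> abs_lsq (ut 0) = abs_lsq u1"
    unfolding weak_solution_def H1 D init
    by (subst weak_eq_abs_lsq_iff[OF a V L]) (assumption | rule refl)+
  show ?thesis
    unfolding weak L2_cont_iff wsol_def
    using L cont by (auto simp: weak_eq_iff_derivative[OF a V])
next
  case False
  then show ?thesis by (auto simp: weak_solution_def L2_cont_iff)
qed

lemma energy_eq_energy_l:
  assumes V: "bmeas V" "\<And>x. 0 \<le> V x" and L: "L2 (u t)" "L2 (ut t)" "L2 (ux t)"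
  shows "energy V u ut ux t = energy_l V (abs_lsq (u t)) (abs_lsq (ut t)) (abs_lsq (ux t))"
proof -
  have "(L2norm (\<lambda>x. sqrt (V x) * u t x))\<^sup>2 = (\<integral>x. (sqrt (V x) * u t x)\<^sup>2 \<partial>lborel)"
    by (simp add: L2norm_def)
  also have "\<dots> = (\<integral>x. V x * u t x * u t x \<partial>lborel)"
    using V(2) by (simp add: power_mult_distrib) (simp add: power2_eq_square mult.assoc)
  finally have "(L2norm (\<lambda>x. sqrt (V x) * u t x))\<^sup>2 = inner (mul V (abs_lsq (u t))) (abs_lsq (u t))"
    using V L by (simp add: mul_abs_lsq inner_abs_lsq L2_mul)
  then show ?thesis
    using L by (simp add: energy_def energy_l_def power2_norm_eq_inner flip: norm_abs_lsq)
qed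

lemma energy_l_nonneg: "bmeas V \<Longrightarrow> (\<And>x. 0 \<le> V x) \<Longrightarrow> 0 \<le> energy_l V u v w"
  by (simp add: energy_l_def inner_mul_nonneg)

theorem theorem1p2:
  fixes a V :: "real \<Rightarrow> real" and a1 a2 R :: real and u0 u1 :: "real \<Rightarrow> real"
  assumes a_cont: "continuous_on UNIV a"
    and a1_pos: "a1 > 0" and a2_pos: "a2 > 0"
    and a_bounds: "\<And>x. a1 / (1 + \<bar>x\<bar>) \<le> a x \<and> a x \<le> a2 / (1 + \<bar>x\<bar>)"
    and V_C1: "V C1_differentiable_on UNIV"
    and V_bdd: "bounded (range V)"
    and V_pos: "\<And>x. V x > 0"
    and V_deriv: "\<And>x. x * deriv V x \<le> 0"
    and R_pos: "R > 0"
    and u0_H1: "\<exists>u0'. H1 u0 u0'"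
    and u1_L2: "L2 u1"
    and supp: "AE x in lborel. \<bar>x\<bar> > R \<longrightarrow> u0 x = 0 \<and> u1 x = 0"
  shows "\<exists>u ut ux.
           weak_solution a V u0 u1 u ut ux
         \<and> (\<forall>v vt vx. weak_solution a V u0 u1 v vt vx \<longrightarrow>
               (\<forall>t\<ge>0. AE x in lborel. v t x = u t x))
         \<and> (\<forall>t\<ge>0. AE x in lborel. \<bar>x\<bar> > R + t \<longrightarrow> u t x = 0)
         \<and> (a1 \<le> 2 \<longrightarrow> (\<exists>\<delta>0>0. \<forall>\<delta>. 0 < \<delta> \<and> \<delta> < \<delta>0 \<longrightarrow>
               energy V u ut ux \<in> O[at_top](\<lambda>t. t powr (- a1 + \<delta>))))
         \<and> (a1 > 2 \<longrightarrow> energy V u ut ux \<in> O[at_top](\<lambda>t. t powr (-2)))"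
proof -
  have a_ge: "a1 / (1 + \<bar>x\<bar>) \<le> a x" and a_nonneg: "0 \<le> a x" and a_le: "a x \<le> a2" for x
  proof -
    show "a1 / (1 + \<bar>x\<bar>) \<le> a x" using a_bounds by blast
    moreover have "0 \<le> a1 / (1 + \<bar>x\<bar>)" using a1_pos by simp
    ultimately show "0 \<le> a x" by linarith
    have "a x \<le> a2 / (1 + \<bar>x\<bar>)" using a_bounds by blast
    also have "\<dots> \<le> a2 / 1" using a2_pos by (intro divide_left_mono) auto
    finally show "a x \<le> a2" by simp
  qed
  have V_nonneg: "0 \<le> V x" for x using V_pos[of x] by simp
  have V_cont: "continuous_on UNIV V" using V_C1 by (rule C1_differentiable_imp_continuous_on)
  have a: "bmeas a"
    using borel_measurable_continuous_onI[OF a_cont] a_nonneg a_le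
    by (auto simp: bmeas_def bounded_iff intro!: exI[of _ a2])
  have V: "bmeas V" using borel_measurable_continuous_onI[OF V_cont] V_bdd by (simp add: bmeas_def)
  obtain u0' where u0': "H1 u0 u0'" using u0_H1 by blast
  then have u0: "L2 u0" and "wd (abs_lsq u0) (abs_lsq u0')" by (simp_all add: H1_def wd_abs_lsq_iff)
  moreover have "supported R (abs_lsq u0)" "supported R (abs_lsq u1)"
    by (rule supported_abs_lsq; use u0 u1_L2 supp in \<open>auto elim: AE_mp\<close>)+
  ultimately obtain U Ut Ux where sol: "wsol a V U Ut Ux"
    and init: "U 0 = abs_lsq u0" "Ut 0 = abs_lsq u1"
    and U_supp: "\<And>t. 0 \<le> t \<Longrightarrow> supported (R + t) (U t)"
    using wsol_exists[OF a V, of "abs_lsq u0" "abs_lsq u0'" R "abs_lsq u1"] R_pos by (metis less_imp_le)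
  \<comment> \<open>Representatives are chosen separately at each time, which is harmless because
    being a weak solution depends only on their classes.\<close>
  define u ut ux where "u t = rep_lsq (U t)" and "ut t = rep_lsq (Ut t)" and "ux t = rep_lsq (Ux t)" for t
  have weak: "weak_solution a V u0 u1 u ut ux"
    unfolding weak_solution_iff_wsol[OF a V u0 u1_L2] using sol init
    by (simp add: u_def ut_def ux_def L2_rep)
  have unique: "AE x in lborel. v t x = u t x"
    if v: "weak_solution a V u0 u1 v vt vx" and t: "0 \<le> t" for v vt vx t
  proof -
    have v': "L2 (v t)" "wsol a V (\<lambda>t. abs_lsq (v t)) (\<lambda>t. abs_lsq (vt t)) (\<lambda>t. abs_lsq (vx t))"
      "abs_lsq (v 0) = U 0" "abs_lsq (vt 0) = Ut 0"
      using v t by (simp_all add: weak_solution_iff_wsol[OF a V u0 u1_L2] init)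
    have "abs_lsq (v t) = U t"
      by (rule wsol_unique[OF a a_nonneg V V_nonneg v'(2) sol v'(3,4) t])
    then show ?thesis using abs_lsq_eq_iff[OF v'(1) L2_rep, of "U t"] by (simp add: u_def)
  qed
  have support: "AE x in lborel. \<bar>x\<bar> > R + t \<longrightarrow> u t x = 0" if "0 \<le> t" for t
    using U_supp[OF that] by (simp add: supported_iff u_def)
  \<comment> \<open>Applied below with \<open>k = a1\<close> when \<open>a1 <= 2\<close> and with
    \<open>k = 2\<close> when \<open>a1 > 2\<close>.\<close>
  have decay: "energy V u ut ux \<in> O[at_top](\<lambda>t. t powr - k)" if k: "0 < k" "k \<le> 2" "k \<le> a1" for k
  proof -
    obtain K where K: "\<And>t. 0 \<le> t \<Longrightarrow> (2 + R + t) powr k * energy_l V (U t) (Ut t) (Ux t) \<le> K"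
      by (rule wsol_decay[OF a a_ge V V_cont V_pos k _ sol U_supp]) (use R_pos in auto)
    have bound: "norm (energy V u ut ux t) \<le> K * norm (t powr - k)" if t: "1 \<le> t" for t
    proof -
      have e: "energy V u ut ux t = energy_l V (U t) (Ut t) (Ux t)"
        using energy_eq_energy_l[OF V V_nonneg, of u t ut ux] by (simp add: u_def ut_def ux_def L2_rep)
      have nn: "0 \<le> energy_l V (U t) (Ut t) (Ux t)" by (rule energy_l_nonneg[OF V V_nonneg])
      have "t powr k * energy_l V (U t) (Ut t) (Ux t) \<le> (2 + R + t) powr k * energy_l V (U t) (Ut t) (Ux t)"
        using t R_pos k nn by (intro mult_right_mono powr_mono2) auto
      also have "\<dots> \<le> K" using t by (intro K) simp
      finally have "energy_l V (U t) (Ut t) (Ux t) \<le> K * t powr - k"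
        using t by (simp add: powr_minus field_simps)
      then show ?thesis using nn by (simp add: e)
    qed
    show ?thesis
    proof (rule bigoI)
      show "\<forall>\<^sub>F t in at_top. norm (energy V u ut ux t) \<le> K * norm (t powr - k)"
        using eventually_ge_at_top[of 1] by eventually_elim (rule bound)
    qed
  qed
  have case1: "energy V u ut ux \<in> O[at_top](\<lambda>t. t powr (- a1 + \<delta>))" if "a1 \<le> 2" "0 < \<delta>" for \<delta>
  proof -
    have "(\<lambda>t. t powr - a1) \<in> O[at_top](\<lambda>t::real. t powr (- a1 + \<delta>))"
    proof (rule bigoI[of _ 1])
      show "\<forall>\<^sub>F t in at_top. norm (t powr - a1) \<le> 1 * norm ((t::real) powr (- a1 + \<delta>))"
        using eventually_ge_at_top[of 1] by eventually_elim (use that in \<open>auto intro!: powr_mono\<close>)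
    qed
    with decay[OF a1_pos that(1) order_refl] show ?thesis by (rule landau_o.big.trans)
  qed
  have case2: "energy V u ut ux \<in> O[at_top](\<lambda>t. t powr (-2))" if "2 < a1"
    using decay[of 2] that by simp
  show ?thesis
  proof (intro exI conjI allI impI)
    show "weak_solution a V u0 u1 u ut ux" by (rule weak)
    \<comment> \<open>The witness for the threshold \<open>\<delta>0\<close> is \<open>1\<close>;
      any positive number serves, since \<open>case1\<close> covers every positive
      \<open>\<delta>\<close>.\<close>
    show "(0::real) < 1" by simp
  qed (use unique support case1 case2 in auto)
qed

end
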